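(* Let $A=\mathrm{diag}(a_1,a_2,a_3)$ be a real diagonal matrix with pairwise distinct diagonal entries, and let $X\in\mathfrak{gl}(3,\mathbb R)$ be such that the spectral curve $C_X$ is smooth. Let $X(t)$ be the solution of the differential equation $\frac{d}{dt}X=[X^2,A]$ with initial condition $X$. Then the following statements hold. 1. If the real part of $C_X$ has one oval, then $X(t)$ blows up. 2. If the real part of $C_X$ has two ovals, then $X(t)$ blows up if and only if the hexagon $H_X$ is of type $(0,6)$ or $(4,2)$; if $H_X$ is of type $(6,0)$ or $(2,4)$, then $X(t)$ exists for all times $t\in\mathbb R$.
   Context: $\mathfrak{gl}(3,\mathbb R)$ is the space of real $3\times3$ matrices. For $z=(z_1,z_2,z_3)$ put $X_z=z_3X+z_1A-z_2\,\mathrm{Id}$. The spectral curve of $X=(x_{ij})$ is $C_X=\{(z_1:z_2:z_3)\in\mathbb{CP}^2 : \det X_z=0\}$, a real cubic curve. Its real part is $C_X\cap\mathbb{RP}^2$; when $C_X$ is smooth, the connected components of the real part are closed curves called ovals, and there are one or two of them. If there are two ovals, exactly one of them is contractible in $\mathbb{RP}^2$. Hexagon $H_X$ (for $C_X$ smooth): let $M_{ij}$ be the $(i,j)$ minor of $X_z$ (delete row $i$ and column $j$). For $i\ne j$ one has $M_{ij}=z_3L_{ij}$, where $L_{ij}$ is a linear form in $z_1,z_2,z_3$; explicitly, up to sign, $L_{ij}=x_{ki}x_{jk}z_3-x_{ji}(x_{kk}z_3+a_kz_1-z_2)$ for $\{i,j,k\}=\{1,2,3\}$. When $C_X$ is smooth,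 $L_{ij}\not\equiv0$. Let $l_{ij}$ be the projective line $L_{ij}=0$. For every permutation $(i,j,k)$ of $(1,2,3)$ put $P_i=l_{ij}\cap l_{ik}$ and $Q_i=l_{ji}\cap l_{ki}$; these are well-defined points lying in the real part of $C_X$. $H_X$ is the hexagon with vertices $P_1,Q_2,P_3,Q_1,P_2,Q_3$. $H_X$ has type $(m,n)$ if $m$ of its six vertices (counted as labelled vertices) lie on the contractible oval of $C_X$ and $n$ of them lie on the non-contractible oval. "A solution blows up" means that it blows up in finite time both forward and backward in time. *)

theory Defs
  imports "HOL-Analysis.Analysis"
begin

subsection \<open>The projective planes\<close>

text \<open>A point of the projective plane over a field is represented by the set of all its
  homogeneous coordinate vectors.\<close>

definition proj_pt :: "'a::field^3 \<Rightarrow> ('a^3) set" where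
  "proj_pt v = {c *s v | c. c \<noteq> 0}"

definition rp2_points :: "(real^3) set set" where
  "rp2_points = {proj_pt v | v. v \<noteq> 0}"

text \<open>The quotient topology with respect to \<open>proj_pt\<close> on \<open>- {0}\<close>.\<close>

definition rp2 :: "(real^3) set topology" where
  "rp2 = topology (\<lambda>U. U \<subseteq> rp2_points \<and> open {v. v \<noteq> 0 \<and> proj_pt v \<in> U})"

lemma openin_rp2:
  "openin rp2 U \<longleftrightarrow> U \<subseteq> rp2_points \<and> open {v. v \<noteq> 0 \<and> proj_pt v \<in> U}"
proof -
  have "istopology (\<lambda>U. U \<subseteq> rp2_points \<and> open {v::real^3. v \<noteq> 0 \<and> proj_pt v \<in> U})"
    unfolding istopology_def
  proof (intro conjI allI impI)
    fix S T :: "(real^3) set set"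
    assume S: "S \<subseteq> rp2_points \<and> open {v::real^3. v \<noteq> 0 \<and> proj_pt v \<in> S}"
      and T: "T \<subseteq> rp2_points \<and> open {v::real^3. v \<noteq> 0 \<and> proj_pt v \<in> T}"
    show "S \<inter> T \<subseteq> rp2_points" using S by blast
    have eq: "{v::real^3. v \<noteq> 0 \<and> proj_pt v \<in> S \<inter> T} =
        {v. v \<noteq> 0 \<and> proj_pt v \<in> S} \<inter> {v. v \<noteq> 0 \<and> proj_pt v \<in> T}" by blast
    show "open {v::real^3. v \<noteq> 0 \<and> proj_pt v \<in> S \<inter> T}"
      unfolding eq using S T by (intro open_Int) simp_all
  next
    fix K :: "(real^3) set set set"
    assume K: "\<forall>S\<in>K. S \<subseteq> rp2_points \<and> open {v::real^3. v \<noteq> 0 \<and> proj_pt v \<in> S}"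
    show "\<Union> K \<subseteq> rp2_points" using K by blast
    have eq: "{v::real^3. v \<noteq> 0 \<and> proj_pt v \<in> \<Union> K} =
        (\<Union>S\<in>K. {v. v \<noteq> 0 \<and> proj_pt v \<in> S})" by blast
    show "open {v::real^3. v \<noteq> 0 \<and> proj_pt v \<in> \<Union> K}"
      unfolding eq using K by (intro open_UN) simp
  qed
  then show ?thesis by (simp add: rp2_def)
qed

lemma topspace_rp2: "topspace rp2 = rp2_points"
proof
  show "topspace rp2 \<subseteq> rp2_points"
    using openin_rp2[of "topspace rp2"] by simp
  have "{v::real^3. v \<noteq> 0 \<and> proj_pt v \<in> rp2_points} = - {0}"
    by (auto simp: rp2_points_def)
  then have "openin rp2 rp2_points"
    by (simp add: openin_rp2 open_Compl)
  then show "rp2_points \<subseteq> topspace rp2"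
    by (rule openin_subset)
qed

subsection \<open>The spectral curve\<close>

text \<open>The matrix \<open>X\<^sub>z = z\<^sub>3 X + z\<^sub>1 A - z\<^sub>2 Id\<close>, for real or complex \<open>z\<close>.\<close>

definition pencil :: "real^3^3 \<Rightarrow> real^3^3 \<Rightarrow> 'a::real_field^3 \<Rightarrow> 'a^3^3" where
  "pencil A X z =
    (\<chi> i j. z$3 * of_real (X$i$j) + z$1 * of_real (A$i$j) - mat (z$2) $ i $ j)"

definition spectral_poly :: "real^3^3 \<Rightarrow> real^3^3 \<Rightarrow> complex^3 \<Rightarrow> complex" where
  "spectral_poly A X z = det (pencil A X z)"

definition spectral_curve :: "real^3^3 \<Rightarrow> real^3^3 \<Rightarrow> (complex^3) set set" where
  "spectral_curve A X = {proj_pt z | z. z \<noteq> 0 \<and> spectral_poly A X z = 0}"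

text \<open>Smoothness as a plane cubic: at every point of the curve some partial derivative of the
  defining cubic form is nonzero.\<close>

definition smooth_spectral_curve :: "real^3^3 \<Rightarrow> real^3^3 \<Rightarrow> bool" where
  "smooth_spectral_curve A X \<longleftrightarrow>
    (\<forall>z. z \<noteq> 0 \<and> spectral_poly A X z = 0 \<longrightarrow>
      (\<exists>j. deriv (\<lambda>w. spectral_poly A X (\<chi> i. if i = j then w else z$i)) (z$j) \<noteq> 0))"

text \<open>The points of \<open>\<real>P\<^sup>2\<close> whose image under \<open>\<real>P\<^sup>2 \<hookrightarrow> \<complex>P\<^sup>2\<close> is on the curve.\<close>

definition real_part :: "real^3^3 \<Rightarrow> real^3^3 \<Rightarrow> (real^3) set set" where
  "real_part A X =
    {proj_pt v | v. v \<noteq> 0 \<and> proj_pt (\<chi> i. complex_of_real (v$i)) \<in> spectral_curve A X}"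

definition ovals :: "real^3^3 \<Rightarrow> real^3^3 \<Rightarrow> (real^3) set set set" where
  "ovals A X = connected_components_of (subtopology rp2 (real_part A X))"

text \<open>Contractible in \<open>\<real>P\<^sup>2\<close>: the inclusion map is null-homotopic (this is not the contractibility
  of \<open>S\<close> as a space).\<close>

definition contractible_in_rp2 :: "(real^3) set set \<Rightarrow> bool" where
  "contractible_in_rp2 S \<longleftrightarrow>
    (\<exists>p. homotopic_with (\<lambda>_. True) (subtopology rp2 S) rp2 (\<lambda>x. x) (\<lambda>_. p))"

subsection \<open>The hexagon\<close>

text \<open>For \<open>{i,j,k} = {1,2,3}\<close>, \<open>minor_form A X i j k\<close> is the linear form \<open>L\<^sub>i\<^sub>j\<close> with
  \<open>M\<^sub>i\<^sub>j = \<plusminus> z\<^sub>3 L\<^sub>i\<^sub>j\<close>, and the third index \<open>k\<close> is passed explicitly.\<close>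

definition minor_form ::
  "real^3^3 \<Rightarrow> real^3^3 \<Rightarrow> 3 \<Rightarrow> 3 \<Rightarrow> 3 \<Rightarrow> real^3 \<Rightarrow> real" where
  "minor_form A X i j k z =
    X$k$i * X$j$k * z$3 - X$j$i * (X$k$k * z$3 + A$k$k * z$1 - z$2)"

lemma cofactor_pencil:
  assumes "\<And>p q. p \<noteq> q \<Longrightarrow> A$p$q = 0" and "i \<noteq> j" "j \<noteq> k" "i \<noteq> k"
  shows "det (\<chi> r c. if r = i then (if c = j then 1 else 0) else pencil A X z $ r $ c)
    = z$3 * minor_form A X i j k z"
proof -
  have A: "A$1$2 = 0" "A$1$3 = 0" "A$2$1 = 0" "A$2$3 = 0" "A$3$1 = 0" "A$3$2 = 0"
    using assms(1) by simp_all
  consider "i = 1" "j = 2" "k = 3" | "i = 1" "j = 3" "k = 2" | "i = 2" "j = 1" "k = 3"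
    | "i = 2" "j = 3" "k = 1" | "i = 3" "j = 1" "k = 2" | "i = 3" "j = 2" "k = 1"
    by (rule disjE[OF exhaust_3[of i]]; rule disjE[OF exhaust_3[of j]])
       (use assms(2-4) exhaust_3[of i] exhaust_3[of j] exhaust_3[of k] in blast)+
  then show ?thesis
    by cases (hypsubst, simp add: det_3 pencil_def minor_form_def mat_def A,
      simp add: algebra_simps)+
qed

definition minor_line :: "real^3^3 \<Rightarrow> real^3^3 \<Rightarrow> 3 \<Rightarrow> 3 \<Rightarrow> 3 \<Rightarrow> (real^3) set set" where
  "minor_line A X i j k = {proj_pt z | z. z \<noteq> 0 \<and> minor_form A X i j k z = 0}"

text \<open>\<open>P\<^sub>i\<close> is the point of \<open>l\<^sub>i\<^sub>j \<inter> l\<^sub>i\<^sub>k\<close> and \<open>Q\<^sub>i\<close> that of \<open>l\<^sub>j\<^sub>i \<inter> l\<^sub>k\<^sub>i\<close>; both are symmetric in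
  \<open>j\<close> and \<open>k\<close>.\<close>

definition vertex_P :: "real^3^3 \<Rightarrow> real^3^3 \<Rightarrow> 3 \<Rightarrow> 3 \<Rightarrow> 3 \<Rightarrow> (real^3) set" where
  "vertex_P A X i j k = the_elem (minor_line A X i j k \<inter> minor_line A X i k j)"

definition vertex_Q :: "real^3^3 \<Rightarrow> real^3^3 \<Rightarrow> 3 \<Rightarrow> 3 \<Rightarrow> 3 \<Rightarrow> (real^3) set" where
  "vertex_Q A X i j k = the_elem (minor_line A X j i k \<inter> minor_line A X k i j)"

definition hexagon :: "real^3^3 \<Rightarrow> real^3^3 \<Rightarrow> (real^3) set list" where
  "hexagon A X =
    [vertex_P A X 1 2 3, vertex_Q A X 2 3 1, vertex_P A X 3 1 2,
     vertex_Q A X 1 2 3, vertex_P A X 2 3 1, vertex_Q A X 3 1 2]"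

definition hexagon_type :: "real^3^3 \<Rightarrow> real^3^3 \<Rightarrow> nat \<Rightarrow> nat \<Rightarrow> bool" where
  "hexagon_type A X m n \<longleftrightarrow>
    (\<exists>C\<in>ovals A X. \<exists>N\<in>ovals A X. contractible_in_rp2 C \<and> \<not> contractible_in_rp2 N \<and>
      length (filter (\<lambda>v. v \<in> C) (hexagon A X)) = m \<and>
      length (filter (\<lambda>v. v \<in> N) (hexagon A X)) = n)"

subsection \<open>The flow\<close>

definition solution_on ::
  "real^3^3 \<Rightarrow> real^3^3 \<Rightarrow> (real \<Rightarrow> real^3^3) \<Rightarrow> real set \<Rightarrow> bool" where
  "solution_on A X x J \<longleftrightarrow> x 0 = X \<and>
    (\<forall>t\<in>J. (x has_vector_derivative ((x t ** x t) ** A - A ** (x t ** x t))) (at t))"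

definition blows_up :: "real^3^3 \<Rightarrow> real^3^3 \<Rightarrow> bool" where
  "blows_up A X \<longleftrightarrow>
    (\<exists>s T x. s < 0 \<and> 0 < T \<and> solution_on A X x {s<..<T} \<and>
      filterlim x at_infinity (at_right s) \<and> filterlim x at_infinity (at_left T))"

definition exists_for_all_times :: "real^3^3 \<Rightarrow> real^3^3 \<Rightarrow> bool" where
  "exists_for_all_times A X \<longleftrightarrow> (\<exists>x. solution_on A X x UNIV)"

end

theory Submission
  imports Defs
begin

text \<open>Let \<open>m\<^sub>i\<close> be the diagonal entries of \<open>X\<^sub>z\<close> and \<open>u\<^sub>1 = x\<^sub>2\<^sub>3 x\<^sub>3\<^sub>2\<close> etc. the products of opposite
  off-diagonal entries. The curve is \<open>m\<^sub>1 m\<^sub>2 m\<^sub>3 - z\<^sub>3\<^sup>2 (u\<^sub>1 m\<^sub>1 + u\<^sub>2 m\<^sub>2 + u\<^sub>3 m\<^sub>3) + r z\<^sub>3\<^sup>3 = 0\<close>, and a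
  linear relation \<open>b\<^sub>1 m\<^sub>1 + b\<^sub>2 m\<^sub>2 + b\<^sub>3 m\<^sub>3 = \<beta> z\<^sub>3\<close> shows that it does not change under
  \<open>u\<^sub>i \<mapsto> u\<^sub>i + b\<^sub>i s\<close>, \<open>r \<mapsto> r + \<beta> s\<close>. The flow is such a motion, with
  \<open>s'\<^sup>2 = F(s) = (r + \<beta> s)\<^sup>2 - 4 (u\<^sub>1 + b\<^sub>1 s) (u\<^sub>2 + b\<^sub>2 s) (u\<^sub>3 + b\<^sub>3 s)\<close>. Smoothness means that \<open>F\<close>
  has only simple roots. So a solution blows up in both time directions if the initial value
  \<open>s = 0\<close> lies on the unbounded component of \<open>F \<ge> 0\<close>, and is bounded otherwise.

  On the other hand, \<open>m\<^sub>2 m\<^sub>3 = (u\<^sub>1 + b\<^sub>1 s) z\<^sub>3\<^sup>2\<close> defines a function \<open>s\<close> on the curve, which makes the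
  curve a double cover of the line branched at the roots of \<open>F\<close> and at \<open>\<infinity>\<close>, with \<open>P\<^sub>1\<close> and \<open>Q\<^sub>1\<close>
  over \<open>s = 0\<close> and the point \<open>m\<^sub>1 = z\<^sub>3 = 0\<close> over \<open>\<infinity>\<close>. Hence the two ovals lie over the two
  components of \<open>F \<ge> 0\<close>, and the solution blows up iff \<open>P\<^sub>1\<close> and \<open>Q\<^sub>1\<close> are on the same oval as
  \<open>m\<^sub>1 = z\<^sub>3 = 0\<close>; likewise for the other indices. The line \<open>z\<^sub>3 = 0\<close> meets the non-contractible
  oval in an odd number of points, so this oval contains one or three of the points
  \<open>m\<^sub>i = z\<^sub>3 = 0\<close>, which gives the types.\<close>

subsection \<open>Topology of the projective plane\<close>

text \<open>The vector (b1, b2, b3) is, up to a sign \<eta>, the cross product of (1, 1, 1) with the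
  diagonal of \<open>A\<close>; this is why z1 and z2 cancel in the weighted sum of the diagonal
  entries. The sign is chosen so that \<open>b1 * b2 * b3 < 0\<close>. Then \<open>F s\<close> tends
  to +\<infinity> with s, and the unbounded component of \<open>F \<ge> 0\<close> is a right
  half-line for every index. The obstacle is to decide which oval is contractible. For s in the gap
  between the two components, \<open>b2 * b3 * (u1 + b1 * s)\<close> and its two cyclic variants
  have a positive product, so one of them is positive, say the first. Then the other two points at
  infinity share an oval, and some line through the point m1 = w = 0 meets the curve there only, and
  transversally. The oval without this point misses the line, so it lies in an affine chart and is
  contractible. Along the other oval a lift to R^3 returns with the opposite sign, so it is not
  null-homotopic. Backward time is reduced to forward time by transposition, which preserves u, r
  and F.\<close>

lemma proj_pt_eq_iff:
  fixes v w :: "'a::field^3"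
  shows "proj_pt v = proj_pt w \<longleftrightarrow> (\<exists>c. c \<noteq> 0 \<and> w = c *s v)"
proof
  assume eq: "proj_pt v = proj_pt w"
  have "w \<in> proj_pt w" unfolding proj_pt_def by (rule CollectI, rule exI[of _ 1]) simp
  then have "w \<in> proj_pt v" using eq by simp
  then show "\<exists>c. c \<noteq> 0 \<and> w = c *s v" unfolding proj_pt_def by blast
next
  assume "\<exists>c. c \<noteq> 0 \<and> w = c *s v"
  then obtain c where c: "c \<noteq> 0" "w = c *s v" by blast
  have *: "d *s w = (d * c) *s v" "d *s v = (d / c) *s w" for d
    using c by (simp_all add: vector_smult_assoc)
  then show "proj_pt v = proj_pt w"
    unfolding proj_pt_def set_eq_iff mem_Collect_eq using c(1) by (metis * divide_eq_0_iff mult_eq_0_iff)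
qed

lemma proj_pt_scale:
  fixes v :: "real^3"
  shows "c \<noteq> 0 \<Longrightarrow> proj_pt (c *\<^sub>R v) = proj_pt v"
  by (metis proj_pt_eq_iff scalar_mult_eq_scaleR)

lemma proj_pt_eq_scaleR:
  fixes v w :: "real^3"
  shows "proj_pt v = proj_pt w \<longleftrightarrow> (\<exists>c. c \<noteq> 0 \<and> w = c *\<^sub>R v)"
  by (simp add: proj_pt_eq_iff scalar_mult_eq_scaleR)

lemma proj_pt_in_rp2_points: "v \<noteq> 0 \<Longrightarrow> proj_pt v \<in> rp2_points"
  by (auto simp: rp2_points_def)

text \<open>By homogeneity of \<open>Q\<close>, the preimage of the image set under
  \<open>proj_pt\<close> is the cone of \<open>Q\<close> itself, and openness in the quotient
  topology is openness of that cone.\<close>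

lemma openin_rp2_image:
  assumes "open {v. v \<noteq> 0 \<and> Q v}"
    and "\<And>v c. v \<noteq> 0 \<Longrightarrow> c \<noteq> 0 \<Longrightarrow> Q v \<Longrightarrow> Q (c *\<^sub>R v)"
  shows "openin rp2 {proj_pt v | v. v \<noteq> 0 \<and> Q v}"
proof -
  have "{v. v \<noteq> 0 \<and> proj_pt v \<in> {proj_pt v | v. v \<noteq> 0 \<and> Q v}} = {v. v \<noteq> 0 \<and> Q v}"
  proof (intro subset_antisym subsetI)
    fix x assume "x \<in> {v. v \<noteq> 0 \<and> proj_pt v \<in> {proj_pt v | v. v \<noteq> 0 \<and> Q v}}"
    then obtain v where v: "v \<noteq> 0" "Q v" "proj_pt v = proj_pt x" "x \<noteq> 0" by auto
    then obtain c where "c \<noteq> 0" "x = c *\<^sub>R v" by (auto simp: proj_pt_eq_scaleR)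
    then show "x \<in> {v. v \<noteq> 0 \<and> Q v}" using v assms(2) by auto
  qed auto
  then show ?thesis
    using assms(1) unfolding openin_rp2 rp2_points_def by auto
qed

lemma continuous_map_proj_pt:
  "continuous_map (top_of_set (- {0})) rp2 (proj_pt :: real^3 \<Rightarrow> _)"
  unfolding continuous_map_def topspace_rp2
proof (intro conjI allI impI)
  show "proj_pt \<in> topspace (top_of_set (- {0::real^3})) \<rightarrow> rp2_points"
    by (auto simp: proj_pt_in_rp2_points)
  fix U assume "openin rp2 U"
  then have "open {v. v \<noteq> 0 \<and> proj_pt v \<in> U}" by (simp add: openin_rp2)
  moreover have "{x \<in> topspace (top_of_set (- {0::real^3})). proj_pt x \<in> U} =
      {v. v \<noteq> 0 \<and> proj_pt v \<in> U}" by auto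
  ultimately show "openin (top_of_set (- {0::real^3})) {x \<in> topspace (top_of_set (- {0})). proj_pt x \<in> U}"
    by (auto intro!: open_subset)
qed

text \<open>Since \<open>S\<close> is open, openness in the subspace is openness in
  \<open>rp2\<close>, which by definition is openness of the cone in R^3.\<close>

lemma continuous_map_from_rp2:
  fixes f :: "(real^3) set \<Rightarrow> 'b::topological_space"
  assumes "openin rp2 S" and "continuous_on {v. v \<noteq> 0 \<and> proj_pt v \<in> S} (\<lambda>v. f (proj_pt v))"
  shows "continuous_map (subtopology rp2 S) euclidean f"
  unfolding continuous_map_def
proof (intro conjI allI impI)
  fix U :: "'b set" assume "openin euclidean U"
  then have U: "open U" by simp
  have o: "open {v. v \<noteq> 0 \<and> proj_pt v \<in> S}" using assms(1) by (simp add: openin_rp2)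
  have "open ({v. v \<noteq> 0 \<and> proj_pt v \<in> S} \<inter> (\<lambda>v. f (proj_pt v)) -` U)"
    by (rule continuous_open_preimage[OF assms(2) o U])
  moreover have "{v. v \<noteq> 0 \<and> proj_pt v \<in> {x \<in> S. f x \<in> U}} =
      {v. v \<noteq> 0 \<and> proj_pt v \<in> S} \<inter> (\<lambda>v. f (proj_pt v)) -` U" by auto
  ultimately have "openin rp2 {x \<in> S. f x \<in> U}"
    using assms(1) by (auto simp: openin_rp2)
  then have "openin (subtopology rp2 S) {x \<in> S. f x \<in> U}"
    using openin_open_subtopology[OF assms(1)] by auto
  moreover have "{x \<in> topspace (subtopology rp2 S). f x \<in> U} = {x \<in> S. f x \<in> U}"
    using openin_subset[OF assms(1)] by auto
  ultimately show "openin (subtopology rp2 S) {x \<in> topspace (subtopology rp2 S). f x \<in> U}"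
    by simp
qed auto

text \<open>A map into \<open>rp2\<close> is continuous if it is locally given by one of several homogeneous
  coordinate vectors, each of which may vanish somewhere.\<close>

lemma continuous_map_into_rp2:
  fixes V :: "'i \<Rightarrow> 'a::topological_space \<Rightarrow> real^3"
  assumes cont: "\<And>i. i \<in> I \<Longrightarrow> continuous_on S (V i)"
    and ex: "\<And>x. x \<in> S \<Longrightarrow> \<exists>i\<in>I. V i x \<noteq> 0"
    and f: "\<And>i x. i \<in> I \<Longrightarrow> x \<in> S \<Longrightarrow> V i x \<noteq> 0 \<Longrightarrow> f x = proj_pt (V i x)"
  shows "continuous_map (top_of_set S) rp2 f"
  unfolding continuous_map_def topspace_rp2
proof (intro conjI allI impI)
  show "f \<in> topspace (top_of_set S) \<rightarrow> rp2_points"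
    using ex f proj_pt_in_rp2_points by fastforce
  fix U assume "openin rp2 U"
  then have o: "open {v. v \<noteq> 0 \<and> proj_pt v \<in> U}" by (simp add: openin_rp2)
  have "openin (top_of_set S) (S \<inter> V i -` {v. v \<noteq> 0 \<and> proj_pt v \<in> U})" if "i \<in> I" for i
    using continuous_openin_preimage_gen[OF cont[OF that] o] .
  then have "openin (top_of_set S) (\<Union>i\<in>I. S \<inter> V i -` {v. v \<noteq> 0 \<and> proj_pt v \<in> U})"
    by blast
  moreover have "{x \<in> topspace (top_of_set S). f x \<in> U} =
      (\<Union>i\<in>I. S \<inter> V i -` {v. v \<noteq> 0 \<and> proj_pt v \<in> U})"
    using ex f by fastforce
  ultimately show "openin (top_of_set S) {x \<in> topspace (top_of_set S). f x \<in> U}" by simp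
qed

lemma continuous_map_scaleR:
  fixes f :: "'a \<Rightarrow> real" and g :: "'a \<Rightarrow> 'b::real_normed_vector"
  shows "continuous_map X euclidean f \<Longrightarrow> continuous_map X euclidean g \<Longrightarrow>
    continuous_map X euclidean (\<lambda>x. f x *\<^sub>R g x)"
  by (simp add: continuous_map_atin tendsto_scaleR)

text \<open>The complement of the line l = 0 is an affine chart: each of its points has a unique
  representative on the convex plane l = 1, where a straight-line homotopy leads to the multiple of
  \<open>e\<close> in that plane.\<close>

lemma contractible_in_rp2_affine:
  fixes l :: "real^3 \<Rightarrow> real"
  assumes l: "linear l" and S: "S \<subseteq> {proj_pt v | v. v \<noteq> 0 \<and> l v \<noteq> 0}" and e: "l e \<noteq> 0"
  shows "contractible_in_rp2 S"
proof -
  define D where "D = {proj_pt v | v. v \<noteq> 0 \<and> l v \<noteq> 0}"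
  define n where "n x = (SOME v. v \<in> x \<and> l v = 1)" for x
  have contl: "continuous_on A l" for A
    using l by (simp add: linear_continuous_on linear_linear)
  have "open {v. l v \<noteq> 0}"
    by (rule open_Collect_neq) (use contl in auto)
  moreover have "{v. v \<noteq> 0 \<and> l v \<noteq> 0} = {v. l v \<noteq> 0}"
    using linear_0[OF l] by auto
  ultimately have "open {v. v \<noteq> 0 \<and> l v \<noteq> 0}" by simp
  then have D: "openin rp2 D"
    unfolding D_def by (rule openin_rp2_image) (simp add: linear_cmul[OF l])
  have n: "n (proj_pt v) = v /\<^sub>R l v" if "l v \<noteq> 0" for v
    unfolding n_def
  proof (rule some_equality)
    show "v /\<^sub>R l v \<in> proj_pt v \<and> l (v /\<^sub>R l v) = 1"
      using that unfolding proj_pt_def by (auto simp: linear_cmul[OF l] scalar_mult_eq_scaleR)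
    fix y assume y: "y \<in> proj_pt v \<and> l y = 1"
    then obtain c where "y = c *\<^sub>R v" unfolding proj_pt_def by (auto simp: scalar_mult_eq_scaleR)
    then show "y = v /\<^sub>R l v" using y that by (auto simp: linear_cmul[OF l] field_simps)
  qed
  have Dl: "l v \<noteq> 0" if "proj_pt v \<in> D" for v
    using that unfolding D_def by (auto simp: proj_pt_eq_scaleR linear_cmul[OF l])
  have "continuous_map (subtopology rp2 D) euclidean n"
  proof (rule continuous_map_from_rp2[OF D])
    show "continuous_on {v. v \<noteq> 0 \<and> proj_pt v \<in> D} (\<lambda>v. n (proj_pt v))"
      by (rule continuous_on_eq[of _ "\<lambda>v. v /\<^sub>R l v"])
         (auto simp: n Dl intro!: continuous_intros contl)
  qed
  then have n1: "continuous_map (subtopology rp2 S) euclidean n"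
    by (rule continuous_map_from_subtopology_mono) (use S in \<open>auto simp: D_def\<close>)
  define e' where "e' = e /\<^sub>R l e"
  have e': "l e' = 1" using e by (simp add: e'_def linear_cmul[OF l])
  define h where "h = (\<lambda>(t::real, x). (1 - t) *\<^sub>R n x + t *\<^sub>R e')"
  let ?T = "prod_topology (top_of_set {0..1::real}) (subtopology rp2 S)"
  have c1: "continuous_map ?T euclidean (\<lambda>z. n (snd z))"
    using continuous_map_compose[OF continuous_map_snd n1] by (simp add: o_def)
  have c0: "continuous_map ?T euclidean (\<lambda>z. fst z :: real)"
    using continuous_map_fst[of "top_of_set {0..1::real}" "subtopology rp2 S"]
    by (simp add: continuous_map_in_subtopology o_def)
  have c2: "continuous_map ?T euclidean h"
    unfolding h_def case_prod_beta
    by (intro continuous_map_add continuous_map_scaleR continuous_map_diff continuous_map_const[THEN iffD2] c0 c1) auto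
  have lnx: "l (n x) = 1" if x: "x \<in> S" for x
  proof -
    obtain v where v: "x = proj_pt v" "l v \<noteq> 0" using x S by auto
    then show ?thesis by (simp add: n linear_cmul[OF l])
  qed
  have lh: "l (h z) = 1" if "z \<in> {0..1} \<times> S" for z
    using that lnx by (auto simp: h_def linear_add[OF l] linear_cmul[OF l] e')
  have "h z \<noteq> 0" if "z \<in> {0..1} \<times> S" for z
    using lh[OF that] l by (metis linear_0 zero_neq_one)
  then have c3: "continuous_map ?T (top_of_set (- {0})) h"
    using c2 by (auto simp: continuous_map_in_subtopology)
  have c4: "continuous_map ?T rp2 (proj_pt \<circ> h)"
    by (rule continuous_map_compose[OF c3 continuous_map_proj_pt])
  have pn: "proj_pt (n x) = x" if x: "x \<in> S" for x
  proof -
    obtain v where v: "x = proj_pt v" "l v \<noteq> 0" using x S by auto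
    then show ?thesis by (simp add: n proj_pt_scale)
  qed
  have "homotopic_with (\<lambda>_. True) (subtopology rp2 S) rp2 (\<lambda>x. x) (\<lambda>_. proj_pt e')"
  proof (subst homotopic_with)
    show "\<exists>h. continuous_map ?T rp2 h \<and> (\<forall>x\<in>topspace (subtopology rp2 S). h (0, x) = x) \<and>
      (\<forall>x\<in>topspace (subtopology rp2 S). h (1, x) = proj_pt e') \<and> (\<forall>t\<in>{0..1}. True)"
      by (rule exI[of _ "proj_pt \<circ> h"]) (use c4 pn in \<open>auto simp: h_def\<close>)
  qed auto
  then show ?thesis unfolding contractible_in_rp2_def by blast
qed

section \<open>Lifting null-homotopic closed curves to R^3\<close>

text \<open>The orthogonal projection onto the line given by the point. It is homogeneous of degree
  0, hence independent of the representative, and it turns maps into \<open>rp2\<close> into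
  matrix-valued maps, for which uniform continuity makes sense.\<close>

definition line_proj :: "(real^3) set \<Rightarrow> real^3^3" where
  "line_proj S = (let v = (SOME v. v \<in> S) in \<chi> i j. v$i * v$j / (v \<bullet> v))"

lemma line_proj_proj_pt:
  fixes v :: "real^3"
  assumes "v \<noteq> 0"
  shows "line_proj (proj_pt v) = (\<chi> i j. v$i * v$j / (v \<bullet> v))"
proof -
  have "v \<in> proj_pt v" unfolding proj_pt_def by (rule CollectI, rule exI[of _ 1]) simp
  then have "(SOME v'. v' \<in> proj_pt v) \<in> proj_pt v" by (rule someI)
  then obtain c where c: "c \<noteq> 0" "(SOME v'. v' \<in> proj_pt v) = c *\<^sub>R v"
    unfolding proj_pt_def by (auto simp: scalar_mult_eq_scaleR)
  then show ?thesis using assms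
    unfolding line_proj_def Let_def c(2) by (simp add: vec_eq_iff)
qed

lemma line_proj_mult:
  fixes v y :: "real^3"
  assumes "v \<noteq> 0"
  shows "line_proj (proj_pt v) *v y = ((v \<bullet> y) / (v \<bullet> v)) *\<^sub>R v"
proof -
  have "v \<bullet> y = v$1 * y$1 + v$2 * y$2 + v$3 * y$3"
    by (simp add: inner_vec_def sum_3)
  then show ?thesis
    unfolding line_proj_proj_pt[OF assms]
    by (simp add: vec_eq_iff matrix_vector_mult_def sum_3 add_divide_distrib algebra_simps)
qed

lemma continuous_map_line_proj: "continuous_map rp2 euclidean line_proj"
proof -
  have "continuous_map (subtopology rp2 rp2_points) euclidean line_proj"
  proof (rule continuous_map_from_rp2)
    show "openin rp2 rp2_points" using openin_topspace[of rp2] by (simp add: topspace_rp2)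
    have "continuous_on (- {0}) (\<lambda>v::real^3. \<chi> i j. v$i * v$j / (v \<bullet> v))"
      by (intro continuous_intros) auto
    then show "continuous_on {v. v \<noteq> 0 \<and> proj_pt v \<in> rp2_points} (\<lambda>v. line_proj (proj_pt v))"
      by (rule continuous_on_eq[OF continuous_on_subset]) (auto simp: line_proj_proj_pt)
  qed
  then show ?thesis by (metis subtopology_topspace topspace_rp2)
qed

text \<open>A crude estimate from 3 rows and 3 columns. Projections at distance below 1/10 therefore
  move a vector by at most 9/10 of its length, so projecting it to a nearby line cannot annihilate
  it.\<close>

lemma norm_matrix_vector_le:
  fixes A :: "real^3^3" and x :: "real^3"
  shows "norm (A *v x) \<le> 9 * norm A * norm x"
proof -
  have "\<bar>(A *v x) $ i\<bar> \<le> 3 * (norm A * norm x)" for i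
  proof -
    have "\<bar>A$i$j * x$j\<bar> \<le> norm A * norm x" for j
      unfolding abs_mult using component_le_norm_cart[of "A$i" j] Finite_Cartesian_Product.norm_nth_le[of A i] component_le_norm_cart[of x j]
      by (intro mult_mono) auto
    then have "(\<Sum>j\<in>UNIV. \<bar>A$i$j * x$j\<bar>) \<le> (\<Sum>j\<in>(UNIV::3 set). norm A * norm x)"
      by (intro sum_mono) 
    then show ?thesis
      unfolding matrix_vector_mult_def by (simp add: order_trans[OF sum_abs])
  qed
  then have "(\<Sum>i\<in>UNIV. \<bar>(A *v x) $ i\<bar>) \<le> (\<Sum>i\<in>(UNIV::3 set). 3 * (norm A * norm x))"
    by (intro sum_mono)
  then show ?thesis using norm_le_l1_cart[of "A *v x"] by simp
qed

text \<open>The constant end of a null-homotopy lifts trivially, and the lift is transported back along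
  the homotopy by repeated orthogonal projection to the lines of nearby times.\<close>

lemma contractible_in_rp2_lift:
  fixes g :: "real \<Rightarrow> (real^3) set"
  assumes contr: "contractible_in_rp2 S"
    and g: "continuous_map (top_of_set {a..b}) (subtopology rp2 S) g"
    and ab: "a \<le> b" "g a = g b"
  obtains W where "continuous_on {a..b} W" "\<And>x. x \<in> {a..b} \<Longrightarrow> W x \<noteq> 0 \<and> g x = proj_pt (W x)"
    "W a = W b"
proof -
  obtain p where "homotopic_with (\<lambda>_. True) (subtopology rp2 S) rp2 (\<lambda>x. x) (\<lambda>_. p)"
    using contr unfolding contractible_in_rp2_def by blast
  then obtain h where h: "continuous_map (prod_topology (top_of_set {0..1::real}) (subtopology rp2 S)) rp2 h"
      "\<And>x. x \<in> topspace (subtopology rp2 S) \<Longrightarrow> h (0, x) = x"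
      "\<And>x. x \<in> topspace (subtopology rp2 S) \<Longrightarrow> h (1, x) = p"
    unfolding homotopic_with_def by auto
  have gS: "g x \<in> topspace (subtopology rp2 S)" if "x \<in> {a..b}" for x
    using g that unfolding continuous_map_def by auto
  define H where "H = (\<lambda>z::real\<times>real. h (fst z, g (snd z)))"
  have "continuous_map (prod_topology (top_of_set {0..1::real}) (top_of_set {a..b}))
      (prod_topology (top_of_set {0..1::real}) (subtopology rp2 S)) (\<lambda>z. (fst z, g (snd z)))"
    unfolding continuous_map_pairwise o_def fst_conv snd_conv
    by (intro conjI continuous_map_compose[OF continuous_map_snd g, unfolded o_def] continuous_map_fst)
  then have "continuous_map (prod_topology (top_of_set {0..1::real}) (top_of_set {a..b})) rp2 H"
    using continuous_map_compose[OF _ h(1)] unfolding H_def o_def by blast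
  then have Hc: "continuous_map (top_of_set ({0..1} \<times> {a..b})) rp2 H"
    by (simp add: prod_topology_subtopology_eu subtopology_Times)
  then have Hr: "H z \<in> rp2_points" if "z \<in> {0..1} \<times> {a..b}" for z
    using that unfolding continuous_map_def topspace_rp2 by auto
  define M where "M = (\<lambda>z. line_proj (H z))"
  have Mc: "continuous_on ({0..1} \<times> {a..b}) M"
    using continuous_map_compose[OF Hc continuous_map_line_proj]
    by (simp add: M_def o_def)
  have "uniformly_continuous_on ({0..1} \<times> {a..b}) M"
    by (rule compact_uniformly_continuous[OF Mc compact_Times]) auto
  then obtain d where d: "d > 0" "\<And>z z'. z \<in> {0..1} \<times> {a..b} \<Longrightarrow> z' \<in> {0..1} \<times> {a..b} \<Longrightarrow>
      dist z' z < d \<Longrightarrow> dist (M z') (M z) < 1/10"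
    unfolding uniformly_continuous_on_def by (metis zero_less_divide_1_iff zero_less_numeral)
  obtain m where m: "inverse (real (Suc m)) < d" using reals_Archimedean[OF d(1)] by blast
  define n where "n = Suc m"
  have n0: "n > 0" "1 / real n < d" using m by (simp_all add: n_def inverse_eq_divide)
  have Mab: "M (t, a) = M (t, b)" for t using ab(2) by (simp add: M_def H_def)
  have M1: "M z *v w = w \<longleftrightarrow> H z = proj_pt w" if zw: "z \<in> {0..1} \<times> {a..b}" "w \<noteq> 0" for z w
  proof -
    obtain v where v: "H z = proj_pt v" "v \<noteq> 0"
      using Hr[OF zw(1)] unfolding rp2_points_def by auto
    show ?thesis
    proof
      assume "M z *v w = w"
      then have e: "w = ((v \<bullet> w) / (v \<bullet> v)) *\<^sub>R v"
        by (simp add: M_def v line_proj_mult)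
      moreover have "(v \<bullet> w) / (v \<bullet> v) \<noteq> 0" using e zw(2) by (metis scale_zero_left)
      ultimately show "H z = proj_pt w" by (metis proj_pt_scale v(1))
    qed (use that in \<open>simp add: M_def line_proj_mult\<close>)
  qed
  have MM: "M z *v (M z *v w) = M z *v w" if zw: "z \<in> {0..1} \<times> {a..b}" for z w
  proof -
    obtain v where v: "H z = proj_pt v" "v \<noteq> 0"
      using Hr[OF zw(1)] unfolding rp2_points_def by auto
    then show ?thesis by (simp add: M_def line_proj_mult)
  qed
  \<comment> \<open>A lift is encoded as a nowhere zero fixed vector of \<open>M\<close>. The
    induction runs from homotopy time 1, the constant end, down to 0 in \<open>n\<close> steps.
    Since \<open>g a = g b\<close>, the projections at both ends agree and the lift stays
    closed.\<close>
  have step: "\<exists>W. continuous_on {a..b} W \<and> W a = W b \<and>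
      (\<forall>x\<in>{a..b}. W x \<noteq> 0 \<and> M (1 - real k / real n, x) *v W x = W x)" if "k \<le> n" for k
    using that
  proof (induction k)
    case 0
    have "H (1, a) = p" using h(3)[OF gS] ab by (simp add: H_def)
    then obtain v where v: "p = proj_pt v" "v \<noteq> 0" using Hr[of "(1, a)"] ab unfolding rp2_points_def by auto
    show ?case
      by (rule exI[of _ "\<lambda>_. v"]) (use v h(3)[OF gS] in \<open>auto simp: M_def H_def line_proj_mult\<close>)
  next
    case (Suc k)
    then obtain W where W: "continuous_on {a..b} W" "W a = W b"
      "\<And>x. x \<in> {a..b} \<Longrightarrow> W x \<noteq> 0 \<and> M (1 - real k / real n, x) *v W x = W x" by force
    let ?t = "1 - real (Suc k) / real n" and ?tt = "1 - real k / real n"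
    have t: "?t \<in> {0..1}" "?tt \<in> {0..1}" using Suc.prems n0 by auto
    have dt: "dist (?t, x) (?tt, x) < d" for x :: real
    proof -
      have "?t - ?tt = - (1 / real n)" using n0 by (simp add: field_simps)
      then show ?thesis using n0 by (simp add: dist_Pair_Pair dist_real_def)
    qed
    have "M (?t, x) *v W x \<noteq> 0" if "x \<in> {a..b}" for x
    proof
      assume z: "M (?t, x) *v W x = 0"
      have "norm ((M (?t, x) - M (?tt, x)) *v W x) \<le> 9 * norm (M (?t, x) - M (?tt, x)) * norm (W x)"
        by (rule norm_matrix_vector_le)
      moreover have "norm (M (?t, x) - M (?tt, x)) < 1/10"
        using d(2)[OF _ _ dt[of x]] t that by (simp add: dist_norm)
      then have "9 * norm (M (?t, x) - M (?tt, x)) * norm (W x) \<le> (9/10) * norm (W x)"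
        by (intro mult_right_mono) auto
      moreover have "(M (?t, x) - M (?tt, x)) *v W x = - W x"
        using z W(3)[OF that] by (simp add: matrix_vector_mult_diff_rdistrib)
      moreover have "norm (W x) > 0" using W(3)[OF that] by simp
      ultimately show False by simp
    qed
    moreover have "continuous_on {a..b} (\<lambda>x. M (?t, x) *v W x)"
    proof -
      have "continuous_on {a..b} (\<lambda>x. M (?t, x))"
        by (rule continuous_on_compose2[OF Mc]) (use t in \<open>auto intro!: continuous_intros\<close>)
      then show ?thesis using W(1) 
        unfolding matrix_vector_mult_def by (intro continuous_intros) 
    qed
    ultimately show ?case
      by (intro exI[of _ "\<lambda>x. M (?t, x) *v W x"]) (use W Mab MM t in auto)
  qed
  obtain W where W: "continuous_on {a..b} W" "W a = W b"
      "\<And>x. x \<in> {a..b} \<Longrightarrow> W x \<noteq> 0 \<and> M (0, x) *v W x = W x"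
    using step[of n] n0 by auto
  show ?thesis
  proof (rule that[OF W(1) _ W(2)])
    fix x assume x: "x \<in> {a..b}"
    then have "H (0, x) = proj_pt (W x)" using M1[of "(0,x)" "W x"] W(3)[OF x] by simp
    then show "W x \<noteq> 0 \<and> g x = proj_pt (W x)"
      using W(3)[OF x] h(2)[OF gS[OF x]] by (simp add: H_def)
  qed
qed

text \<open>Every component lies in one of the two clopen sets, and each of these contains a
  component. A count of exactly two forces each set to be one whole component.\<close>

lemma connected_components_clopen_split:
  assumes A: "openin X A" "A \<noteq> {}" and B: "openin X B" "B \<noteq> {}"
    and disj: "A \<inter> B = {}" and un: "A \<union> B = topspace X"
  shows "card (connected_components_of X) \<noteq> 1"
    and "card (connected_components_of X) = 2 \<Longrightarrow> connected_components_of X = {A, B}"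
proof -
  have sub: "C \<subseteq> A \<or> C \<subseteq> B" if "C \<in> connected_components_of X" for C
  proof -
    have c: "connectedin X C" using that by (rule connectedin_connected_components_of)
    have "topspace X - A = B" using disj un by blast
    then have "closedin X A" using A B openin_subset[OF A(1)] by (simp add: closedin_def)
    then have "C \<subseteq> A \<or> disjnt C A"
      using connectedin_clopen_cases[OF c] A(1) by blast
    then show ?thesis
      using connectedin_subset_topspace[OF c] un unfolding disjnt_def by blast
  qed
  have U: "\<Union> (connected_components_of X) = topspace X"
    by (rule Union_connected_components_of)
  have meet: "\<exists>C\<in>connected_components_of X. C \<inter> Y \<noteq> {}" if "Y \<noteq> {}" "Y \<subseteq> topspace X" for Y
    using U that by blast
  obtain C1 where C1: "C1 \<in> connected_components_of X" "C1 \<subseteq> A"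
    using meet[OF A(2)] un disj sub by blast
  obtain C2 where C2: "C2 \<in> connected_components_of X" "C2 \<subseteq> B"
    using meet[OF B(2)] un disj sub by blast
  have ne: "C1 \<noteq> {}" "C2 \<noteq> {}" using C1 C2 nonempty_connected_components_of by blast+
  have 12: "C1 \<noteq> C2" using C1 C2 ne disj by blast
  show "card (connected_components_of X) \<noteq> 1"
    using C1(1) C2(1) 12 by (metis card_1_singletonE singletonD)
  assume "card (connected_components_of X) = 2"
  then have eq: "connected_components_of X = {C1, C2}"
    using C1(1) C2(1) 12 by (metis card_2_iff insertE insert_commute singletonD)
  then have "C1 \<union> C2 = A \<union> B" using U un by simp
  then have "C1 = A" "C2 = B" using C1 C2 disj by blast+
  then show "connected_components_of X = {A, B}" using eq by simp
qed

subsection \<open>The cubic curve and its ovals\<close>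

lemma quadratic_pos:
  fixes k0 k1 k2 v :: real
  assumes "k2 > 0" and "k1\<^sup>2 < 4 * k2 * k0"
  shows "k2 * v\<^sup>2 + k1 * v + k0 > 0"
proof -
  have "4 * k2 * (k2 * v\<^sup>2 + k1 * v + k0) = (2 * k2 * v + k1)\<^sup>2 + (4 * k2 * k0 - k1\<^sup>2)"
    by (simp add: algebra_simps power2_eq_square)
  also have "\<dots> > 0" using assms(2) by (simp add: add_nonneg_pos)
  finally show ?thesis using assms(1) by (simp add: zero_less_mult_iff)
qed

lemma eq_if_power2_eq_same_sign:
  fixes a b :: real
  assumes "a\<^sup>2 = b\<^sup>2" "a * b \<ge> 0"
  shows "a = b"
proof -
  have "a = b \<or> a = - b" using assms(1) by (simp add: power2_eq_iff)
  then show ?thesis using assms(2) by (auto simp: mult_le_0_iff)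
qed

lemma ex_less_right_end:
  fixes f :: "real \<Rightarrow> real"
  assumes "a < b" "continuous_on {a..b} f" "f b > 0"
  shows "\<exists>x\<in>{a<..<b}. f x > 0"
proof -
  have "(f \<longlongrightarrow> f b) (at_left b)" using continuous_on_Icc_at_leftD assms by blast
  then have "eventually (\<lambda>x. f x > 0) (at_left b)" using assms(3) by (rule order_tendstoD)
  moreover have "eventually (\<lambda>x. x \<in> {a<..<b}) (at_left b)"
    using assms(1) by (intro eventually_at_leftI[of a]) auto
  ultimately have "eventually (\<lambda>x. x \<in> {a<..<b} \<and> f x > 0) (at_left b)" by eventually_elim auto
  then show ?thesis using eventually_happens'[OF trivial_limit_at_left_real] by blast
qed

lemma ex_less_left_end:
  fixes f :: "real \<Rightarrow> real"
  assumes "a < b" "continuous_on {a..b} f" "f a > 0"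
  shows "\<exists>x\<in>{a<..<b}. f x > 0"
proof -
  have "(f \<longlongrightarrow> f a) (at_right a)" using continuous_on_Icc_at_rightD assms by blast
  then have "eventually (\<lambda>x. f x > 0) (at_right a)" using assms(3) by (rule order_tendstoD)
  moreover have "eventually (\<lambda>x. x \<in> {a<..<b}) (at_right a)"
    using assms(1) by (intro eventually_at_rightI[of _ b]) auto
  ultimately have "eventually (\<lambda>x. x \<in> {a<..<b} \<and> f x > 0) (at_right a)" by eventually_elim auto
  then show ?thesis using eventually_happens'[OF trivial_limit_at_right_real] by blast
qed

text \<open>The discriminant \<open>F\<close> defined below has only simple roots by \<open>nondeg\<close>.\<close>

locale pencil_cubic =
  fixes m1 m2 m3 w :: "real^3 \<Rightarrow> real" and b1 b2 b3 \<beta> u1 u2 u3 r :: real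
  assumes lin: "linear m1" "linear m2" "linear m3" "linear w"
    and rel: "b1 * m1 z + b2 * m2 z + b3 * m3 z = \<beta> * w z"
    and sep: "m1 z = 0 \<Longrightarrow> m2 z = 0 \<Longrightarrow> m3 z = 0 \<Longrightarrow> w z = 0 \<Longrightarrow> z = 0"
    and surj: "b1 * x1 + b2 * x2 + b3 * x3 = \<beta> * c \<Longrightarrow>
      \<exists>z. m1 z = x1 \<and> m2 z = x2 \<and> m3 z = x3 \<and> w z = c"
    and neg: "b1 * b2 * b3 < 0"
    and nondeg: "(r + \<beta> * s)\<^sup>2 = 4 * (u1 + b1 * s) * (u2 + b2 * s) * (u3 + b3 * s) \<Longrightarrow>
      \<beta> * (r + \<beta> * s) \<noteq> 2 * (b1 * (u2 + b2 * s) * (u3 + b3 * s)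
        + b2 * (u1 + b1 * s) * (u3 + b3 * s) + b3 * (u1 + b1 * s) * (u2 + b2 * s))"
begin

text \<open>Levels and the separating form single out index 1. Their facts for indices 2 and 3 come
  from interpreting the locale at the cyclically permuted data.\<close>

lemma rotate: "pencil_cubic m2 m3 m1 w b2 b3 b1 \<beta> u2 u3 u1 r"
proof (rule pencil_cubic.intro)
  show "b2 * m2 z + b3 * m3 z + b1 * m1 z = \<beta> * w z" for z using rel[of z] by simp
  show "\<exists>z. m2 z = x1 \<and> m3 z = x2 \<and> m1 z = x3 \<and> w z = c"
    if "b2 * x1 + b3 * x2 + b1 * x3 = \<beta> * c" for x1 x2 x3 c
    using surj[of x3 x1 x2 c] that by auto
  show "b2 * b3 * b1 < 0" using neg by (simp add: mult.commute mult.left_commute)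
  show "\<beta> * (r + \<beta> * s) \<noteq> 2 * (b2 * (u3 + b3 * s) * (u1 + b1 * s)
        + b3 * (u2 + b2 * s) * (u1 + b1 * s) + b1 * (u2 + b2 * s) * (u3 + b3 * s))"
    if "(r + \<beta> * s)\<^sup>2 = 4 * (u2 + b2 * s) * (u3 + b3 * s) * (u1 + b1 * s)" for s
    using nondeg[of s] that by (simp add: algebra_simps)
qed (use lin sep in auto)

section \<open>Level function and separating quadratic form\<close>

definition F :: "real \<Rightarrow> real" where
  "F s = (r + \<beta> * s)\<^sup>2 - 4 * (u1 + b1 * s) * (u2 + b2 * s) * (u3 + b3 * s)"

definition Phi :: "real^3 \<Rightarrow> real" where
  "Phi z = m1 z * m2 z * m3 z - (w z)\<^sup>2 * (u1 * m1 z + u2 * m2 z + u3 * m3 z) + r * (w z)^3"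

definition curve :: "(real^3) set set" where
  "curve = {proj_pt z | z. z \<noteq> 0 \<and> Phi z = 0}"

text \<open>On the curve the first equation implies the second where w is nonzero, and the second
  implies the first where m1 is nonzero (see \<open>Phi_eq\<close>). Together they define the level
  also at points with w = 0.\<close>

definition at_level :: "real \<Rightarrow> real^3 \<Rightarrow> bool" where
  "at_level s z \<longleftrightarrow> m2 z * m3 z = (u1 + b1 * s) * (w z)\<^sup>2 \<and>
    (u2 + b2 * s) * m2 z + (u3 + b3 * s) * m3 z = (r + \<beta> * s) * w z"

definition at_inf :: "real^3 \<Rightarrow> bool" where "at_inf z \<longleftrightarrow> m1 z = 0 \<and> w z = 0"

text \<open>For \<open>F s < 0\<close> this quadratic form has no zero on the curve, and its sign separates the ovals.\<close>

definition sep_form :: "real \<Rightarrow> real^3 \<Rightarrow> real" where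
  "sep_form s z = b1 * ((m2 z * m3 z - (u1 + b1 * s) * (w z)\<^sup>2)
    + m1 z * ((u2 + b2 * s) * m2 z + (u3 + b3 * s) * m3 z - (r + \<beta> * s) * w z))"

lemma b_nz: "b1 \<noteq> 0" "b2 \<noteq> 0" "b3 \<noteq> 0" using neg by auto

lemma cont: "continuous_on S m1" "continuous_on S m2" "continuous_on S m3" "continuous_on S w"
  using lin by (auto simp: linear_continuous_on linear_linear)

lemma scale: "m1 (c *\<^sub>R z) = c * m1 z" "m2 (c *\<^sub>R z) = c * m2 z" "m3 (c *\<^sub>R z) = c * m3 z"
  "w (c *\<^sub>R z) = c * w z"
  using lin by (simp_all add: linear_cmul)

lemma Phi_scale: "Phi (c *\<^sub>R z) = c^3 * Phi z"
  unfolding Phi_def scale by algebra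

lemma sep_form_scale: "sep_form s (c *\<^sub>R z) = c\<^sup>2 * sep_form s z"
  unfolding sep_form_def scale by algebra

text \<open>\<open>s\<close> is arbitrary: this is the invariance of the cubic under the motion of u
  and r.\<close>

lemma Phi_eq: "Phi z = m1 z * (m2 z * m3 z - (u1 + b1 * s) * (w z)\<^sup>2)
    - (w z)\<^sup>2 * ((u2 + b2 * s) * m2 z + (u3 + b3 * s) * m3 z - (r + \<beta> * s) * w z)"
  unfolding Phi_def using rel[of z] by algebra

lemma at_level_Phi: "at_level s z \<Longrightarrow> Phi z = 0"
  unfolding at_level_def Phi_eq[of z s] by simp

lemma at_inf_Phi: "at_inf z \<Longrightarrow> Phi z = 0"
  unfolding at_inf_def Phi_def by simp

lemma coords_zero: "m2 z = 0 \<Longrightarrow> m3 z = 0 \<Longrightarrow> w z = 0 \<Longrightarrow> z = 0"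
  using rel[of z] sep[of z] b_nz by auto

text \<open>If w is nonzero, the first equation can be solved for \<open>s\<close>, which has
  coefficient \<open>b1 * (w z)\<^sup>2\<close>. If w = 0, the second one can, since
  \<open>rel\<close> turns its coefficient of \<open>s\<close> into
  \<open>- b1 * m1 z\<close>.\<close>

lemma level_exists:
  assumes "Phi z = 0" "\<not> at_inf z"
  shows "\<exists>s. at_level s z"
proof (cases "w z = 0")
  case False
  define s where "s = (m2 z * m3 z - u1 * (w z)\<^sup>2) / (b1 * (w z)\<^sup>2)"
  have "s * (b1 * (w z)\<^sup>2) = m2 z * m3 z - u1 * (w z)\<^sup>2"
    unfolding s_def using False b_nz by simp
  then have g: "m2 z * m3 z = (u1 + b1 * s) * (w z)\<^sup>2" by (simp add: algebra_simps)
  then have "(w z)\<^sup>2 * ((u2 + b2 * s) * m2 z + (u3 + b3 * s) * m3 z - (r + \<beta> * s) * w z) = 0"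
    using assms(1) Phi_eq[of z s] by simp
  then show ?thesis using g False unfolding at_level_def by (intro exI[of _ s]) simp
next
  case True
  then have m1: "m1 z \<noteq> 0" using assms(2) by (simp add: at_inf_def)
  define s where "s = (u2 * m2 z + u3 * m3 z - r * w z) / (b1 * m1 z)"
  have "s * (b1 * m1 z) = u2 * m2 z + u3 * m3 z - r * w z"
    unfolding s_def using m1 b_nz by simp
  then have h: "(u2 + b2 * s) * m2 z + (u3 + b3 * s) * m3 z = (r + \<beta> * s) * w z"
    using rel[of z] by algebra
  then have "m1 z * (m2 z * m3 z - (u1 + b1 * s) * (w z)\<^sup>2) = 0"
    using assms(1) Phi_eq[of z s] by simp
  then show ?thesis using h m1 unfolding at_level_def by (intro exI[of _ s]) simp
qed

text \<open>\<open>(u2 + b2 * s) * m2 z\<close> and \<open>(u3 + b3 * s) * m3 z\<close> are the real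
  roots of a quadratic with known sum and product, and its discriminant is
  \<open>F s * (w z)\<^sup>2\<close>. At w = 0 one of \<open>u2 + b2 * s\<close> and
  \<open>u3 + b3 * s\<close> vanishes, and \<open>F s\<close> is itself a square.\<close>

lemma at_level_F_nonneg:
  assumes l: "at_level s z" and z: "z \<noteq> 0"
  shows "F s \<ge> 0"
proof (cases "w z = 0")
  case False
  let ?U1 = "u1 + b1 * s" and ?U2 = "u2 + b2 * s" and ?U3 = "u3 + b3 * s" and ?R = "r + \<beta> * s"
  have g: "m2 z * m3 z = ?U1 * (w z)\<^sup>2" and h: "?U2 * m2 z + ?U3 * m3 z = ?R * w z"
    using l unfolding at_level_def by auto
  have "F s * (w z)\<^sup>2 = (?R * w z)\<^sup>2 - 4 * ?U2 * ?U3 * (?U1 * (w z)\<^sup>2)"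
    unfolding F_def by algebra
  also have "\<dots> = (?U2 * m2 z - ?U3 * m3 z)\<^sup>2"
    unfolding g[symmetric] h[symmetric] by algebra
  finally have "F s * (w z)\<^sup>2 \<ge> 0" by simp
  then show ?thesis using False by (simp add: zero_le_mult_iff)
next
  case True
  then have "m2 z = 0 \<and> u3 + b3 * s = 0 \<or> m3 z = 0 \<and> u2 + b2 * s = 0"
    using l coords_zero[of z] z unfolding at_level_def by auto
  then show ?thesis unfolding F_def by auto
qed

lemma at_level_not_inf: "at_level s z \<Longrightarrow> z \<noteq> 0 \<Longrightarrow> \<not> at_inf z"
  using rel[of z] sep[of z] b_nz unfolding at_level_def at_inf_def by auto

text \<open>Passing to level \<open>s'\<close> changes the two equations by
  \<open>b1 * (s - s') * (w z)\<^sup>2\<close> and \<open>b1 * m1 z * (s - s')\<close>. The form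
  combines both into a multiple of \<open>s - s'\<close> that is positive off the point m1 = w =
  0.\<close>

lemma sep_form_level:
  assumes "at_level s z"
  shows "sep_form s' z = b1\<^sup>2 * (s - s') * ((w z)\<^sup>2 + (m1 z)\<^sup>2)"
proof -
  have "m2 z * m3 z - (u1 + b1 * s') * (w z)\<^sup>2 = b1 * (s - s') * (w z)\<^sup>2"
    using assms unfolding at_level_def by algebra
  moreover have "(u2 + b2 * s') * m2 z + (u3 + b3 * s') * m3 z - (r + \<beta> * s') * w z = b1 * m1 z * (s - s')"
    using assms rel[of z] unfolding at_level_def by algebra
  ultimately show ?thesis unfolding sep_form_def by algebra
qed

lemma sep_form_level_sgn:
  assumes "at_level s z" "z \<noteq> 0"
  shows "sep_form s' z > 0 \<longleftrightarrow> s > s'" "sep_form s' z < 0 \<longleftrightarrow> s < s'"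
proof -
  have "(w z)\<^sup>2 + (m1 z)\<^sup>2 > 0"
    using at_level_not_inf[OF assms] unfolding at_inf_def
    by (auto simp: sum_power2_gt_zero_iff)
  then have "b1\<^sup>2 * ((w z)\<^sup>2 + (m1 z)\<^sup>2) > 0" using b_nz by simp
  moreover have "sep_form s' z = (b1\<^sup>2 * ((w z)\<^sup>2 + (m1 z)\<^sup>2)) * (s - s')"
    unfolding sep_form_level[OF assms(1)] by simp
  ultimately show "sep_form s' z > 0 \<longleftrightarrow> s > s'" "sep_form s' z < 0 \<longleftrightarrow> s < s'"
    by (simp_all add: zero_less_mult_iff mult_less_0_iff)
qed

text \<open>Here \<open>b1 * b2 * b3 < 0\<close> enters: the value is
  \<open>- b1 * b2 * b3 * (m2 z / b3)\<^sup>2\<close>, so the point over \<infinity> counts as s =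
  +\<infinity>.\<close>

lemma sep_form_inf:
  assumes "at_inf z" "z \<noteq> 0"
  shows "sep_form s z > 0"
proof -
  have z: "m1 z = 0" "w z = 0" and r0: "b2 * m2 z = - (b3 * m3 z)"
    using assms rel[of z] unfolding at_inf_def by auto
  then have "m2 z \<noteq> 0" using sep[of z] assms(2) b_nz by auto
  then have "- (b1 * b2 * b3) * (m2 z)\<^sup>2 > 0" using neg by (intro mult_pos_pos) auto
  moreover have "b3\<^sup>2 * sep_form s z = b1 * b3 * m2 z * (b3 * m3 z)"
    by (simp add: sep_form_def z power2_eq_square)
  moreover have "b3 * m3 z = - (b2 * m2 z)" using r0 by simp
  ultimately have "b3\<^sup>2 * sep_form s z > 0" by (simp add: power2_eq_square ac_simps)
  then show ?thesis by (simp add: zero_less_mult_iff)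
qed

lemma sep_form_nonzero:
  assumes "F s < 0" "Phi z = 0" "z \<noteq> 0"
  shows "sep_form s z \<noteq> 0"
proof (cases "at_inf z")
  case True
  then show ?thesis using sep_form_inf[OF True assms(3), of s] by simp
next
  case False
  then obtain s' where s': "at_level s' z" using level_exists assms by blast
  then have "s' \<noteq> s" using at_level_F_nonneg[OF s' assms(3)] assms(1) by auto
  then show ?thesis using sep_form_level_sgn[OF s' assms(3), of s] by linarith
qed

lemma inf_point: "\<exists>z. z \<noteq> 0 \<and> at_inf z"
proof -
  obtain z where "m1 z = 0" "m2 z = b3" "m3 z = - b2" "w z = 0"
    using surj[of 0 b3 "- b2" 0] by auto
  then show ?thesis using b_nz lin(2) unfolding at_inf_def by (metis linear_0)
qed

lemma affine_level_point:
  assumes "F s \<ge> 0" "u2 + b2 * s \<noteq> 0" "u3 + b3 * s \<noteq> 0"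
  shows "\<exists>z. w z = 1 \<and> at_level s z"
proof -
  \<comment> \<open>The roots of the quadratic from \<open>at_level_F_nonneg\<close> at w = 1. They
    are to be the values of \<open>(u2 + b2 * s) * m2 z\<close> and
    \<open>(u3 + b3 * s) * m3 z\<close>.\<close>
  define q p where "q = (r + \<beta> * s + sqrt (F s)) / 2" and "p = (r + \<beta> * s - sqrt (F s)) / 2"
  have "4 * (p * q) = (r + \<beta> * s)\<^sup>2 - (sqrt (F s))\<^sup>2"
    unfolding p_def q_def by (simp add: field_simps power2_eq_square)
  also have "\<dots> = 4 * ((u1 + b1 * s) * (u2 + b2 * s) * (u3 + b3 * s))"
    using assms(1) by (simp add: F_def)
  finally have pq: "p * q = (u1 + b1 * s) * (u2 + b2 * s) * (u3 + b3 * s)" by simp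
  let ?x = "q / (u2 + b2 * s)" and ?y = "p / (u3 + b3 * s)"
  have "b1 * ((\<beta> - b2 * ?x - b3 * ?y) / b1) + b2 * ?x + b3 * ?y = \<beta> * 1" using b_nz by simp
  then obtain z where "m2 z = ?x" "m3 z = ?y" "w z = 1" using surj by blast
  moreover have "?x * ?y = u1 + b1 * s" 
    unfolding times_divide_times_eq mult.commute[of q p] pq using assms(2,3) by simp
  moreover have "p + q = r + \<beta> * s" by (simp add: p_def q_def field_simps)
  ultimately show ?thesis using assms unfolding at_level_def by (intro exI[of _ z]) simp
qed

text \<open>(m2, m3, w) are linear coordinates on R^3, because \<open>rel\<close> determines m1 from
  them.\<close>

lemma frame:
  obtains e2 e3 e0 where "\<And>x y c. m2 (x *\<^sub>R e2 + y *\<^sub>R e3 + c *\<^sub>R e0) = x"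
    "\<And>x y c. m3 (x *\<^sub>R e2 + y *\<^sub>R e3 + c *\<^sub>R e0) = y"
    "\<And>x y c. w (x *\<^sub>R e2 + y *\<^sub>R e3 + c *\<^sub>R e0) = c"
proof -
  have ex: "\<exists>z. m2 z = x \<and> m3 z = y \<and> w z = c" for x y c
    using surj[of "(\<beta> * c - b2 * x - b3 * y) / b1" x y c] b_nz by auto
  obtain e2 where e2: "m2 e2 = 1 \<and> m3 e2 = 0 \<and> w e2 = 0" using ex[of 1 0 0] by blast
  obtain e3 where e3: "m2 e3 = 0 \<and> m3 e3 = 1 \<and> w e3 = 0" using ex[of 0 1 0] by blast
  obtain e0 where e0: "m2 e0 = 0 \<and> m3 e0 = 0 \<and> w e0 = 1" using ex[of 0 0 1] by blast
  show thesis
    by (rule that[of e2 e3 e0]) (use e2 e3 e0 lin in \<open>simp_all add: linear_add linear_cmul\<close>)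
qed

lemma proj_pt_eq_coords:
  assumes "v \<noteq> 0" "z \<noteq> 0" "m2 v * m3 z = m3 v * m2 z" "m2 v * w z = w v * m2 z" "m3 v * w z = w v * m3 z"
  shows "proj_pt v = proj_pt z"
proof -
  have "\<exists>c. m2 v = c * m2 z \<and> m3 v = c * m3 z \<and> w v = c * w z"
  proof -
    consider "m2 z \<noteq> 0" | "m3 z \<noteq> 0" | "w z \<noteq> 0" using coords_zero[of z] assms(2) by blast
    then show ?thesis
    proof cases
      case 1
      show ?thesis by (rule exI[of _ "m2 v / m2 z"]) (use 1 assms in \<open>auto simp: field_simps\<close>)
    next
      case 2
      show ?thesis by (rule exI[of _ "m3 v / m3 z"]) (use 2 assms in \<open>auto simp: field_simps\<close>)
    next
      case 3
      show ?thesis by (rule exI[of _ "w v / w z"]) (use 3 assms in \<open>auto simp: field_simps\<close>)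
    qed
  qed
  then obtain c where c: "m2 v = c * m2 z" "m3 v = c * m3 z" "w v = c * w z" by blast
  have "v - c *\<^sub>R z = 0"
    by (rule coords_zero) (use c lin in \<open>simp_all add: linear_diff linear_cmul\<close>)
  then have v: "v = c *\<^sub>R z" by simp
  then have "c \<noteq> 0" using assms(1) by auto
  then show ?thesis unfolding v by (rule proj_pt_scale)
qed

section \<open>Mutual position of the three points at infinity\<close>

lemma F_neg_prod:
  assumes "F s < 0"
  shows "(u1 + b1 * s) * (u2 + b2 * s) * (u3 + b3 * s) > 0"
proof -
  have "(r + \<beta> * s)\<^sup>2 < 4 * ((u1 + b1 * s) * (u2 + b2 * s) * (u3 + b3 * s))"
    using assms unfolding F_def by (simp only: mult.assoc)
  then show ?thesis using zero_le_power2[of "r + \<beta> * s"] by linarith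
qed

text \<open>On the affine part the forms of indices 2 and 3 are positive multiples of
  \<open>b2 * ?G2\<close> and \<open>b3 * ?G3\<close>. On the curve \<open>?G2 * ?G3\<close> is w^2
  times a binary quadratic form in m1 and w with discriminant \<open>F s < 0\<close>, so it has the
  sign of \<open>u1 + b1 * s\<close>. The three points with w = 0 are checked directly. Hence the
  ovals are labelled alike by indices 2 and 3.\<close>

lemma sep_form_pos_pair:
  assumes F: "F s < 0" and pos: "b2 * b3 * (u1 + b1 * s) > 0" and z: "Phi z = 0" "z \<noteq> 0"
  shows "pencil_cubic.sep_form m2 m3 m1 w b2 b3 b1 \<beta> u2 u3 u1 r s z *
    pencil_cubic.sep_form m3 m1 m2 w b3 b1 b2 \<beta> u3 u1 u2 r s z > 0"
proof -
  interpret rot: pencil_cubic m2 m3 m1 w b2 b3 b1 \<beta> u2 u3 u1 r by (rule rotate)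
  interpret rot2: pencil_cubic m3 m1 m2 w b3 b1 b2 \<beta> u3 u1 u2 r by (rule rot.rotate)
  let ?U1 = "u1 + b1 * s" and ?U2 = "u2 + b2 * s" and ?U3 = "u3 + b3 * s" and ?R = "r + \<beta> * s"
  have UUU: "?U1 * ?U2 * ?U3 > 0" using F by (rule F_neg_prod)
  have bbUU: "b2 * b3 * (?U2 * ?U3) > 0"
  proof -
    have "(b2 * b3 * ?U1) * (?U1 * ?U2 * ?U3) > 0" using pos UUU by (rule mult_pos_pos)
    then have "?U1\<^sup>2 * (b2 * b3 * (?U2 * ?U3)) > 0" by (simp only: power2_eq_square ac_simps)
    moreover have "?U1\<^sup>2 > 0" using pos by auto
    ultimately show ?thesis by (rule zero_less_mult_pos)
  qed
  let ?w2 = "(w z)\<^sup>2"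
  let ?G2 = "m3 z * m1 z - ?U2 * ?w2" and ?G3 = "m1 z * m2 z - ?U3 * ?w2"
  have P1: "m1 z * (m2 z * m3 z - ?U1 * ?w2) = ?w2 * (?U2 * m2 z + ?U3 * m3 z - ?R * w z)"
    using Phi_eq[of z s] z by simp
  show ?thesis
  proof (cases "w z = 0")
    case False
    then have w2: "?w2 > 0" by simp
    have e2: "?w2 * rot.sep_form s z = (?w2 + (m2 z)\<^sup>2) * (b2 * ?G2)"
      unfolding rot.sep_form_def using P1 by algebra
    have e3: "?w2 * rot2.sep_form s z = (?w2 + (m3 z)\<^sup>2) * (b3 * ?G3)"
      unfolding rot2.sep_form_def using P1 by algebra
    have GG: "?G2 * ?G3 = ?w2 * (?U1 * (m1 z)\<^sup>2 - ?R * m1 z * w z + ?U2 * ?U3 * ?w2)"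
      using P1 by algebra
    have e: "?U1 * (4 * (?U1 * (m1 z)\<^sup>2 - ?R * m1 z * w z + ?U2 * ?U3 * ?w2))
        = (2 * ?U1 * m1 z - ?R * w z)\<^sup>2 - F s * ?w2"
      unfolding F_def by algebra
    define Q where "Q = ?U1 * (m1 z)\<^sup>2 - ?R * m1 z * w z + ?U2 * ?U3 * ?w2"
    have "F s * ?w2 < 0" using F w2 by (rule mult_neg_pos)
    then have Q: "?U1 * Q > 0" using e zero_le_power2[of "2 * ?U1 * m1 z - ?R * w z"]
      unfolding Q_def[symmetric] by linarith
    have "(b2 * b3 * ?U1) * (?w2 * (?U1 * Q)) > 0"
      by (rule mult_pos_pos[OF pos mult_pos_pos[OF w2 Q]])
    also have "(b2 * b3 * ?U1) * (?w2 * (?U1 * Q)) = ?U1\<^sup>2 * (b2 * b3 * (?w2 * Q))"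
      by (simp only: power2_eq_square ac_simps)
    also have "\<dots> = ?U1\<^sup>2 * ((b2 * ?G2) * (b3 * ?G3))"
      unfolding Q_def GG[symmetric] by (simp only: ac_simps)
    finally have "?U1\<^sup>2 * ((b2 * ?G2) * (b3 * ?G3)) > 0" .
    moreover have "?U1\<^sup>2 > 0" using pos by auto
    ultimately have "(b2 * ?G2) * (b3 * ?G3) > 0" by (rule zero_less_mult_pos)
    moreover have "?w2 + (m2 z)\<^sup>2 > 0" "?w2 + (m3 z)\<^sup>2 > 0" using w2 by (simp_all add: add_pos_nonneg)
    ultimately have "((?w2 + (m2 z)\<^sup>2) * (?w2 + (m3 z)\<^sup>2)) * ((b2 * ?G2) * (b3 * ?G3)) > 0"
      by (rule mult_pos_pos[OF mult_pos_pos, rotated 2])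
    also have "((?w2 + (m2 z)\<^sup>2) * (?w2 + (m3 z)\<^sup>2)) * ((b2 * ?G2) * (b3 * ?G3))
        = (?w2 * rot.sep_form s z) * (?w2 * rot2.sep_form s z)"
      unfolding e2 e3 by simp
    also have "\<dots> = (?w2 * ?w2) * (rot.sep_form s z * rot2.sep_form s z)" by (simp only: ac_simps)
    finally have "(?w2 * ?w2) * (rot.sep_form s z * rot2.sep_form s z) > 0" .
    moreover have "?w2 * ?w2 > 0" using w2 by (rule mult_pos_pos[OF _ w2])
    ultimately show ?thesis by (rule zero_less_mult_pos)
  next
    case True
    have rel0: "b1 * m1 z + b2 * m2 z + b3 * m3 z = 0" using rel[of z] True by simp
    have "m1 z * (m2 z * m3 z) = 0" using z True by (simp add: Phi_def)
    then consider "m1 z = 0" | "m2 z = 0" | "m3 z = 0" by auto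
    then show ?thesis
    proof cases
      case 1
      have nz: "m2 z \<noteq> 0" "m3 z \<noteq> 0" using rel0 1 True sep[of z] z b_nz by auto
      have "rot.sep_form s z * rot2.sep_form s z = (b2 * b3 * (?U2 * ?U3)) * (m2 z * m3 z)\<^sup>2"
        unfolding rot.sep_form_def rot2.sep_form_def using 1 True by (simp add: power2_eq_square)
      then show ?thesis using bbUU nz by simp
    next
      case 2
      have nz: "m1 z \<noteq> 0" "m3 z \<noteq> 0" using rel0 2 True sep[of z] z b_nz by auto
      have "rot.sep_form s z * rot2.sep_form s z = (b2 * b3 * ?U1) * (m1 z * m3 z)\<^sup>2"
        unfolding rot.sep_form_def rot2.sep_form_def using 2 True by (simp add: power2_eq_square)
      then show ?thesis using pos nz by simp
    next
      case 3
      have nz: "m1 z \<noteq> 0" "m2 z \<noteq> 0" using rel0 3 True sep[of z] z b_nz by auto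
      have "rot.sep_form s z * rot2.sep_form s z = (b2 * b3 * ?U1) * (m1 z * m2 z)\<^sup>2"
        unfolding rot.sep_form_def rot2.sep_form_def using 3 True by (simp add: power2_eq_square)
      then show ?thesis using pos nz by simp
    qed
  qed
qed

text \<open>Sum and product of \<open>Y2\<close> and \<open>Y3\<close> are controlled by m1 alone,
  that is, by the line through the point m1 = w = 0. The third identity ties the sign of
  \<open>Y3\<close> to the separating form of index 2.\<close>

lemma affine_identities:
  assumes "Phi z = 0" "w z = 1"
  defines "Y2 \<equiv> \<lambda>s. b2 * (m1 z * m2 z - (u3 + b3 * s))" and "Y3 \<equiv> \<lambda>s. b3 * (m1 z * m3 z - (u2 + b2 * s))"
  shows "Y2 s + Y3 s = - (b1 * (m1 z)\<^sup>2 - \<beta> * m1 z + (b2 * (u3 + b3 * s) + b3 * (u2 + b2 * s)))"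
    and "4 * (u1 + b1 * s) * (Y2 s * Y3 s) = b2 * b3 * ((2 * (u1 + b1 * s) * m1 z - (r + \<beta> * s))\<^sup>2 - F s)"
    and "pencil_cubic.sep_form m2 m3 m1 w b2 b3 b1 \<beta> u2 u3 u1 r s z * b3 = b2 * (1 + (m2 z)\<^sup>2) * Y3 s"
proof -
  interpret rot: pencil_cubic m2 m3 m1 w b2 b3 b1 \<beta> u2 u3 u1 r by (rule rotate)
  have P1: "m1 z * (m2 z * m3 z - (u1 + b1 * s)) = (u2 + b2 * s) * m2 z + (u3 + b3 * s) * m3 z - (r + \<beta> * s)"
    using Phi_eq[of z s] assms by simp
  have r1: "b1 * m1 z + b2 * m2 z + b3 * m3 z = \<beta>" using rel[of z] assms(2) by simp
  show "Y2 s + Y3 s = - (b1 * (m1 z)\<^sup>2 - \<beta> * m1 z + (b2 * (u3 + b3 * s) + b3 * (u2 + b2 * s)))"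
  proof -
    have "b2 * m2 z + b3 * m3 z = \<beta> - b1 * m1 z" using r1 by simp
    then have "m1 z * (b2 * m2 z + b3 * m3 z) = m1 z * (\<beta> - b1 * m1 z)" by (simp only:)
    then show ?thesis unfolding Y2_def Y3_def by (simp add: algebra_simps power2_eq_square)
  qed
  show "4 * (u1 + b1 * s) * (Y2 s * Y3 s) = b2 * b3 * ((2 * (u1 + b1 * s) * m1 z - (r + \<beta> * s))\<^sup>2 - F s)"
    unfolding Y2_def Y3_def F_def using P1 by algebra
  show "rot.sep_form s z * b3 = b2 * (1 + (m2 z)\<^sup>2) * Y3 s"
    unfolding Y3_def rot.sep_form_def assms(2) power_one mult_1_right using P1 by algebra
qed

text \<open>If the two points at infinity other than \<open>m1 = w = 0\<close> lie on the same component, then the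
  pencil of lines through the point \<open>m1 = w = 0\<close> contains one that meets the curve only there:
  on the line \<open>m1 = \<mu> w\<close> the two other intersection points are the roots of a quadratic equation
  whose discriminant is \<open>H(\<mu>)\<^sup>2\<close> minus a positive quantity.\<close>

lemma isolating_line:
  assumes F: "F s < 0" and pos: "b2 * b3 * (u1 + b1 * s) > 0"
    and z0: "Phi z0 = 0" "w z0 = 1" "pencil_cubic.sep_form m2 m3 m1 w b2 b3 b1 \<beta> u2 u3 u1 r s z0 < 0"
  shows "\<exists>\<mu>. \<mu> \<noteq> 0 \<and> (\<forall>z. Phi z = 0 \<and> m1 z = \<mu> * w z \<longrightarrow> at_inf z)"
proof -
  let ?U1 = "u1 + b1 * s" and ?U2 = "u2 + b2 * s" and ?U3 = "u3 + b3 * s"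
  define k where "k = b2 * ?U3 + b3 * ?U2"
  define Y2 Y3 where "Y2 z = b2 * (m1 z * m2 z - ?U3)" and "Y3 z = b3 * (m1 z * m3 z - ?U2)" for z
  have YY: "Y2 z * Y3 z > 0" if z: "Phi z = 0" "w z = 1" for z
  proof -
    define D where "D = (2 * ?U1 * m1 z - (r + \<beta> * s))\<^sup>2 - F s"
    have "D > 0" unfolding D_def using F zero_le_power2[of "2 * ?U1 * m1 z - (r + \<beta> * s)"] by linarith
    then have "(b2 * b3 * ?U1) * D > 0" using pos by (rule mult_pos_pos[rotated])
    also have "(b2 * b3 * ?U1) * D = ?U1 * (b2 * b3 * D)" by (simp only: ac_simps)
    also have "\<dots> = ?U1 * (4 * ?U1 * (Y2 z * Y3 z))"
      unfolding D_def affine_identities(2)[OF z, of s, symmetric] Y2_def Y3_def ..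
    finally have "4 * ?U1\<^sup>2 * (Y2 z * Y3 z) > 0" by (simp only: power2_eq_square ac_simps)
    moreover have "4 * ?U1\<^sup>2 > 0" using pos by auto
    ultimately show ?thesis by (rule zero_less_mult_pos)
  qed
  have sum: "Y2 z + Y3 z = - (b1 * (m1 z)\<^sup>2 - \<beta> * m1 z + k)" if z: "Phi z = 0" "w z = 1" for z
    using affine_identities(1)[OF z, of s] unfolding Y2_def Y3_def k_def .
  define H where "H x = b1 * x\<^sup>2 - \<beta> * x + k" for x
  \<comment> \<open>\<open>H\<close> has two real roots: at \<open>z0\<close> both \<open>Y2\<close>
    and \<open>Y3\<close> have the sign opposite to \<open>b2 * b3\<close>, which makes
    \<open>b1 * H\<close> negative there, although its leading coefficient is a square.\<close>
  have disc: "\<beta>\<^sup>2 - 4 * b1 * k > 0"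
  proof -
    define x where "x = m1 z0"
    have "1 + (m2 z0)\<^sup>2 > 0" by (simp add: add_pos_nonneg)
    moreover have "b2 * b3 * (1 + (m2 z0)\<^sup>2) * Y3 z0 < 0"
    proof -
      define f where "f = pencil_cubic.sep_form m2 m3 m1 w b2 b3 b1 \<beta> u2 u3 u1 r s z0"
      have "b3\<^sup>2 * f < 0" using z0(3) b_nz by (simp add: mult_pos_neg f_def)
      also have "b3\<^sup>2 * f = b3 * (f * b3)" by (simp only: power2_eq_square ac_simps)
      also have "\<dots> = b2 * b3 * (1 + (m2 z0)\<^sup>2) * Y3 z0"
        unfolding f_def affine_identities(3)[OF z0(1,2), of s] Y3_def by (simp only: ac_simps)
      finally show ?thesis .
    qed
    moreover have "b2 * b3 * (1 + (m2 z0)\<^sup>2) * Y3 z0 = (1 + (m2 z0)\<^sup>2) * (b2 * b3 * Y3 z0)"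
      by (simp only: ac_simps)
    ultimately have y: "b2 * b3 * Y3 z0 < 0"
      by (metis mult_less_0_iff not_less_iff_gr_or_eq)
    have "(b2 * b3)\<^sup>2 * (Y2 z0 * Y3 z0) > 0" using YY[OF z0(1,2)] b_nz by simp
    then have "(b2 * b3 * Y2 z0) * (b2 * b3 * Y3 z0) > 0" by (simp only: power2_eq_square ac_simps)
    then have "b2 * b3 * Y2 z0 < 0" using y by (metis zero_less_mult_iff not_less_iff_gr_or_eq)
    then have "b2 * b3 * (Y2 z0 + Y3 z0) < 0" using y by (simp add: distrib_left)
    moreover have "Y2 z0 + Y3 z0 = - H x" using sum[OF z0(1,2)] unfolding H_def x_def .
    ultimately have "b2 * b3 * H x > 0" by simp
    then have "(b1 * b2 * b3) * (b2 * b3 * H x) < 0" by (rule mult_neg_pos[OF neg])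
    then have "(b2 * b3)\<^sup>2 * (b1 * H x) < 0" by (simp only: power2_eq_square ac_simps)
    then have "b1 * H x < 0" using zero_le_power2[of "b2 * b3"] by (metis mult_less_0_iff not_less)
    moreover have "4 * (b1 * H x) = (2 * b1 * x - \<beta>)\<^sup>2 - (\<beta>\<^sup>2 - 4 * b1 * k)"
      unfolding H_def by algebra
    ultimately show ?thesis using zero_le_power2[of "2 * b1 * x - \<beta>"] by linarith
  qed
  \<comment> \<open>A root of \<open>H\<close>. Points of the curve with m1 = \<mu> and w = 1 would
    satisfy Y2 + Y3 = 0 and Y2 * Y3 > 0.\<close>
  define \<mu> where "\<mu> = (\<beta> + sqrt (\<beta>\<^sup>2 - 4 * b1 * k)) / (2 * b1)"
  have "2 * b1 * \<mu> - \<beta> = sqrt (\<beta>\<^sup>2 - 4 * b1 * k)" unfolding \<mu>_def using b_nz by simp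
  then have "(2 * b1 * \<mu> - \<beta>)\<^sup>2 = \<beta>\<^sup>2 - 4 * b1 * k" using disc by simp
  then have "4 * b1 * H \<mu> = 0" unfolding H_def by algebra
  then have H0: "H \<mu> = 0" using b_nz by simp
  \<comment> \<open>The line m1 = 0 is tangent to the curve at m1 = w = 0, so \<mu> \<noteq> 0 makes
    the crossing there transversal; \<open>not_contractible\<close> relies on this.\<close>
  have "\<mu> \<noteq> 0"
  proof
    assume "\<mu> = 0"
    then have k0: "k = 0" using H0 by (simp add: H_def)
    have "?U1 * ?U2 * ?U3 > 0" using F by (rule F_neg_prod)
    then have "(b2 * b3 * ?U1) * (?U1 * ?U2 * ?U3) > 0" using pos by (rule mult_pos_pos[rotated])
    moreover have "(b2 * b3 * ?U1) * (?U1 * ?U2 * ?U3) = - (?U1 * (b2 * ?U3))\<^sup>2"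
      using k0 unfolding k_def by algebra
    ultimately show False using zero_le_power2[of "?U1 * (b2 * ?U3)"] by linarith
  qed
  moreover have "at_inf z" if z: "Phi z = 0" "m1 z = \<mu> * w z" for z
  proof (rule ccontr)
    assume "\<not> at_inf z"
    then have wz: "w z \<noteq> 0" using z by (auto simp: at_inf_def)
    define z' where "z' = inverse (w z) *\<^sub>R z"
    have z': "Phi z' = 0" "w z' = 1" "m1 z' = \<mu>"
      using z wz by (simp_all add: z'_def Phi_scale scale)
    then have "Y2 z' = - Y3 z'" using sum[OF z'(1,2)] H0 by (simp add: H_def)
    then have "Y2 z' * Y3 z' = - (Y3 z' * Y3 z')" by simp
    then show False using YY[OF z'(1,2)] zero_le_square[of "Y3 z'"] by linarith
  qed
  ultimately show ?thesis by blast
qed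

section \<open>A closed parametrisation of the unbounded branch\<close>

text \<open>The factorisation of \<open>F\<close> at \<open>s3 + (c / d)\<^sup>2\<close>, cleared of
  the denominator \<open>d ^ 6\<close>. Its extension to d = 0, where only the leading coefficient
  survives, lets the parametrisation pass through s = \<infinity>.\<close>

lemma discriminant_homogeneous:
  assumes Fs: "\<And>s. F s = (s - s3) * (k2 * (s - s3)\<^sup>2 + k1 * (s - s3) + k0)"
    and k2: "k2 = - 4 * (b1 * b2 * b3)"
  shows "d\<^sup>2 * ((r + \<beta> * s3) * d\<^sup>2 + \<beta> * c\<^sup>2)\<^sup>2 - 4 * ((u1 + b1 * s3) * d\<^sup>2 + b1 * c\<^sup>2)
      * ((u2 + b2 * s3) * d\<^sup>2 + b2 * c\<^sup>2) * ((u3 + b3 * s3) * d\<^sup>2 + b3 * c\<^sup>2)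
    = c\<^sup>2 * (k2 * (c\<^sup>2)\<^sup>2 + k1 * c\<^sup>2 * d\<^sup>2 + k0 * (d\<^sup>2)\<^sup>2)"
proof (cases "d = 0")
  case True
  then show ?thesis unfolding k2 by (simp add: power2_eq_square)
next
  case False
  define x where "x = c\<^sup>2 / d\<^sup>2"
  have c: "c\<^sup>2 = x * d\<^sup>2" using False by (simp add: x_def)
  have "(r + \<beta> * (s3 + x))\<^sup>2 - 4 * (u1 + b1 * (s3 + x)) * (u2 + b2 * (s3 + x)) * (u3 + b3 * (s3 + x))
      = x * (k2 * x\<^sup>2 + k1 * x + k0)"
    using Fs[of "s3 + x"] unfolding F_def by simp
  then show ?thesis unfolding c by algebra
qed

text \<open>The arc of discriminant values \<open>s \<ge> s3\<close>, together with \<open>s = \<infinity>\<close>, is a closed curve. It is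
  parametrised by \<open>s = s3 + (c/d)\<^sup>2\<close> with \<open>(c, d) = (sin \<theta>, cos \<theta>)\<close>; the three coordinate vectors
  represent the same point and have no common zero.\<close>

lemma closed_path:
  assumes Fs: "\<And>s. F s = (s - s3) * (k2 * (s - s3)\<^sup>2 + k1 * (s - s3) + k0)"
    and k2: "k2 = - 4 * (b1 * b2 * b3)"
    and K: "\<And>v. v \<ge> 0 \<Longrightarrow> k2 * v\<^sup>2 + k1 * v + k0 > 0"
  obtains \<gamma> V a m where "continuous_map (top_of_set {- pi/2..pi/2}) rp2 \<gamma>"
    "\<And>\<theta>. \<theta> \<in> {- pi/2..pi/2} \<Longrightarrow> \<exists>z. z \<noteq> 0 \<and> \<gamma> \<theta> = proj_pt z \<and>
      (if cos \<theta> = 0 then at_inf z else \<exists>s\<ge>s3. at_level s z)"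
    "\<And>z. z \<noteq> 0 \<Longrightarrow> at_inf z \<or> (\<exists>s\<ge>s3. at_level s z) \<Longrightarrow> \<exists>\<theta>\<in>{- pi/2..pi/2}. \<gamma> \<theta> = proj_pt z"
    "continuous_on UNIV V" "continuous_on UNIV a" "continuous_on UNIV m"
    "\<And>\<theta>. V \<theta> \<noteq> 0 \<Longrightarrow> \<gamma> \<theta> = proj_pt (V \<theta>)"
    "V (- pi/2) = - V (pi/2)" "V (pi/2) \<noteq> 0"
    "\<And>\<theta>. w (V \<theta>) = cos \<theta> * a \<theta>" "\<And>\<theta>. m1 (V \<theta>) = cos \<theta> * (cos \<theta> * m \<theta>)"
    "a (pi/2) = b2 * b3" "a (- pi/2) = b2 * b3"
proof -
  obtain e2 e3 e0 where fr: "\<And>x y c. m2 (x *\<^sub>R e2 + y *\<^sub>R e3 + c *\<^sub>R e0) = x"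
    "\<And>x y c. m3 (x *\<^sub>R e2 + y *\<^sub>R e3 + c *\<^sub>R e0) = y"
    "\<And>x y c. w (x *\<^sub>R e2 + y *\<^sub>R e3 + c *\<^sub>R e0) = c" using frame by blast
  define vec where "vec x y c = x *\<^sub>R e2 + y *\<^sub>R e3 + c *\<^sub>R e0" for x y c :: real
  have vec: "m2 (vec x y c) = x" "m3 (vec x y c) = y" "w (vec x y c) = c" for x y c
    unfolding vec_def by (rule fr)+
  have vec0: "vec x y c = 0 \<longleftrightarrow> x = 0 \<and> y = 0 \<and> c = 0" for x y c
    using vec[of x y c] lin by (metis linear_0 coords_zero)
  have m1: "b1 * m1 z = \<beta> * w z - b2 * m2 z - b3 * m3 z" for z using rel[of z] by simp
  let ?V1 = "u1 + b1 * s3" and ?V2 = "u2 + b2 * s3" and ?V3 = "u3 + b3 * s3" and ?R = "r + \<beta> * s3"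
  \<comment> \<open>With s = s3 + tan^2 x, these and \<open>P\<close> are \<open>u1 + b1 * s\<close>
    etc. and \<open>r + \<beta> * s\<close>, times cos^2 x. The square of \<open>y\<close> is
    \<open>F s\<close> times cos^6 x. The sign of \<open>y\<close> is that of sin x, so
    \<open>x\<close> and \<open>- x\<close> lie over the same level.\<close>
  define D1 D2 D3 where "D1 x = ?V1 * (cos x)\<^sup>2 + b1 * (sin x)\<^sup>2"
    and "D2 x = ?V2 * (cos x)\<^sup>2 + b2 * (sin x)\<^sup>2" and "D3 x = ?V3 * (cos x)\<^sup>2 + b3 * (sin x)\<^sup>2" for x
  define P where "P x = ?R * (cos x)\<^sup>2 + \<beta> * (sin x)\<^sup>2" for x
  define Q where "Q x = k2 * ((sin x)\<^sup>2)\<^sup>2 + k1 * (sin x)\<^sup>2 * (cos x)\<^sup>2 + k0 * ((cos x)\<^sup>2)\<^sup>2" for x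
  define y where "y x = sin x * sqrt (Q x)" for x
  define p q where "p x = (cos x * P x - y x) / 2" and "q x = (cos x * P x + y x) / 2" for x
  have contD: "continuous_on S D1" "continuous_on S D2" "continuous_on S D3" "continuous_on S p"
    "continuous_on S q" "continuous_on S y" "continuous_on S P" for S
    unfolding D1_def D2_def D3_def p_def q_def P_def y_def Q_def
    by (intro continuous_intros; simp)+
  have Qpos: "Q x > 0" for x
  proof (cases "cos x = 0")
    case True
    then have "(sin x)\<^sup>2 = 1" using sin_cos_squared_add[of x] by simp
    then show ?thesis using True neg unfolding Q_def k2 by simp
  next
    case False
    define t where "t = (sin x)\<^sup>2 / (cos x)\<^sup>2"
    have s: "(sin x)\<^sup>2 = t * (cos x)\<^sup>2" using False by (simp add: t_def)
    have "Q x = (k2 * t\<^sup>2 + k1 * t + k0) * ((cos x)\<^sup>2)\<^sup>2" unfolding Q_def s by (simp add: algebra_simps power2_eq_square)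
    moreover have "t \<ge> 0" by (simp add: t_def)
    ultimately show ?thesis using K[of t] False by simp
  qed
  have y2: "(y x)\<^sup>2 = (cos x)\<^sup>2 * (P x)\<^sup>2 - 4 * D1 x * D2 x * D3 x" for x
    using discriminant_homogeneous[OF Fs k2, of "cos x" "sin x"] Qpos[of x]
    unfolding y_def D1_def D2_def D3_def P_def Q_def[symmetric] by (simp add: power_mult_distrib)
  have sum: "p x + q x = cos x * P x" for x by (simp add: p_def q_def field_simps)
  have prod: "p x * q x = D1 x * D2 x * D3 x" for x
  proof -
    have "4 * (p x * q x) = (cos x)\<^sup>2 * (P x)\<^sup>2 - (y x)\<^sup>2"
      unfolding p_def q_def by (simp add: field_simps power2_eq_square)
    then show ?thesis using y2[of x] by simp
  qed
  \<comment> \<open>In coordinates (m2 : m3 : w) the point is the first vector. The other two arise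
    from it by the factors \<open>q / D3\<close> and \<open>p / D2\<close>, simplified with
    \<open>p * q = D1 * D2 * D3\<close>; they can remain nonzero where the first one
    vanishes.\<close>
  define V where "V i x = (if i = 0 then vec (q x * D3 x) (p x * D2 x) (cos x * D2 x * D3 x)
    else if i = 1 then vec ((q x)\<^sup>2) (D1 x * (D2 x)\<^sup>2) (cos x * D2 x * q x)
    else vec (D1 x * (D3 x)\<^sup>2) ((p x)\<^sup>2) (cos x * p x * D3 x))" for i :: nat and x
  have V_simps: "V 0 x = vec (q x * D3 x) (p x * D2 x) (cos x * D2 x * D3 x)"
    "V (Suc 0) x = vec ((q x)\<^sup>2) (D1 x * (D2 x)\<^sup>2) (cos x * D2 x * q x)"
    "V 2 x = vec (D1 x * (D3 x)\<^sup>2) ((p x)\<^sup>2) (cos x * p x * D3 x)" for x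
    unfolding V_def by simp_all
  define I :: "nat set" where "I = {0, 1, 2}"
  have contV: "continuous_on S (V i)" for i S
    unfolding V_def vec_def
    by (cases "i = 0"; cases "i = 1") (auto intro!: continuous_intros contD)
  have level_shift: "D1 x = (u1 + b1 * s) * (cos x)\<^sup>2" "D2 x = (u2 + b2 * s) * (cos x)\<^sup>2"
    "D3 x = (u3 + b3 * s) * (cos x)\<^sup>2" "P x = (r + \<beta> * s) * (cos x)\<^sup>2"
    if "s = s3 + (sin x)\<^sup>2 / (cos x)\<^sup>2" "cos x \<noteq> 0" for x s
    using that unfolding D1_def D2_def D3_def P_def by (simp_all add: field_simps)
  have cos0: "D1 x = b1" "D2 x = b2" "D3 x = b3" "p x + q x = 0" "P x = \<beta>" if "cos x = 0" for x
  proof -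
    have "(sin x)\<^sup>2 = 1" using that sin_cos_squared_add[of x] by simp
    then show "D1 x = b1" "D2 x = b2" "D3 x = b3" "p x + q x = 0" "P x = \<beta>"
      unfolding D1_def D2_def D3_def P_def sum using that by simp_all
  qed
  \<comment> \<open>A common zero forces p = q = 0. At cos x = 0 this contradicts
    \<open>p * q = b1 * b2 * b3\<close>. Otherwise \<open>r + \<beta> * s\<close> and two of the
    three linear factors vanish, so \<open>F\<close> has a double root, against
    \<open>nondeg\<close>.\<close>
  have Vex: "\<exists>i\<in>I. V i x \<noteq> 0" for x
  proof (rule ccontr)
    assume "\<not> ?thesis"
    then have z: "V 0 x = 0" "V (Suc 0) x = 0" "V 2 x = 0" unfolding I_def by auto
    then have pq0: "p x = 0" "q x = 0" unfolding V_simps vec0 by auto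
    show False
    proof (cases "cos x = 0")
      case True
      then show ?thesis using prod[of x] pq0 cos0[of x] b_nz by simp
    next
      case False
      define s where "s = s3 + (sin x)\<^sup>2 / (cos x)\<^sup>2"
      note ls = level_shift[OF s_def False]
      have two: "D1 x = 0 \<or> D2 x = 0" "D1 x = 0 \<or> D3 x = 0" "D2 x = 0 \<or> D3 x = 0"
        using z False unfolding V_simps vec0 by auto
      have "P x = 0" using sum[of x] pq0 False by simp
      then have R0: "r + \<beta> * s = 0" using ls(4) False by simp
      have t2: "u1 + b1 * s = 0 \<or> u2 + b2 * s = 0" "u1 + b1 * s = 0 \<or> u3 + b3 * s = 0"
        "u2 + b2 * s = 0 \<or> u3 + b3 * s = 0"
        using two False unfolding ls(1-3) by auto
      show ?thesis using nondeg[of s] R0 t2 by auto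
    qed
  qed
  have Vpar: "proj_pt (V i x) = proj_pt (V j x)"
    if "i \<in> I" "j \<in> I" "V i x \<noteq> 0" "V j x \<noteq> 0" for i j x
  proof -
    have par: "proj_pt (V 0 x) = proj_pt (V (Suc 0) x)" if "V 0 x \<noteq> 0" "V (Suc 0) x \<noteq> 0"
    proof (rule proj_pt_eq_coords[OF that]; unfold V_simps vec)
      show "(q x * D3 x) * (D1 x * (D2 x)\<^sup>2) = (p x * D2 x) * (q x)\<^sup>2"
        using arg_cong[OF prod[of x], of "\<lambda>t. t * (D2 x * q x)"] by (simp only: power2_eq_square ac_simps)
      show "(q x * D3 x) * (cos x * D2 x * q x) = (cos x * D2 x * D3 x) * (q x)\<^sup>2"
        by (simp only: power2_eq_square ac_simps)
      show "(p x * D2 x) * (cos x * D2 x * q x) = (cos x * D2 x * D3 x) * (D1 x * (D2 x)\<^sup>2)"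
        using arg_cong[OF prod[of x], of "\<lambda>t. t * (cos x * (D2 x * D2 x))"] by (simp only: power2_eq_square ac_simps)
    qed
    have par2: "proj_pt (V 0 x) = proj_pt (V 2 x)" if "V 0 x \<noteq> 0" "V 2 x \<noteq> 0"
    proof (rule proj_pt_eq_coords[OF that]; unfold V_simps vec)
      show "(q x * D3 x) * (p x)\<^sup>2 = (p x * D2 x) * (D1 x * (D3 x)\<^sup>2)"
        using arg_cong[OF prod[of x], of "\<lambda>t. t * (p x * D3 x)"] by (simp only: power2_eq_square ac_simps)
      show "(q x * D3 x) * (cos x * p x * D3 x) = (cos x * D2 x * D3 x) * (D1 x * (D3 x)\<^sup>2)"
        using arg_cong[OF prod[of x], of "\<lambda>t. t * (cos x * (D3 x * D3 x))"] by (simp only: power2_eq_square ac_simps)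
      show "(p x * D2 x) * (cos x * p x * D3 x) = (cos x * D2 x * D3 x) * (p x)\<^sup>2"
        by (simp only: power2_eq_square ac_simps)
    qed
    have par3: "proj_pt (V (Suc 0) x) = proj_pt (V 2 x)" if "V (Suc 0) x \<noteq> 0" "V 2 x \<noteq> 0"
    proof (rule proj_pt_eq_coords[OF that]; unfold V_simps vec)
      show "(q x)\<^sup>2 * (p x)\<^sup>2 = (D1 x * (D2 x)\<^sup>2) * (D1 x * (D3 x)\<^sup>2)"
        using arg_cong[OF prod[of x], of "\<lambda>t. t * t"] by (simp only: power2_eq_square ac_simps)
      show "(q x)\<^sup>2 * (cos x * p x * D3 x) = (cos x * D2 x * q x) * (D1 x * (D3 x)\<^sup>2)"
        using arg_cong[OF prod[of x], of "\<lambda>t. t * (q x * cos x * D3 x)"] by (simp only: power2_eq_square ac_simps)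
      show "(D1 x * (D2 x)\<^sup>2) * (cos x * p x * D3 x) = (cos x * D2 x * q x) * (p x)\<^sup>2"
        using arg_cong[OF prod[of x], of "\<lambda>t. t * (D2 x * cos x * p x)"] by (simp only: power2_eq_square ac_simps)
    qed
    show ?thesis using that par par2 par3 unfolding I_def by auto
  qed
  define \<gamma> where "\<gamma> x = proj_pt (V (SOME i. i \<in> I \<and> V i x \<noteq> 0) x)" for x
  have \<gamma>: "\<gamma> x = proj_pt (V i x)" if "i \<in> I" "V i x \<noteq> 0" for i x
  proof -
    define k where "k = (SOME i. i \<in> I \<and> V i x \<noteq> 0)"
    have "\<exists>i. i \<in> I \<and> V i x \<noteq> 0" using Vex[of x] by blast
    then have "k \<in> I \<and> V k x \<noteq> 0" unfolding k_def by (rule someI_ex)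
    then have "proj_pt (V k x) = proj_pt (V i x)" using that by (intro Vpar) auto
    then show ?thesis unfolding \<gamma>_def k_def .
  qed
  have cont\<gamma>: "continuous_map (top_of_set {- pi/2..pi/2}) rp2 \<gamma>"
    by (rule continuous_map_into_rp2[where V = V and I = I]) (use contV Vex \<gamma> in auto)
  have on_curve: "\<exists>z. z \<noteq> 0 \<and> \<gamma> x = proj_pt z \<and>
      (if cos x = 0 then at_inf z else \<exists>s\<ge>s3. at_level s z)" for x
  proof -
    obtain i where i: "i \<in> I" "V i x \<noteq> 0" using Vex by blast
    have "if cos x = 0 then at_inf (V i x) else \<exists>s\<ge>s3. at_level s (V i x)"
    proof (cases "cos x = 0")
      case True
      note c0 = cos0[OF True]
      have q: "p x = - q x" using c0(4) by simp
      have pr: "- (q x * q x) = b1 * b2 * b3" using prod[of x] unfolding c0(1-3) q by simp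
      have "b1 * m1 (V 0 x) = 0" unfolding m1 V_simps vec c0(1-3) q True by simp
      moreover have "b1 * m1 (V (Suc 0) x) = 0"
        using arg_cong[OF pr, of "\<lambda>t. t * b2"]
        unfolding m1 V_simps vec c0(1-3) True by (simp add: algebra_simps power2_eq_square)
      moreover have "b1 * m1 (V 2 x) = 0"
        using arg_cong[OF pr, of "\<lambda>t. t * b3"]
        unfolding m1 V_simps vec c0(1-3) q True by (simp add: algebra_simps power2_eq_square)
      ultimately have "b1 * m1 (V i x) = 0" using i(1) unfolding I_def by auto
      moreover have "w (V i x) = 0" using i(1) True unfolding I_def by (auto simp: V_simps vec)
      ultimately show ?thesis using True b_nz by (simp add: at_inf_def)
    next
      case False
      define s where "s = s3 + (sin x)\<^sup>2 / (cos x)\<^sup>2"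
      note ls = level_shift[OF s_def False]
      let ?c = "cos x"
      have "m2 (V 0 x) * m3 (V 0 x) * ?c\<^sup>2 = D1 x * (w (V 0 x))\<^sup>2"
        using arg_cong[OF prod[of x], of "\<lambda>t. t * (D2 x * D3 x * ?c * ?c)"]
        unfolding V_simps vec by (simp only: power2_eq_square ac_simps)
      moreover have "m2 (V (Suc 0) x) * m3 (V (Suc 0) x) * ?c\<^sup>2 = D1 x * (w (V (Suc 0) x))\<^sup>2"
        unfolding V_simps vec by (simp only: power2_eq_square ac_simps)
      moreover have "m2 (V 2 x) * m3 (V 2 x) * ?c\<^sup>2 = D1 x * (w (V 2 x))\<^sup>2"
        unfolding V_simps vec by (simp only: power2_eq_square ac_simps)
      ultimately have "m2 (V i x) * m3 (V i x) * ?c\<^sup>2 = D1 x * (w (V i x))\<^sup>2"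
        using i(1) unfolding I_def by auto
      then have "m2 (V i x) * m3 (V i x) = (u1 + b1 * s) * (w (V i x))\<^sup>2"
        unfolding ls(1) using False by simp
      moreover have "D2 x * m2 (V i x) + D3 x * m3 (V i x) = P x * w (V i x)"
      proof -
        have "D2 x * m2 (V 0 x) + D3 x * m3 (V 0 x) = P x * w (V 0 x)"
          using arg_cong[OF sum[of x], of "\<lambda>t. t * (D2 x * D3 x)"]
          unfolding V_simps vec by (simp add: algebra_simps)
        moreover have "D2 x * m2 (V (Suc 0) x) + D3 x * m3 (V (Suc 0) x) = P x * w (V (Suc 0) x)"
          using arg_cong[OF sum[of x], of "\<lambda>t. t * (D2 x * q x)"] prod[of x]
          unfolding V_simps vec by (simp add: algebra_simps power2_eq_square)
        moreover have "D2 x * m2 (V 2 x) + D3 x * m3 (V 2 x) = P x * w (V 2 x)"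
          using arg_cong[OF sum[of x], of "\<lambda>t. t * (p x * D3 x)"] prod[of x]
          unfolding V_simps vec by (simp add: algebra_simps power2_eq_square)
        ultimately show ?thesis using i(1) unfolding I_def by auto
      qed
      then have "?c\<^sup>2 * ((u2 + b2 * s) * m2 (V i x) + (u3 + b3 * s) * m3 (V i x)) = ?c\<^sup>2 * ((r + \<beta> * s) * w (V i x))"
        unfolding ls by (simp add: algebra_simps)
      then have "(u2 + b2 * s) * m2 (V i x) + (u3 + b3 * s) * m3 (V i x) = (r + \<beta> * s) * w (V i x)"
        using False by simp
      ultimately have "at_level s (V i x)" unfolding at_level_def by simp
      moreover have "s \<ge> s3" by (simp add: s_def)
      ultimately show ?thesis using False by auto
    qed
    then show ?thesis using i \<gamma>[OF i] by blast
  qed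
  have surj\<gamma>: "\<exists>x\<in>{- pi/2..pi/2}. \<gamma> x = proj_pt z"
    if z: "z \<noteq> 0" "at_inf z \<or> (\<exists>s\<ge>s3. at_level s z)" for z
  proof (cases "at_inf z")
    case True
    obtain v where v: "v \<noteq> 0" "\<gamma> (pi/2) = proj_pt v" "at_inf v" using on_curve[of "pi/2"] by auto
    have e: "b2 * m2 z = - (b3 * m3 z)" "b2 * m2 v = - (b3 * m3 v)" "w z = 0" "w v = 0"
      using rel[of z] rel[of v] True v(3) unfolding at_inf_def by auto
    have "b2 * (m2 v * m3 z) = b2 * (m3 v * m2 z)"
      using arg_cong[OF e(1), of "\<lambda>t. m3 v * t"] arg_cong[OF e(2), of "\<lambda>t. m3 z * t"]
      by (simp add: ac_simps)
    then have "proj_pt v = proj_pt z"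
      by (intro proj_pt_eq_coords) (use v z e b_nz in auto)
    then show ?thesis using v by (intro bexI[of _ "pi/2"]) auto
  next
    case False
    then obtain s where s: "s \<ge> s3" "at_level s z" using z by blast
    let ?U1 = "u1 + b1 * s" and ?U2 = "u2 + b2 * s" and ?U3 = "u3 + b3 * s" and ?S = "r + \<beta> * s"
    have g: "m2 z * m3 z = ?U1 * (w z)\<^sup>2" and h: "?U2 * m2 z + ?U3 * m3 z = ?S * w z"
      using s unfolding at_level_def by auto
    have "\<exists>p0 q0. p0 + q0 = ?S \<and> p0 * q0 = ?U1 * ?U2 * ?U3 \<and> ?U2 * m2 z = q0 * w z \<and> ?U3 * m3 z = p0 * w z
        \<and> p0 * m2 z = ?U1 * ?U3 * w z \<and> q0 * m3 z = ?U1 * ?U2 * w z"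
    proof (cases "w z = 0")
      case True
      then have "m2 z = 0 \<and> m3 z \<noteq> 0 \<and> ?U3 = 0 \<or> m3 z = 0 \<and> m2 z \<noteq> 0 \<and> ?U2 = 0"
        using g h coords_zero[of z] z(1) by auto
      then show ?thesis
      proof
        assume a: "m2 z = 0 \<and> m3 z \<noteq> 0 \<and> ?U3 = 0"
        show ?thesis by (rule exI[of _ ?S], rule exI[of _ 0]) (use a True in simp)
      next
        assume a: "m3 z = 0 \<and> m2 z \<noteq> 0 \<and> ?U2 = 0"
        show ?thesis by (rule exI[of _ 0], rule exI[of _ ?S]) (use a True in simp)
      qed
    next
      case wz: False
      define p0 q0 where "p0 = ?U3 * m3 z / w z" and "q0 = ?U2 * m2 z / w z"
      have "?U3 * m3 z = p0 * w z" "?U2 * m2 z = q0 * w z" using wz by (simp_all add: p0_def q0_def)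
      moreover have "p0 + q0 = ?S" using h wz unfolding p0_def q0_def
        by (simp add: add_divide_distrib[symmetric] add.commute)
      moreover have "p0 * q0 = ?U2 * ?U3 * (m2 z * m3 z) / (w z)\<^sup>2"
        by (simp add: p0_def q0_def power2_eq_square)
      moreover have "p0 * m2 z = ?U3 * (m2 z * m3 z) / w z" "q0 * m3 z = ?U2 * (m2 z * m3 z) / w z"
        by (simp_all add: p0_def q0_def)
      ultimately show ?thesis
        unfolding g using wz by (intro exI[of _ p0] exI[of _ q0]) (simp add: power2_eq_square)
    qed
    then obtain p0 q0 where pq: "p0 + q0 = ?S" "p0 * q0 = ?U1 * ?U2 * ?U3" "?U2 * m2 z = q0 * w z"
      "?U3 * m3 z = p0 * w z" "p0 * m2 z = ?U1 * ?U3 * w z" "q0 * m3 z = ?U1 * ?U2 * w z" by blast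
    have Fq: "F s = (q0 - p0)\<^sup>2"
    proof -
      have "F s = ?S\<^sup>2 - 4 * (?U1 * ?U2 * ?U3)" unfolding F_def by simp
      also have "\<dots> = (q0 - p0)\<^sup>2" unfolding pq(1,2)[symmetric] by (simp add: algebra_simps power2_eq_square)
      finally show ?thesis .
    qed
    \<comment> \<open>The tangent of the wanted parameter; its sign selects which of the two points
      over the level is \<open>z\<close>.\<close>
    define t where "t = (if q0 - p0 \<ge> 0 then sqrt (s - s3) else - sqrt (s - s3))"
    have t2: "t\<^sup>2 = s - s3" unfolding t_def using s(1) by simp
    define x where "x = arctan t"
    have x: "x \<in> {- pi/2..pi/2}" "cos x > 0" "sin x = t * cos x"
    proof -
      have b: "- (pi/2) < x" "x < pi/2" unfolding x_def using arctan_bounded by auto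
      then show "x \<in> {- pi/2..pi/2}" by auto
      show c: "cos x > 0" using b by (rule cos_gt_zero_pi)
      have "tan x = t" unfolding x_def by (rule tan_arctan)
      then show "sin x = t * cos x" using c by (simp add: tan_def field_simps)
    qed
    have sx: "s = s3 + (sin x)\<^sup>2 / (cos x)\<^sup>2" using t2 x by (simp add: power_mult_distrib)
    note ls = level_shift[OF sx less_imp_neq[OF x(2), symmetric]]
    have Qx: "Q x = (cos x)^4 * (k2 * (s - s3)\<^sup>2 + k1 * (s - s3) + k0)"
      unfolding Q_def x(3) power_mult_distrib t2 by (simp add: eval_nat_numeral algebra_simps)
    have "y x = (cos x)^3 * (q0 - p0)"
    proof (rule eq_if_power2_eq_same_sign)
      show "(y x)\<^sup>2 = ((cos x)^3 * (q0 - p0))\<^sup>2"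
      proof -
        have "(y x)\<^sup>2 = (sin x)\<^sup>2 * Q x" unfolding y_def using Qpos[of x] by (simp add: power_mult_distrib)
        also have "\<dots> = ((cos x)^3)\<^sup>2 * ((s - s3) * (k2 * (s - s3)\<^sup>2 + k1 * (s - s3) + k0))"
          unfolding Qx x(3) power_mult_distrib t2 by (simp add: eval_nat_numeral ac_simps)
        also have "\<dots> = ((cos x)^3)\<^sup>2 * (q0 - p0)\<^sup>2" using Fs[of s] Fq by simp
        finally show ?thesis by (simp add: power_mult_distrib)
      qed
      show "y x * ((cos x)^3 * (q0 - p0)) \<ge> 0"
      proof -
        have "sin x * (q0 - p0) \<ge> 0" unfolding x(3) t_def using x(2) s(1)
          by (auto simp: zero_le_mult_iff mult_nonpos_nonpos)
        moreover have "sqrt (Q x) * (cos x)^3 \<ge> 0" using Qpos[of x] x(2) by simp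
        ultimately have "sqrt (Q x) * (cos x)^3 * (sin x * (q0 - p0)) \<ge> 0"
          by (rule mult_nonneg_nonneg[rotated])
        then show ?thesis unfolding y_def by (simp add: ac_simps)
      qed
    qed
    then have pqx: "p x = (cos x)^3 * p0" "q x = (cos x)^3 * q0"
      unfolding p_def q_def ls(4) pq(1)[symmetric] by (simp_all add: field_simps power2_eq_square power3_eq_cube)
    obtain i where i: "i \<in> I" "V i x \<noteq> 0" using Vex by blast
    let ?c = "cos x"
    have "P * m3 z = Q * m2 z \<and> P * w z = T * m2 z \<and> Q * w z = T * m3 z"
      if "P = q0 * ?U3 \<and> Q = p0 * ?U2 \<and> T = ?U2 * ?U3 \<or>
        P = q0\<^sup>2 \<and> Q = ?U1 * ?U2\<^sup>2 \<and> T = ?U2 * q0 \<or>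
        P = ?U1 * ?U3\<^sup>2 \<and> Q = p0\<^sup>2 \<and> T = p0 * ?U3"
      for P Q T
      using that
    proof (elim disjE conjE; hypsubst; intro conjI)
      show "q0 * ?U3 * m3 z = p0 * ?U2 * m2 z"
        using arg_cong[OF pq(4), of "\<lambda>t. t * (q0)"] arg_cong[OF pq(3), of "\<lambda>t. t * (p0)"]
        by (simp only: power2_eq_square ac_simps)
      show "q0 * ?U3 * w z = ?U2 * ?U3 * m2 z"
        using arg_cong[OF pq(3), of "\<lambda>t. t * (?U3)"]
        by (simp only: power2_eq_square ac_simps)
      show "p0 * ?U2 * w z = ?U2 * ?U3 * m3 z"
        using arg_cong[OF pq(4), of "\<lambda>t. t * (?U2)"]
        by (simp only: power2_eq_square ac_simps)
      show "q0\<^sup>2 * m3 z = ?U1 * ?U2\<^sup>2 * m2 z"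
        using arg_cong[OF pq(6), of "\<lambda>t. t * (q0)"] arg_cong[OF pq(3), of "\<lambda>t. t * (?U1 * ?U2)"]
        by (simp only: power2_eq_square ac_simps)
      show "q0\<^sup>2 * w z = ?U2 * q0 * m2 z"
        using arg_cong[OF pq(3), of "\<lambda>t. t * (q0)"]
        by (simp only: power2_eq_square ac_simps)
      show "?U1 * ?U2\<^sup>2 * w z = ?U2 * q0 * m3 z"
        using arg_cong[OF pq(6), of "\<lambda>t. t * (?U2)"]
        by (simp only: power2_eq_square ac_simps)
      show "?U1 * ?U3\<^sup>2 * m3 z = p0\<^sup>2 * m2 z"
        using arg_cong[OF pq(5), of "\<lambda>t. t * (p0)"] arg_cong[OF pq(4), of "\<lambda>t. t * (?U1 * ?U3)"]
        by (simp only: power2_eq_square ac_simps)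
      show "?U1 * ?U3\<^sup>2 * w z = p0 * ?U3 * m2 z"
        using arg_cong[OF pq(5), of "\<lambda>t. t * (?U3)"]
        by (simp only: power2_eq_square ac_simps)
      show "p0\<^sup>2 * w z = p0 * ?U3 * m3 z"
        using arg_cong[OF pq(4), of "\<lambda>t. t * (p0)"]
        by (simp only: power2_eq_square ac_simps)
    qed
    note par = this
    have "\<exists>k P Q T. m2 (V i x) = k * P \<and> m3 (V i x) = k * Q \<and> w (V i x) = k * T \<and>
      (P = q0 * ?U3 \<and> Q = p0 * ?U2 \<and> T = ?U2 * ?U3 \<or>
        P = q0\<^sup>2 \<and> Q = ?U1 * ?U2\<^sup>2 \<and> T = ?U2 * q0 \<or>
        P = ?U1 * ?U3\<^sup>2 \<and> Q = p0\<^sup>2 \<and> T = p0 * ?U3)"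
    proof -
      consider "i = 0" | "i = Suc 0" | "i = 2" using i(1) unfolding I_def by auto
      then show ?thesis
      proof cases
        case 1
        show ?thesis
          by (rule exI[of _ "?c^5"], rule exI[of _ "q0 * ?U3"], rule exI[of _ "p0 * ?U2"], rule exI[of _ "?U2 * ?U3"])
             (unfold 1 V_simps vec pqx ls(1-3), simp add: eval_nat_numeral ac_simps)
      next
        case 2
        show ?thesis
          by (rule exI[of _ "?c^6"], rule exI[of _ "q0\<^sup>2"], rule exI[of _ "?U1 * ?U2\<^sup>2"], rule exI[of _ "?U2 * q0"])
             (unfold 2 V_simps vec pqx ls(1-3), simp add: eval_nat_numeral ac_simps)
      next
        case 3
        show ?thesis
          by (rule exI[of _ "?c^6"], rule exI[of _ "?U1 * ?U3\<^sup>2"], rule exI[of _ "p0\<^sup>2"], rule exI[of _ "p0 * ?U3"])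
             (unfold 3 V_simps vec pqx ls(1-3), simp add: eval_nat_numeral ac_simps)
      qed
    qed
    then obtain k P' Q' T where k: "m2 (V i x) = k * P'" "m3 (V i x) = k * Q'" "w (V i x) = k * T"
      and "P' * m3 z = Q' * m2 z \<and> P' * w z = T * m2 z \<and> Q' * w z = T * m3 z"
      using par by blast
    then have "proj_pt (V i x) = proj_pt z"
      by (intro proj_pt_eq_coords[OF i(2) z(1)]; simp only: k mult.assoc)
    then show ?thesis using x(1) \<gamma>[OF i] by auto
  qed
  define a where "a x = D2 x * D3 x" for x
  \<comment> \<open>\<open>2 * b1 * m1 (V 0 x)\<close> divided by cos^2 x. The double zero at the
    ends reflects that m1 = 0 is the tangent at m1 = w = 0.\<close>
  define N where "N x = cos x * ((sin x)\<^sup>2 * (\<beta> * (b2 * ?V3 + b3 * ?V2) - 2 * ?R * b2 * b3)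
      + (cos x)\<^sup>2 * (2 * \<beta> * ?V2 * ?V3 - ?R * (b2 * ?V3 + b3 * ?V2)))
      - y x * (b2 * ?V3 - b3 * ?V2)" for x
  define m where "m x = N x / (2 * b1)" for x
  have m1V: "m1 (V 0 x) = cos x * (cos x * m x)" for x
  proof -
    have "2 * (b1 * m1 (V 0 x)) = 2 * (\<beta> * (cos x * D2 x * D3 x)) - b2 * (2 * q x) * D3 x - b3 * (2 * p x) * D2 x"
      unfolding m1 V_simps vec by simp
    also have "\<dots> = cos x * (cos x * N x)"
    proof -
      have pq2: "2 * q x = cos x * P x + y x" "2 * p x = cos x * P x - y x" by (simp_all add: p_def q_def)
      show ?thesis unfolding pq2 D2_def D3_def P_def N_def
        by (simp add: algebra_simps power2_eq_square)
    qed
    also have "\<dots> = 2 * (b1 * (cos x * (cos x * m x)))"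
      unfolding m_def using b_nz by simp
    finally show ?thesis using b_nz by simp
  qed
  have pi2: "sin (- pi/2) = -1" "cos (- pi/2) = 0" using sin_minus[of "pi/2"] cos_minus[of "pi/2"] by simp_all
  have y_end: "y (- pi/2) = - y (pi/2)" "y (pi/2) \<noteq> 0"
    using Qpos[of "pi/2"] unfolding y_def Q_def pi2 by simp_all
  have Vend: "V 0 (- pi/2) = - V 0 (pi/2)"
    unfolding V_simps vec_def p_def q_def D2_def D3_def pi2 y_end(1) by simp
  have Vnz: "V 0 (pi/2) \<noteq> 0"
    unfolding V_simps vec0 q_def D3_def using y_end(2) b_nz by simp
  have contA: "continuous_on UNIV a" unfolding a_def by (intro continuous_intros contD)
  have contM: "continuous_on UNIV m" unfolding m_def N_def
    using b_nz by (intro continuous_intros contD) auto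
  have wV: "w (V 0 x) = cos x * a x" for x unfolding V_simps vec a_def by simp
  have a_end: "a (pi/2) = b2 * b3" "a (- pi/2) = b2 * b3" unfolding a_def D2_def D3_def pi2 by simp_all
  have \<gamma>0: "\<gamma> x = proj_pt (V 0 x)" if "V 0 x \<noteq> 0" for x using \<gamma>[of 0 x] that by (simp add: I_def)
  show thesis
    by (rule that[of \<gamma> "V 0" a m])
       (assumption | rule cont\<gamma> on_curve surj\<gamma> contV contA contM \<gamma>0 Vend Vnz wV m1V a_end)+
qed

section \<open>Real roots of the discriminant\<close>

lemma leading_coeff_pos: "- 4 * (b1 * b2 * b3) > 0"
  using neg by simp

text \<open>The two sides in \<open>nondeg\<close> differ by half the derivative of
  \<open>F\<close>.\<close>

lemma F_double_root:
  assumes "\<And>s. F s = (s - a)\<^sup>2 * (k * s + c)"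
  shows False
proof -
  have "((\<lambda>s. (s - a)\<^sup>2 * (k * s + c)) has_real_derivative 0) (at a)"
    by (auto intro!: derivative_eq_intros)
  then have "(F has_real_derivative 0) (at a)" using assms by presburger
  moreover have "(F has_real_derivative 2 * (\<beta> * (r + \<beta> * a) - 2 * (b1 * (u2 + b2 * a) * (u3 + b3 * a)
        + b2 * (u1 + b1 * a) * (u3 + b3 * a) + b3 * (u1 + b1 * a) * (u2 + b2 * a)))) (at a)"
    unfolding F_def[abs_def]
    by (auto intro!: derivative_eq_intros simp: algebra_simps)
  ultimately have "\<beta> * (r + \<beta> * a) = 2 * (b1 * (u2 + b2 * a) * (u3 + b3 * a)
        + b2 * (u1 + b1 * a) * (u3 + b3 * a) + b3 * (u1 + b1 * a) * (u2 + b2 * a))"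
    using DERIV_unique by force
  moreover have "F a = 0" using assms[of a] by simp
  ultimately show False using nondeg[of a] unfolding F_def by simp
qed

lemma F_root_cases:
  defines "k2 \<equiv> - 4 * (b1 * b2 * b3)"
  obtains (one) s3 k1 k0 where "\<And>s. F s = (s - s3) * (k2 * (s - s3)\<^sup>2 + k1 * (s - s3) + k0)"
      "k1\<^sup>2 < 4 * k2 * k0"
  | (three) x1 x2 x3 where "x1 < x2" "x2 < x3" "\<And>s. F s = k2 * (s - x1) * (s - x2) * (s - x3)"
proof -
  have k2: "k2 > 0" unfolding k2_def by (rule leading_coeff_pos)
  define f2 f1 f0 where "f2 = \<beta>\<^sup>2 - 4 * (u1 * b2 * b3 + b1 * u2 * b3 + b1 * b2 * u3)"
    and "f1 = 2 * r * \<beta> - 4 * (b1 * u2 * u3 + u1 * b2 * u3 + u1 * u2 * b3)"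
    and "f0 = r\<^sup>2 - 4 * u1 * u2 * u3"
  have Fp: "F s = k2 * s^3 + f2 * s\<^sup>2 + f1 * s + f0" for s
    unfolding F_def k2_def f2_def f1_def f0_def by (simp add: algebra_simps eval_nat_numeral)
  \<comment> \<open>\<open>M\<close> is the Cauchy bound for the roots of \<open>F\<close>, which
    gives opposite signs at \<open>- M\<close> and \<open>M\<close>.\<close>
  define S M where "S = \<bar>f2\<bar> + \<bar>f1\<bar> + \<bar>f0\<bar>" and "M = 1 + S / k2"
  have "S \<ge> 0" "k2 * M = k2 + S" using k2 by (simp add: S_def, simp add: M_def distrib_left)
  then have M: "M \<ge> 1" "k2 * M > \<bar>f2\<bar> + \<bar>f1\<bar> + \<bar>f0\<bar>" using k2 by (simp_all add: S_def M_def)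
  have M2: "M\<^sup>2 \<ge> M" "M\<^sup>2 \<ge> 1" using M(1) by (auto simp: power2_eq_square mult_le_cancel_left1 intro: order_trans)
  have "\<bar>f2\<bar> * M\<^sup>2 + \<bar>f1\<bar> * M + \<bar>f0\<bar> \<le> (\<bar>f2\<bar> + \<bar>f1\<bar> + \<bar>f0\<bar>) * M\<^sup>2"
  proof -
    have "\<bar>f1\<bar> * M \<le> \<bar>f1\<bar> * M\<^sup>2" "\<bar>f0\<bar> * 1 \<le> \<bar>f0\<bar> * M\<^sup>2" 
      using mult_left_mono[OF M2(1), of "\<bar>f1\<bar>"] mult_left_mono[OF M2(2), of "\<bar>f0\<bar>"] by simp_all
    then show ?thesis by (simp add: algebra_simps)
  qed
  also have "\<dots> < k2 * M * M\<^sup>2" using M(2) M2 by (intro mult_strict_right_mono) auto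
  finally have big: "\<bar>f2\<bar> * M\<^sup>2 + \<bar>f1\<bar> * M + \<bar>f0\<bar> < k2 * M^3" by (simp add: eval_nat_numeral ac_simps)
  have "\<bar>f2 * M\<^sup>2\<bar> = \<bar>f2\<bar> * M\<^sup>2" "\<bar>f1 * M\<bar> = \<bar>f1\<bar> * M" using M(1) by (simp_all add: abs_mult)
  moreover have "F (- M) = - (k2 * M^3) + f2 * M\<^sup>2 - f1 * M + f0" unfolding Fp by simp
  ultimately have "F (- M) \<le> 0" "F M \<ge> 0" using big unfolding Fp[of M] by linarith+
  moreover have "continuous_on {- M..M} F" unfolding Fp[abs_def] by (intro continuous_intros)
  moreover have "- M \<le> M" using M(1) by simp
  ultimately obtain s3 where s3: "F s3 = 0" using IVT'[of F "- M" 0 M] by blast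
  define k1 k0 where "k1 = 3 * k2 * s3 + f2" and "k0 = 3 * k2 * s3\<^sup>2 + 2 * f2 * s3 + f1"
  have Fs: "F s = (s - s3) * (k2 * (s - s3)\<^sup>2 + k1 * (s - s3) + k0)" for s
  proof -
    have "F s = F s - F s3" using s3 by simp
    also have "\<dots> = (s - s3) * (k2 * (s - s3)\<^sup>2 + k1 * (s - s3) + k0)"
      unfolding Fp k1_def k0_def by (simp add: algebra_simps eval_nat_numeral)
    finally show ?thesis .
  qed
  define D where "D = k1\<^sup>2 - 4 * k2 * k0"
  show thesis
  proof (cases "D < 0")
    case True
    then show ?thesis by (intro one[OF Fs]) (simp add: D_def)
  next
    case False
    define a b where "a = s3 + (- k1 - sqrt D) / (2 * k2)" and "b = s3 + (- k1 + sqrt D) / (2 * k2)"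
    have ab: "a + b = 2 * s3 - k1 / k2" unfolding a_def b_def using k2 by (simp add: field_simps)
    have "(a - s3) * (b - s3) = k0 / k2"
    proof -
      have "(a - s3) * (b - s3) = (k1\<^sup>2 - (sqrt D)\<^sup>2) / (4 * k2\<^sup>2)"
        unfolding a_def b_def using k2 by (simp add: field_simps power2_eq_square)
      also have "\<dots> = k0 / k2" using False k2 by (simp add: D_def field_simps power2_eq_square)
      finally show ?thesis .
    qed
    then have q: "k2 * (s - s3)\<^sup>2 + k1 * (s - s3) + k0 = k2 * ((s - a) * (s - b))" for s
    proof -
      assume p: "(a - s3) * (b - s3) = k0 / k2"
      have "(s - a) * (s - b) = (s - s3)\<^sup>2 - (a + b - 2 * s3) * (s - s3) + (a - s3) * (b - s3)"
        by (simp add: algebra_simps power2_eq_square)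
      then show ?thesis unfolding p ab using k2 by (simp add: field_simps)
    qed
    have F3: "F s = k2 * (s - s3) * (s - a) * (s - b)" for s unfolding Fs q by simp
    have ne: "s3 \<noteq> a" "s3 \<noteq> b" "a \<noteq> b"
    proof -
      show "s3 \<noteq> a"
      proof
        assume "s3 = a"
        then have "F s = (s - a)\<^sup>2 * (k2 * s + (- (k2 * b)))" for s
          unfolding F3 by (simp add: algebra_simps power2_eq_square)
        then show False by (rule F_double_root)
      qed
      show "s3 \<noteq> b"
      proof
        assume "s3 = b"
        then have "F s = (s - b)\<^sup>2 * (k2 * s + (- (k2 * a)))" for s
          unfolding F3 by (simp add: algebra_simps power2_eq_square)
        then show False by (rule F_double_root)
      qed
      show "a \<noteq> b"
      proof
        assume "a = b"
        then have "F s = (s - b)\<^sup>2 * (k2 * s + (- (k2 * s3)))" for s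
          unfolding F3 by (simp add: algebra_simps power2_eq_square)
        then show False by (rule F_double_root)
      qed
    qed
    have "a \<le> b" unfolding a_def b_def using k2 False by (simp add: divide_right_mono)
    then have "a < b" using ne by simp
    then consider "s3 < a" | "a < s3" "s3 < b" | "b < s3" using ne by linarith
    then show ?thesis
    proof cases
      case 1
      show ?thesis by (rule three[OF 1 \<open>a < b\<close>]) (rule F3)
    next
      case 2
      show ?thesis by (rule three[OF 2]) (simp add: F3)
    next
      case 3
      show ?thesis by (rule three[OF \<open>a < b\<close> 3]) (simp add: F3)
    qed
  qed
qed

section \<open>Connectedness and contractibility of the ovals\<close>

lemma curve_subset: "curve \<subseteq> rp2_points"
  unfolding curve_def rp2_points_def by auto

lemma proj_pt_curve_iff: "z \<noteq> 0 \<Longrightarrow> proj_pt z \<in> curve \<longleftrightarrow> Phi z = 0"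
  unfolding curve_def by (auto simp: proj_pt_eq_scaleR Phi_scale)

text \<open>With a single root all levels satisfy \<open>s \<ge> s3\<close>, so the closed path runs
  through the whole curve.\<close>

lemma connectedin_curve_one_root:
  assumes Fs: "\<And>s. F s = (s - s3) * (k2 * (s - s3)\<^sup>2 + k1 * (s - s3) + k0)"
    and k2: "k2 = - 4 * (b1 * b2 * b3)" and D: "k1\<^sup>2 < 4 * k2 * k0"
  shows "connectedin rp2 curve"
proof -
  have k2': "k2 > 0" unfolding k2 by (rule leading_coeff_pos)
  have K: "k2 * v\<^sup>2 + k1 * v + k0 > 0" for v by (rule quadratic_pos[OF k2' D])
  have K': "v \<ge> 0 \<Longrightarrow> k2 * v\<^sup>2 + k1 * v + k0 > 0" for v using K by simp
  show ?thesis
  proof (rule closed_path[OF Fs k2 K'], assumption)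
    fix \<gamma> :: "real \<Rightarrow> (real^3) set"
    assume c: "continuous_map (top_of_set {- pi/2..pi/2}) rp2 \<gamma>"
      and i: "\<And>\<theta>. \<theta> \<in> {- pi/2..pi/2} \<Longrightarrow> \<exists>z. z \<noteq> 0 \<and> \<gamma> \<theta> = proj_pt z \<and>
        (if cos \<theta> = 0 then at_inf z else \<exists>s\<ge>s3. at_level s z)"
      and s: "\<And>z. z \<noteq> 0 \<Longrightarrow> at_inf z \<or> (\<exists>s\<ge>s3. at_level s z) \<Longrightarrow> \<exists>\<theta>\<in>{- pi/2..pi/2}. \<gamma> \<theta> = proj_pt z"
    have "\<gamma> ` {- pi/2..pi/2} = curve"
    proof (intro subset_antisym subsetI)
      fix x assume "x \<in> \<gamma> ` {- pi/2..pi/2}"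
      then obtain t where t: "t \<in> {- pi/2..pi/2}" "x = \<gamma> t" by blast
      obtain z where z: "z \<noteq> 0" "\<gamma> t = proj_pt z"
        and "if cos t = 0 then at_inf z else \<exists>s\<ge>s3. at_level s z" using i[OF t(1)] by blast
      then have "at_inf z \<or> (\<exists>s. at_level s z)" by (auto split: if_splits)
      then have "Phi z = 0" using at_level_Phi at_inf_Phi by blast
      then show "x \<in> curve" using t z by (simp add: proj_pt_curve_iff)
    next
      fix x assume "x \<in> curve"
      then obtain z where z: "z \<noteq> 0" "x = proj_pt z" "Phi z = 0" unfolding curve_def by auto
      have "at_inf z \<or> (\<exists>s\<ge>s3. at_level s z)"
      proof (cases "at_inf z")
        case False
        then obtain s where "at_level s z" using level_exists z by blast
        moreover have "F s \<ge> 0" using at_level_F_nonneg[OF \<open>at_level s z\<close> z(1)] .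
        then have "s \<ge> s3" unfolding Fs using K[of "s - s3"] by (simp add: zero_le_mult_iff)
        ultimately show ?thesis by blast
      qed simp
      then show "x \<in> \<gamma> ` {- pi/2..pi/2}" using s[OF z(1)] z(2) by (metis imageI)
    qed
    moreover have "connectedin rp2 (\<gamma> ` {- pi/2..pi/2})"
      by (rule connectedin_continuous_map_image[OF c]) (simp add: connectedin_subtopology)
    ultimately show ?thesis by simp
  qed
qed

text \<open>\<open>V\<close> ends at the negative of its start, whereas a null-homotopic loop has a
  lift \<open>W\<close> with equal ends. Both represent the same points wherever \<open>V\<close> is
  nonzero. The linear form \<open>m1 - \<mu> * w\<close> has no zero on \<open>W\<close> strictly
  between the ends, but the comparison with \<open>V\<close> gives it opposite signs near the two
  ends.\<close>

lemma not_contractible: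
  assumes Fs: "\<And>s. F s = (s - s3) * (k2 * (s - s3)\<^sup>2 + k1 * (s - s3) + k0)"
    and k2: "k2 = - 4 * (b1 * b2 * b3)"
    and K: "\<And>v. v \<ge> 0 \<Longrightarrow> k2 * v\<^sup>2 + k1 * v + k0 > 0"
    and N: "\<And>z. z \<noteq> 0 \<Longrightarrow> at_inf z \<or> (\<exists>s\<ge>s3. at_level s z) \<Longrightarrow> proj_pt z \<in> N"
    and \<mu>: "\<mu> \<noteq> 0" "\<And>z. Phi z = 0 \<Longrightarrow> m1 z = \<mu> * w z \<Longrightarrow> at_inf z"
  shows "\<not> contractible_in_rp2 N"
proof
  assume contr: "contractible_in_rp2 N"
  let ?I = "{- pi/2..pi/2}"
  show False
  proof (rule closed_path[OF Fs k2 K], assumption)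
    fix \<gamma> :: "real \<Rightarrow> (real^3) set" and V :: "real \<Rightarrow> real^3" and a m :: "real \<Rightarrow> real"
    assume c: "continuous_map (top_of_set ?I) rp2 \<gamma>"
      and i: "\<And>\<theta>. \<theta> \<in> ?I \<Longrightarrow> \<exists>z. z \<noteq> 0 \<and> \<gamma> \<theta> = proj_pt z \<and>
        (if cos \<theta> = 0 then at_inf z else \<exists>s\<ge>s3. at_level s z)"
      and "\<And>z. z \<noteq> 0 \<Longrightarrow> at_inf z \<or> (\<exists>s\<ge>s3. at_level s z) \<Longrightarrow> \<exists>\<theta>\<in>?I. \<gamma> \<theta> = proj_pt z"
      and cV: "continuous_on UNIV V" "continuous_on UNIV a" "continuous_on UNIV m"
      and \<gamma>V: "\<And>\<theta>. V \<theta> \<noteq> 0 \<Longrightarrow> \<gamma> \<theta> = proj_pt (V \<theta>)"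
      and Vend: "V (- pi/2) = - V (pi/2)" "V (pi/2) \<noteq> 0"
      and wV: "\<And>\<theta>. w (V \<theta>) = cos \<theta> * a \<theta>" and mV: "\<And>\<theta>. m1 (V \<theta>) = cos \<theta> * (cos \<theta> * m \<theta>)"
      and aend: "a (pi/2) = b2 * b3" "a (- pi/2) = b2 * b3"
    have "\<gamma> \<theta> \<in> N" if \<theta>: "\<theta> \<in> ?I" for \<theta>
    proof -
      obtain z where z: "z \<noteq> 0" "\<gamma> \<theta> = proj_pt z"
        and "if cos \<theta> = 0 then at_inf z else \<exists>s\<ge>s3. at_level s z" using i[OF \<theta>] by blast
      then have "at_inf z \<or> (\<exists>s\<ge>s3. at_level s z)" by (auto split: if_splits)
      then show ?thesis using N[OF z(1)] z(2) by simp
    qed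
    then have c': "continuous_map (top_of_set ?I) (subtopology rp2 N) \<gamma>"
      using c by (auto simp: continuous_map_in_subtopology)
    have "proj_pt (- V (pi/2)) = proj_pt (V (pi/2))" using proj_pt_scale[of "-1" "V (pi/2)"] by simp
    then have ends: "\<gamma> (- pi/2) = \<gamma> (pi/2)" using \<gamma>V[of "pi/2"] \<gamma>V[of "- pi/2"] Vend by simp
    obtain W where W: "continuous_on ?I W" "\<And>x. x \<in> ?I \<Longrightarrow> W x \<noteq> 0 \<and> \<gamma> x = proj_pt (W x)" "W (- pi/2) = W (pi/2)"
      using contractible_in_rp2_lift[OF contr c' _ ends] by auto
    define l where "l z = m1 z - \<mu> * w z" for z
    define L where "L x = cos x * m x - \<mu> * a x" for x
    \<comment> \<open>\<open>J\<close> extends \<open>l (W x) * (V x \<bullet> V x) / cos x\<close>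
      to the ends, where its values are opposite and nonzero. Inner products replace the ratio of
      \<open>W\<close> and \<open>V\<close>, because \<open>V\<close> may vanish in between.\<close>
    define J where "J x = L x * (W x \<bullet> V x)" for x
    have lV: "l (V x) = cos x * L x" for x unfolding l_def L_def wV mV by (simp add: algebra_simps)
    have l_scale: "l (c *\<^sub>R z) = c * l z" for c z unfolding l_def scale by (simp add: algebra_simps)
    have key: "l (W x) * (V x \<bullet> V x) = cos x * J x" if x: "x \<in> ?I" for x
    proof (cases "V x = 0")
      case True
      then show ?thesis by (simp add: J_def)
    next
      case False
      then have "proj_pt (W x) = proj_pt (V x)" using \<gamma>V W(2)[OF x] by simp
      then obtain k where k: "V x = k *\<^sub>R W x" by (auto simp: proj_pt_eq_scaleR)
      have "l (W x) * (V x \<bullet> V x) = l (V x) * (W x \<bullet> V x)"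
        unfolding k l_scale by simp
      then show ?thesis unfolding lV J_def by simp
    qed
    have lnz: "l (W x) \<noteq> 0" if x: "x \<in> {- pi/2<..<pi/2}" for x
    proof
      assume l0: "l (W x) = 0"
      have xI: "x \<in> ?I" and cx: "cos x \<noteq> 0" using x cos_gt_zero_pi[of x] by auto
      obtain z s where z: "z \<noteq> 0" "\<gamma> x = proj_pt z" "at_level s z" using i[OF xI] cx by auto
      obtain k where k: "z = k *\<^sub>R W x" "k \<noteq> 0" using z W(2)[OF xI] by (auto simp: proj_pt_eq_scaleR)
      have "Phi z = 0" "m1 z = \<mu> * w z"
        using at_level_Phi[OF z(3)] l0 unfolding k(1) scale l_def by auto
      then show False using \<mu>(2) at_level_not_inf z by blast
    qed
    have cont_l: "continuous_on ?I (\<lambda>x. l (W x))"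
      unfolding l_def using W(1) lin(1,4)
      by (intro continuous_intros) (auto intro: linear_continuous_on_compose)
    have cont_J: "continuous_on ?I J" unfolding J_def L_def
      by (intro continuous_intros W(1) cV[THEN continuous_on_subset]) auto
    define v where "v = V (pi/2)"
    have "proj_pt v = proj_pt (W (pi/2))" using \<gamma>V[of "pi/2"] Vend W(2)[of "pi/2"] by (simp add: v_def)
    then obtain k where k: "k \<noteq> 0" "W (pi/2) = k *\<^sub>R v" by (auto simp: proj_pt_eq_scaleR)
    have cos_end: "cos (- pi/2) = 0" "cos (pi/2) = 0" using cos_minus[of "pi/2"] by simp_all
    have Jend: "J (pi/2) = - \<mu> * (b2 * b3) * (k * (v \<bullet> v))" "J (- pi/2) = \<mu> * (b2 * b3) * (k * (v \<bullet> v))"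
      unfolding J_def L_def cos_end aend W(3) k(2) Vend(1) v_def[symmetric] by simp_all
    define c where "c = \<mu> * (b2 * b3) * (k * (v \<bullet> v))"
    have "c \<noteq> 0" unfolding c_def using \<mu>(1) b_nz k(1) Vend(2) by (simp add: v_def)
    have pi: "- pi/2 < pi/2" using pi_gt_zero by linarith
    have cont_cJ: "continuous_on ?I (\<lambda>x. - c * J x)" "continuous_on ?I (\<lambda>x. c * J x)"
      by (intro continuous_intros cont_J)+
    have Jc: "J (pi/2) = - c" "J (- pi/2) = c" using Jend by (simp_all add: c_def)
    have "- c * J (pi/2) > 0" "c * J (- pi/2) > 0" unfolding Jc using \<open>c \<noteq> 0\<close> by (simp_all add: zero_less_mult_iff) linarith+
    obtain x1 x2 where x: "x1 \<in> {- pi/2<..<pi/2}" "- c * J x1 > 0" "x2 \<in> {- pi/2<..<pi/2}" "c * J x2 > 0"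
      using ex_less_right_end[OF pi cont_cJ(1) \<open>- c * J (pi/2) > 0\<close>]
        ex_less_left_end[OF pi cont_cJ(2) \<open>c * J (- pi/2) > 0\<close>] by blast
    have sgn: "d * l (W x) > 0" if "x \<in> {- pi/2<..<pi/2}" "d * J x > 0" for x d
    proof -
      have "cos x > 0" using that(1) cos_gt_zero_pi[of x] by auto
      then have "cos x * (d * J x) > 0" using that(2) by (rule mult_pos_pos)
      also have "cos x * (d * J x) = d * l (W x) * (V x \<bullet> V x)" using key[of x] that(1) by (simp add: ac_simps)
      finally show ?thesis by (metis inner_ge_zero mult_le_0_iff not_less)
    qed
    have "- c * l (W x1) > 0" "c * l (W x2) > 0" using sgn[OF x(1,2)] sgn[OF x(3,4)] by auto
    then have opp: "c * l (W x1) < 0" "c * l (W x2) > 0" by auto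
    have "\<exists>x\<in>{- pi/2<..<pi/2}. c * l (W x) = 0"
    proof -
      have sub: "closed_segment x1 x2 \<subseteq> {- pi/2<..<pi/2}"
        using x(1,3) by (auto simp: closed_segment_eq_real_ivl)
      have "continuous_on (closed_segment x1 x2) (\<lambda>x. c * l (W x))"
        by (intro continuous_intros continuous_on_subset[OF cont_l]) (use sub in auto)
      then have "connected ((\<lambda>x. c * l (W x)) ` closed_segment x1 x2)"
        by (rule connected_continuous_image) simp
      then have "0 \<in> (\<lambda>x. c * l (W x)) ` closed_segment x1 x2"
        by (rule connectedD_interval[of _ "c * l (W x1)" "c * l (W x2)"]) (use opp in auto)
      then show ?thesis using sub by force
    qed
    then show False using lnz \<open>c \<noteq> 0\<close> by auto
  qed
qed

definition curve_pos :: "real \<Rightarrow> (real^3) set set" where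
  "curve_pos s = {proj_pt z | z. z \<noteq> 0 \<and> Phi z = 0 \<and> sep_form s z > 0}"

definition curve_neg :: "real \<Rightarrow> (real^3) set set" where
  "curve_neg s = {proj_pt z | z. z \<noteq> 0 \<and> Phi z = 0 \<and> sep_form s z < 0}"

lemma mem_curve_pos_neg:
  assumes "z \<noteq> 0" "Phi z = 0"
  shows "proj_pt z \<in> curve_pos s \<longleftrightarrow> sep_form s z > 0" "proj_pt z \<in> curve_neg s \<longleftrightarrow> sep_form s z < 0"
proof -
  have "sep_form s (c *\<^sub>R x) > 0 \<longleftrightarrow> sep_form s x > 0" "sep_form s (c *\<^sub>R x) < 0 \<longleftrightarrow> sep_form s x < 0" if "c \<noteq> 0" for c x
    using that by (simp_all add: sep_form_scale zero_less_mult_iff mult_less_0_iff)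
  then show "proj_pt z \<in> curve_pos s \<longleftrightarrow> sep_form s z > 0" "proj_pt z \<in> curve_neg s \<longleftrightarrow> sep_form s z < 0"
    using assms unfolding curve_pos_def curve_neg_def by (auto simp: proj_pt_eq_scaleR)
qed

text \<open>\<open>sep_form\<close> has even degree, so its sign is well defined on the projective
  plane and both pieces are open. The point m1 = w = 0 lies on the positive one.\<close>

lemma curve_pos_neg_split:
  assumes F: "F s < 0" and B: "curve_neg s \<noteq> {}"
  shows "card (connected_components_of (subtopology rp2 curve)) \<noteq> 1"
    and "card (connected_components_of (subtopology rp2 curve)) = 2 \<Longrightarrow>
      connected_components_of (subtopology rp2 curve) = {curve_pos s, curve_neg s}"
    and "curve_pos s \<inter> curve_neg s = {}"
proof -
  have cs: "continuous_on S (sep_form s)" for S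
    unfolding sep_form_def by (intro continuous_intros cont)
  have o: "openin rp2 {proj_pt z | z. z \<noteq> 0 \<and> sep_form s z > 0}" "openin rp2 {proj_pt z | z. z \<noteq> 0 \<and> sep_form s z < 0}"
  proof -
    have "open ({z. sep_form s z > 0} - {0})" "open ({z. sep_form s z < 0} - {0})"
      by (auto intro!: open_Diff open_Collect_less continuous_intros cs)
    moreover have "{z. sep_form s z > 0} - {0} = {z. z \<noteq> 0 \<and> sep_form s z > 0}" "{z. sep_form s z < 0} - {0} = {z. z \<noteq> 0 \<and> sep_form s z < 0}"
      by auto
    ultimately have "open {z. z \<noteq> 0 \<and> sep_form s z > 0}" "open {z. z \<noteq> 0 \<and> sep_form s z < 0}"
      by simp_all
    then show "openin rp2 {proj_pt z | z. z \<noteq> 0 \<and> sep_form s z > 0}" "openin rp2 {proj_pt z | z. z \<noteq> 0 \<and> sep_form s z < 0}"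
      by (intro openin_rp2_image; simp add: sep_form_scale zero_less_mult_iff mult_less_0_iff)+
  qed
  have e: "curve_pos s = curve \<inter> {proj_pt z | z. z \<noteq> 0 \<and> sep_form s z > 0}"
    "curve_neg s = curve \<inter> {proj_pt z | z. z \<noteq> 0 \<and> sep_form s z < 0}"
  proof -
    show "curve_pos s = curve \<inter> {proj_pt z | z. z \<noteq> 0 \<and> sep_form s z > 0}"
    proof (intro subset_antisym subsetI)
      fix x assume "x \<in> curve_pos s"
      then show "x \<in> curve \<inter> {proj_pt z | z. z \<noteq> 0 \<and> sep_form s z > 0}"
        unfolding curve_pos_def curve_def by blast
    next
      fix x assume x: "x \<in> curve \<inter> {proj_pt z | z. z \<noteq> 0 \<and> sep_form s z > 0}"
      then obtain z where z: "x = proj_pt z" "z \<noteq> 0" "sep_form s z > 0" by blast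
      then show "x \<in> curve_pos s" using x proj_pt_curve_iff[OF z(2)] unfolding curve_pos_def by blast
    qed
    show "curve_neg s = curve \<inter> {proj_pt z | z. z \<noteq> 0 \<and> sep_form s z < 0}"
    proof (intro subset_antisym subsetI)
      fix x assume "x \<in> curve_neg s"
      then show "x \<in> curve \<inter> {proj_pt z | z. z \<noteq> 0 \<and> sep_form s z < 0}"
        unfolding curve_neg_def curve_def by blast
    next
      fix x assume x: "x \<in> curve \<inter> {proj_pt z | z. z \<noteq> 0 \<and> sep_form s z < 0}"
      then obtain z where z: "x = proj_pt z" "z \<noteq> 0" "sep_form s z < 0" by blast
      then show "x \<in> curve_neg s" using x proj_pt_curve_iff[OF z(2)] unfolding curve_neg_def by blast
    qed
  qed
  have op: "openin (subtopology rp2 curve) (curve_pos s)" "openin (subtopology rp2 curve) (curve_neg s)"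
    unfolding e using o by (auto intro: openin_subtopology_Int2)
  show dis: "curve_pos s \<inter> curve_neg s = {}"
  proof -
    have "x \<notin> curve_neg s" if x: "x \<in> curve_pos s" for x
    proof -
      obtain z where "x = proj_pt z" "z \<noteq> 0" "Phi z = 0" "sep_form s z > 0" using x unfolding curve_pos_def by auto
      then show ?thesis using mem_curve_pos_neg[of z s] by simp
    qed
    then show ?thesis by blast
  qed
  have un: "curve_pos s \<union> curve_neg s = topspace (subtopology rp2 curve)"
  proof -
    have "curve_pos s \<union> curve_neg s = curve"
    proof (intro subset_antisym subsetI)
      fix x assume "x \<in> curve"
      then obtain z where z: "z \<noteq> 0" "x = proj_pt z" "Phi z = 0" unfolding curve_def by blast
      then have "sep_form s z > 0 \<or> sep_form s z < 0" using sep_form_nonzero[OF F] by fastforce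
      then show "x \<in> curve_pos s \<union> curve_neg s" using z mem_curve_pos_neg by blast
    qed (auto simp: curve_pos_def curve_neg_def curve_def)
    then show ?thesis using curve_subset by (auto simp: topspace_rp2)
  qed
  have A: "curve_pos s \<noteq> {}"
    using inf_point sep_form_inf at_inf_Phi unfolding curve_pos_def by blast
  show "card (connected_components_of (subtopology rp2 curve)) \<noteq> 1"
    by (rule connected_components_clopen_split(1)[OF op(1) A op(2) B dis un])
  show "connected_components_of (subtopology rp2 curve) = {curve_pos s, curve_neg s}"
    if "card (connected_components_of (subtopology rp2 curve)) = 2"
    by (rule connected_components_clopen_split(2)[OF op(1) A op(2) B dis un that])
qed

lemma affine_negative_point:
  assumes "x1 < x2" "x2 < x3" and Fs: "\<And>s. F s = - 4 * (b1 * b2 * b3) * (s - x1) * (s - x2) * (s - x3)"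
    and s: "x2 < s"
  shows "\<exists>z. Phi z = 0 \<and> w z = 1 \<and> sep_form s z < 0"
proof -
  \<comment> \<open>A level on the bounded component, away from the two values at which
    \<open>affine_level_point\<close> would divide by zero.\<close>
  have "infinite ({x1<..<x2} - {- u2 / b2, - u3 / b3})"
    using assms(1) by (simp add: infinite_Ioo)
  then obtain t where t: "t \<in> {x1<..<x2} - {- u2 / b2, - u3 / b3}"
    by (metis ex_in_conv finite.emptyI)
  then have nz: "u2 + b2 * t \<noteq> 0" "u3 + b3 * t \<noteq> 0" using b_nz by (auto simp: field_simps eq_neg_iff_add_eq_0)
  have "(t - x1) * (t - x2) * (t - x3) \<ge> 0"
    using t assms by (intro mult_nonpos_nonpos mult_nonneg_nonpos) auto
  from mult_nonneg_nonneg[OF less_imp_le[OF leading_coeff_pos] this]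
  have "F t \<ge> 0" unfolding Fs by (simp only: mult.assoc)
  then obtain z where z: "w z = 1" "at_level t z" using affine_level_point nz by blast
  then have "z \<noteq> 0" using lin(4) linear_0 by fastforce
  then have "sep_form s z < 0" using sep_form_level_sgn(2)[OF z(2)] t s by auto
  then show ?thesis using z at_level_Phi by blast
qed

text \<open>The line m1 = \<mu> w can meet the curve only at m1 = w = 0, where
  \<open>sep_form\<close> is positive. So the negative piece lies in the chart complementary to this
  line.\<close>

lemma contractible_curve_neg:
  assumes \<mu>: "\<And>z. Phi z = 0 \<Longrightarrow> m1 z = \<mu> * w z \<Longrightarrow> at_inf z"
  shows "contractible_in_rp2 (curve_neg s)"
proof -
  define l where "l z = m1 z - \<mu> * w z" for z
  have "b1 * 1 + b2 * (- b1 / b2) + b3 * 0 = \<beta> * 0" using b_nz by simp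
  then obtain e where "m1 e = 1" "w e = 0" using surj by blast
  then have e: "l e \<noteq> 0" by (simp add: l_def)
  have l: "linear l"
    by (rule linearI) (use lin in \<open>simp_all add: l_def linear_add linear_cmul algebra_simps\<close>)
  show ?thesis
  proof (rule contractible_in_rp2_affine[OF l _ e])
    show "curve_neg s \<subseteq> {proj_pt v |v. v \<noteq> 0 \<and> l v \<noteq> 0}"
    proof
      fix x assume "x \<in> curve_neg s"
      then obtain z where z: "x = proj_pt z" "z \<noteq> 0" "Phi z = 0" "sep_form s z < 0"
        unfolding curve_neg_def by blast
      then have "l z \<noteq> 0" using \<mu>[of z] sep_form_inf[of z s] by (auto simp: l_def)
      then show "x \<in> {proj_pt v |v. v \<noteq> 0 \<and> l v \<noteq> 0}" using z by blast
    qed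
  qed
qed

text \<open>Equation, discriminant and curve are cyclically symmetric, so the three interpretations
  describe the same curve and differ only in their levels.\<close>

lemma rot_Phi: "pencil_cubic.Phi m2 m3 m1 w u2 u3 u1 r = Phi"
proof -
  interpret rot: pencil_cubic m2 m3 m1 w b2 b3 b1 \<beta> u2 u3 u1 r by (rule rotate)
  show ?thesis by (rule ext) (simp add: rot.Phi_def Phi_def algebra_simps)
qed

lemma rot_F: "pencil_cubic.F b2 b3 b1 \<beta> u2 u3 u1 r = F"
proof -
  interpret rot: pencil_cubic m2 m3 m1 w b2 b3 b1 \<beta> u2 u3 u1 r by (rule rotate)
  show ?thesis by (rule ext) (simp only: rot.F_def F_def ac_simps)
qed

lemma rot_curve: "pencil_cubic.curve m2 m3 m1 w u2 u3 u1 r = curve"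
proof -
  interpret rot: pencil_cubic m2 m3 m1 w b2 b3 b1 \<beta> u2 u3 u1 r by (rule rotate)
  show ?thesis by (simp add: rot.curve_def curve_def rot_Phi)
qed

lemma two_components:
  assumes x: "x1 < x2" "x2 < x3" and Fs: "\<And>s. F s = - 4 * (b1 * b2 * b3) * (s - x1) * (s - x2) * (s - x3)"
    and s: "x2 < s" "s < x3"
  shows "F s < 0" "curve_neg s \<noteq> {}" "card (connected_components_of (subtopology rp2 curve)) \<noteq> 1"
    and "card (connected_components_of (subtopology rp2 curve)) = 2 \<Longrightarrow>
      connected_components_of (subtopology rp2 curve) = {curve_pos s, curve_neg s}"
    and "curve_pos s \<inter> curve_neg s = {}"
proof -
  have "(- 4 * (b1 * b2 * b3)) * ((s - x1) * (s - x2)) * (s - x3) < 0"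
    using x s by (intro mult_pos_neg mult_pos_pos leading_coeff_pos) auto
  then show F: "F s < 0" unfolding Fs by (simp only: mult.assoc)
  obtain z where z: "Phi z = 0" "w z = 1" "sep_form s z < 0"
    using affine_negative_point[OF x Fs s(1)] by blast
  then have "z \<noteq> 0" using lin(4) linear_0 by fastforce
  then show B: "curve_neg s \<noteq> {}" using z unfolding curve_neg_def by blast
  show "card (connected_components_of (subtopology rp2 curve)) \<noteq> 1"
    by (rule curve_pos_neg_split(1)[OF F B])
  show "connected_components_of (subtopology rp2 curve) = {curve_pos s, curve_neg s}"
    if "card (connected_components_of (subtopology rp2 curve)) = 2"
    by (rule curve_pos_neg_split(2)[OF F B that])
  show "curve_pos s \<inter> curve_neg s = {}" by (rule curve_pos_neg_split(3)[OF F B])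
qed

text \<open>By \<open>pos\<close> the forms of indices 2 and 3 agree in sign on the curve, which is
  the last claim. Moreover \<open>pos\<close> provides the isolating line through the point at
  infinity of index 1: the negative piece misses it, the positive one crosses it once.\<close>

lemma distinguished_index:
  assumes x: "x1 < x2" "x2 < x3" and Fs: "\<And>s. F s = - 4 * (b1 * b2 * b3) * (s - x1) * (s - x2) * (s - x3)"
    and s: "x2 < s" "s < x3" and pos: "b2 * b3 * (u1 + b1 * s) > 0"
  shows "contractible_in_rp2 (curve_neg s)" "\<not> contractible_in_rp2 (curve_pos s)"
    and "pencil_cubic.curve_pos m2 m3 m1 w b2 b3 b1 \<beta> u2 u3 u1 r s =
      pencil_cubic.curve_pos m3 m1 m2 w b3 b1 b2 \<beta> u3 u1 u2 r s"
proof -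
  interpret rot: pencil_cubic m2 m3 m1 w b2 b3 b1 \<beta> u2 u3 u1 r by (rule rotate)
  interpret rot2: pencil_cubic m3 m1 m2 w b3 b1 b2 \<beta> u3 u1 u2 r by (rule rot.rotate)
  have F: "F s < 0" by (rule two_components(1)[OF x Fs s])
  have Fs': "rot.F t = - 4 * (b2 * b3 * b1) * (t - x1) * (t - x2) * (t - x3)" for t
    unfolding rot_F Fs by (simp add: ac_simps)
  obtain z0 where "Phi z0 = 0" "w z0 = 1" "rot.sep_form s z0 < 0"
    using rot.affine_negative_point[OF x Fs' s(1)] unfolding rot_Phi by blast
  then obtain \<mu> where \<mu>: "\<mu> \<noteq> 0" "\<And>z. Phi z = 0 \<Longrightarrow> m1 z = \<mu> * w z \<Longrightarrow> at_inf z"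
    using isolating_line[OF F pos] by blast
  show "contractible_in_rp2 (curve_neg s)" by (rule contractible_curve_neg) (rule \<mu>(2))
  let ?k2 = "- 4 * (b1 * b2 * b3)"
  \<comment> \<open>\<open>k1\<close> and \<open>k0\<close> are the lower coefficients of
    \<open>?k2 * (s - x1) * (s - x2)\<close> expanded around \<open>x3\<close>.\<close>
  show "\<not> contractible_in_rp2 (curve_pos s)"
  proof (rule not_contractible[where ?s3.0 = x3 and ?k2.0 = ?k2 and \<mu> = \<mu>
        and ?k1.0 = "?k2 * ((x3 - x1) + (x3 - x2))" and ?k0.0 = "?k2 * ((x3 - x1) * (x3 - x2))"])
    show "F t = (t - x3) * (?k2 * (t - x3)\<^sup>2 + ?k2 * ((x3 - x1) + (x3 - x2)) * (t - x3) + ?k2 * ((x3 - x1) * (x3 - x2)))" for t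
      unfolding Fs by (simp add: algebra_simps power2_eq_square)
    show "?k2 * v\<^sup>2 + ?k2 * ((x3 - x1) + (x3 - x2)) * v + ?k2 * ((x3 - x1) * (x3 - x2)) > 0" if "v \<ge> 0" for v
    proof -
      have "?k2 * ((v + (x3 - x1)) * (v + (x3 - x2))) > 0"
        using that x by (intro mult_pos_pos leading_coeff_pos) auto
      then show ?thesis by (simp add: algebra_simps power2_eq_square)
    qed
    show "proj_pt z \<in> curve_pos s" if z: "z \<noteq> 0" "at_inf z \<or> (\<exists>t\<ge>x3. at_level t z)" for z
    proof -
      have "Phi z = 0 \<and> sep_form s z > 0"
        using z at_inf_Phi at_level_Phi sep_form_inf sep_form_level_sgn(1) s(2)
        by (meson less_le_trans)
      then show ?thesis using mem_curve_pos_neg(1) z(1) by blast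
    qed
  qed (use \<mu> in auto)
  have "rot.sep_form s z > 0 \<longleftrightarrow> rot2.sep_form s z > 0" if "z \<noteq> 0" "Phi z = 0" for z
    using sep_form_pos_pair[OF F pos that(2,1)] by (auto simp: zero_less_mult_iff)
  then have "(z \<noteq> 0 \<and> Phi z = 0 \<and> rot.sep_form s z > 0) \<longleftrightarrow> (z \<noteq> 0 \<and> Phi z = 0 \<and> rot2.sep_form s z > 0)" for z
    by blast
  then show "rot.curve_pos s = rot2.curve_pos s"
    unfolding rot.curve_pos_def rot2.curve_pos_def rot.rot_Phi rot_Phi by simp
qed

section \<open>Hexagon vertices as points over level 0\<close>

text \<open>The two lines are those of P1. Exchanging each entry with its transpose gives those of
  Q1 and preserves u and r. The witness \<open>v\<close> solves both equations in the coordinates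
  (m2, m3, w).\<close>

lemma vertex:
  assumes u: "u1 = x23 * x32" "u2 = x31 * x13" "u3 = x12 * x21"
    and r: "r = x12 * x23 * x31 + x13 * x32 * x21"
  obtains v where "v \<noteq> 0" "at_level 0 v"
    "{proj_pt z | z. z \<noteq> 0 \<and> x31 * x23 * w z - x21 * m3 z = 0} \<inter>
     {proj_pt z | z. z \<noteq> 0 \<and> x21 * x32 * w z - x31 * m2 z = 0} = {proj_pt v}"
proof -
  obtain e2 e3 e0 where fr: "\<And>x y c. m2 (x *\<^sub>R e2 + y *\<^sub>R e3 + c *\<^sub>R e0) = x"
    "\<And>x y c. m3 (x *\<^sub>R e2 + y *\<^sub>R e3 + c *\<^sub>R e0) = y"
    "\<And>x y c. w (x *\<^sub>R e2 + y *\<^sub>R e3 + c *\<^sub>R e0) = c" using frame by blast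
  define v where "v = (x21\<^sup>2 * x32) *\<^sub>R e2 + (x31\<^sup>2 * x23) *\<^sub>R e3 + (x21 * x31) *\<^sub>R e0"
  have v: "m2 v = x21\<^sup>2 * x32" "m3 v = x31\<^sup>2 * x23" "w v = x21 * x31"
    unfolding v_def fr by simp_all
  \<comment> \<open>Otherwise \<open>r\<close> and two of the products u vanish, which makes 0 a
    double root of \<open>F\<close>.\<close>
  have v0: "v \<noteq> 0"
  proof
    assume "v = 0"
    then have "m2 v = 0" "m3 v = 0" "w v = 0" using lin by (simp_all add: linear_0)
    then have "x21 = 0 \<and> x31 = 0 \<or> x21 = 0 \<and> x23 = 0 \<or> x31 = 0 \<and> x32 = 0" unfolding v by auto
    then have "r = 0 \<and> (u3 = 0 \<and> u2 = 0 \<or> u3 = 0 \<and> u1 = 0 \<or> u2 = 0 \<and> u1 = 0)"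
      unfolding u r by auto
    then show False using nondeg[of 0] by auto
  qed
  have lev: "at_level 0 v" unfolding at_level_def v by (simp add: u r algebra_simps power2_eq_square)
  have on: "x31 * x23 * w v - x21 * m3 v = 0" "x21 * x32 * w v - x31 * m2 v = 0"
    unfolding v by (simp_all add: power2_eq_square)
  have uniq: "proj_pt z = proj_pt v"
    if z: "z \<noteq> 0" "x31 * x23 * w z - x21 * m3 z = 0" "x21 * x32 * w z - x31 * m2 z = 0" for z
  proof (rule proj_pt_eq_coords[OF z(1) v0])
    have a: "x21 * m3 z = x31 * x23 * w z" "x31 * m2 z = x21 * x32 * w z" using z by auto
    show "m2 z * m3 v = m3 z * m2 v"
      unfolding v using arg_cong[OF a(1), of "\<lambda>t. t * (x21 * x32)"] arg_cong[OF a(2), of "\<lambda>t. t * (x31 * x23)"]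
      by (simp only: power2_eq_square ac_simps)
    show "m2 z * w v = w z * m2 v"
      unfolding v using arg_cong[OF a(2), of "\<lambda>t. t * x21"] by (simp only: power2_eq_square ac_simps)
    show "m3 z * w v = w z * m3 v"
      unfolding v using arg_cong[OF a(1), of "\<lambda>t. t * x31"] by (simp only: power2_eq_square ac_simps)
  qed
  have "{proj_pt z | z. z \<noteq> 0 \<and> x31 * x23 * w z - x21 * m3 z = 0} \<inter>
     {proj_pt z | z. z \<noteq> 0 \<and> x21 * x32 * w z - x31 * m2 z = 0} = {proj_pt v}"
  proof (intro subset_antisym subsetI)
    fix p assume "p \<in> {proj_pt z | z. z \<noteq> 0 \<and> x31 * x23 * w z - x21 * m3 z = 0} \<inter>
     {proj_pt z | z. z \<noteq> 0 \<and> x21 * x32 * w z - x31 * m2 z = 0}"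
    then obtain z z' where z: "z \<noteq> 0" "p = proj_pt z" "x31 * x23 * w z - x21 * m3 z = 0"
      and z': "p = proj_pt z'" "x21 * x32 * w z' - x31 * m2 z' = 0" by blast
    have "proj_pt z = proj_pt z'" using z(2) z'(1) by simp
    then obtain c where "c \<noteq> 0" "z' = c *\<^sub>R z" by (auto simp: proj_pt_eq_scaleR)
    then have "c * (x21 * x32 * w z - x31 * m2 z) = 0" using z'(2) by (simp add: scale algebra_simps)
    then have "x21 * x32 * w z - x31 * m2 z = 0" using \<open>c \<noteq> 0\<close> by simp
    then show "p \<in> {proj_pt v}" using uniq z by simp
  next
    fix p assume "p \<in> {proj_pt v}"
    then show "p \<in> {proj_pt z | z. z \<noteq> 0 \<and> x31 * x23 * w z - x21 * m3 z = 0} \<inter>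
     {proj_pt z | z. z \<noteq> 0 \<and> x21 * x32 * w z - x31 * m2 z = 0}" using v0 on by blast
  qed
  then show thesis by (rule that[OF v0 lev])
qed

end

subsection \<open>Local solutions and blow-up\<close>

abbreviation flow_field :: "real^3^3 \<Rightarrow> real^3^3 \<Rightarrow> real^3^3" where
  "flow_field A X \<equiv> (X ** X) ** A - A ** (X ** X)"

lemma flow_field_nth:
  fixes A X :: "real^3^3"
  assumes "\<And>i j. i \<noteq> j \<Longrightarrow> A$i$j = 0"
  shows "flow_field A X $ i $ j = (A$j$j - A$i$i) * (\<Sum>k\<in>UNIV. X$i$k * X$k$j)"
proof -
  have "(M ** A) $ i $ j = M$i$j * A$j$j" for M :: "real^3^3"
  proof -
    have "M$i$k * A$k$j = (if k = j then M$i$j * A$j$j else 0)" for k using assms[of k j] by simp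
    then have "(\<Sum>k\<in>UNIV. M$i$k * A$k$j) = (\<Sum>k\<in>UNIV. if k = j then M$i$j * A$j$j else 0)"
      by (rule sum.cong[OF refl])
    then show ?thesis by (simp add: matrix_matrix_mult_def)
  qed
  moreover have "(A ** M) $ i $ j = A$i$i * M$i$j" for M :: "real^3^3"
  proof -
    have "A$i$k * M$k$j = (if k = i then A$i$i * M$i$j else 0)" for k using assms[of i k] by auto
    then have "(\<Sum>k\<in>UNIV. A$i$k * M$k$j) = (\<Sum>k\<in>UNIV. if k = i then A$i$i * M$i$j else 0)"
      by (rule sum.cong[OF refl])
    then show ?thesis by (simp add: matrix_matrix_mult_def)
  qed
  moreover have "(X ** X) $ i $ j = (\<Sum>k\<in>UNIV. X$i$k * X$k$j)"
    by (simp add: matrix_matrix_mult_def)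
  ultimately show ?thesis by (simp add: algebra_simps)
qed

lemma norm_le_9_entry_bound:
  fixes X :: "real^3^3"
  assumes "\<And>i j. \<bar>X$i$j\<bar> \<le> c"
  shows "norm X \<le> 9 * c"
proof -
  have "norm (X$i) \<le> 3 * c" for i
    using norm_le_l1_cart[of "X$i"] sum_mono[of UNIV "\<lambda>j. \<bar>X$i$j\<bar>" "\<lambda>_::3. c"] assms by simp
  then have "(\<Sum>i\<in>UNIV. norm (X$i)) \<le> (\<Sum>i\<in>(UNIV::3 set). 3 * c)" by (intro sum_mono) simp
  moreover have "norm X \<le> (\<Sum>i\<in>UNIV. norm (X$i))"
    unfolding norm_vec_def by (rule L2_set_le_sum) simp
  ultimately show ?thesis by simp
qed

lemma entry_le_norm:
  fixes X :: "real^3^3"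
  shows "\<bar>X$i$j\<bar> \<le> norm X"
  using component_le_norm_cart[of "X$i" j] Finite_Cartesian_Product.norm_nth_le[of X i] by simp

lemma has_vector_derivative_entries:
  fixes x :: "real \<Rightarrow> real^3^3"
  shows "(x has_vector_derivative D) (at t within S) \<longleftrightarrow>
    (\<forall>i j. ((\<lambda>t. x t $ i $ j) has_real_derivative D$i$j) (at t within S))"
proof
  assume "(x has_vector_derivative D) (at t within S)"
  then show "\<forall>i j. ((\<lambda>t. x t $ i $ j) has_real_derivative D$i$j) (at t within S)"
    unfolding has_real_derivative_iff_has_vector_derivative
    by (intro allI bounded_linear.has_vector_derivative[OF bounded_linear_vec_nth])
next
  assume *: "\<forall>i j. ((\<lambda>t. x t $ i $ j) has_real_derivative D$i$j) (at t within S)"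
  show "(x has_vector_derivative D) (at t within S)"
    unfolding has_vector_derivative_def
  proof (subst has_derivative_componentwise_within, intro ballI)
    fix b :: "real^3^3" assume "b \<in> Basis"
    then obtain i c where "b = axis i c" "c \<in> Basis" unfolding Basis_vec_def by blast
    moreover from this(2) obtain j where "c = axis j 1" unfolding Basis_vec_def by auto
    ultimately have "b = axis i (axis j 1)" by simp
    then show "((\<lambda>t. x t \<bullet> b) has_derivative (\<lambda>h. (h *\<^sub>R D) \<bullet> b)) (at t within S)"
      using * by (simp add: inner_axis has_field_derivative_def mult.commute[of _ "D$i$j"])
  qed
qed

text \<open>Local existence by power series: the recursion for the coefficients of a solution of a
  homogeneous quadratic equation gives the geometric bound \<open>\<bar>c\<^sub>n\<bar> \<le> m \<rho>\<^sup>n\<close>.\<close>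

fun flow_coeff :: "real^3^3 \<Rightarrow> real^3^3 \<Rightarrow> nat \<Rightarrow> 3 \<Rightarrow> 3 \<Rightarrow> real" where
  "flow_coeff A X 0 i j = X$i$j"
| "flow_coeff A X (Suc n) i j = (A$j$j - A$i$i) *
    (\<Sum>k\<in>UNIV. \<Sum>l\<le>n. flow_coeff A X l i k * flow_coeff A X (n - l) k j) / real (Suc n)"

text \<open>All convolution terms have the same geometric bound, and their number cancels against
  the division by \<open>Suc n\<close>. The 3 counts the summands of the matrix product.\<close>

lemma flow_coeff_bound:
  assumes a: "\<And>i j. \<bar>A$j$j - A$i$i\<bar> \<le> a"
  shows "\<bar>flow_coeff A X n i j\<bar> \<le> norm X * (3 * a * norm X)^n"
proof (induction n arbitrary: i j rule: less_induct)
  case (less n)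
  have a0: "a \<ge> 0" using a[of 1 1] by simp
  let ?m = "norm X" and ?r = "3 * a * norm X"
  show ?case
  proof (cases n)
    case 0
    then show ?thesis by (simp add: entry_le_norm)
  next
    case (Suc k)
    have "\<bar>flow_coeff A X l i p * flow_coeff A X (k - l) p j\<bar> \<le> ?m\<^sup>2 * ?r^k" if "l \<le> k" for l p
    proof -
      have "\<bar>flow_coeff A X l i p\<bar> * \<bar>flow_coeff A X (k - l) p j\<bar> \<le> (?m * ?r^l) * (?m * ?r^(k - l))"
        using less.IH[of l i p] less.IH[of "k - l" p j] that Suc a0 by (intro mult_mono) auto
      also have "\<dots> = ?m\<^sup>2 * ?r^k" using that by (simp add: power2_eq_square power_add[symmetric] ac_simps)
      finally show ?thesis by (simp add: abs_mult)
    qed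
    then have "(\<Sum>l\<le>k. \<bar>flow_coeff A X l i p * flow_coeff A X (k - l) p j\<bar>) \<le> (\<Sum>l\<le>k. ?m\<^sup>2 * ?r^k)" for p
      by (intro sum_mono) auto
    then have "\<bar>\<Sum>l\<le>k. flow_coeff A X l i p * flow_coeff A X (k - l) p j\<bar> \<le> real (Suc k) * (?m\<^sup>2 * ?r^k)" for p
      using order_trans[OF sum_abs] by fastforce
    then have "(\<Sum>p\<in>UNIV. \<bar>\<Sum>l\<le>k. flow_coeff A X l i p * flow_coeff A X (k - l) p j\<bar>) \<le>
        (\<Sum>p\<in>(UNIV::3 set). real (Suc k) * (?m\<^sup>2 * ?r^k))" by (intro sum_mono)
    then have S: "\<bar>\<Sum>p\<in>UNIV. \<Sum>l\<le>k. flow_coeff A X l i p * flow_coeff A X (k - l) p j\<bar> \<le>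
        3 * (real (Suc k) * (?m\<^sup>2 * ?r^k))"
      using order_trans[OF sum_abs] by fastforce
    have "\<bar>flow_coeff A X n i j\<bar> = \<bar>A$j$j - A$i$i\<bar> *
        \<bar>\<Sum>p\<in>UNIV. \<Sum>l\<le>k. flow_coeff A X l i p * flow_coeff A X (k - l) p j\<bar> / real (Suc k)"
      by (simp add: Suc abs_mult del: of_nat_Suc)
    also have "\<dots> \<le> a * (3 * (real (Suc k) * (?m\<^sup>2 * ?r^k))) / real (Suc k)"
      using a[of j i] S a0 by (intro divide_right_mono mult_mono) auto
    also have "\<dots> = ?m * ?r^n" by (simp add: Suc power2_eq_square del: of_nat_Suc)
    finally show ?thesis .
  qed
qed

text \<open>\<open>K\<close> makes the ratio of the majorising geometric series at most 1/20. Its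
  tail is then at most \<open>norm X / 19\<close> per entry, and 9/19 < 1/2 covers all nine
  entries.\<close>

lemma flow_local_solution:
  fixes A X :: "real^3^3"
  assumes diag: "\<And>i j. i \<noteq> j \<Longrightarrow> A$i$j = 0" and a: "\<And>i j. \<bar>A$j$j - A$i$i\<bar> \<le> a"
  defines "K \<equiv> 20 * (3 * a + 1)"
  shows "\<exists>x. x 0 = X \<and> (\<forall>t. \<bar>t\<bar> \<le> 1 / (K * (norm X + 1)) \<longrightarrow>
    (x has_vector_derivative flow_field A (x t)) (at t) \<and> norm (x t - X) \<le> norm X / 2)"
proof -
  let ?m = "norm X" and ?r = "3 * a * norm X"
  have a0: "a \<ge> 0" using a[of 1 1] by simp
  have K: "K > 0" unfolding K_def using a0 by simp
  define c where "c = flow_coeff A X"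
  define x where "x t = (\<chi> i j. \<Sum>n. c n i j * t^n)" for t
  have bound: "\<bar>c n i j * t^n\<bar> \<le> ?m * (?r * \<bar>t\<bar>)^n" for n i j t
    using mult_right_mono[OF flow_coeff_bound[OF a, where X = X and n = n and i = i and j = j], of "\<bar>t^n\<bar>"]
    by (simp add: c_def abs_mult power_abs power_mult_distrib mult.assoc)
  have summ: "summable (\<lambda>n. \<bar>c n i j * t^n\<bar>)" if "?r * \<bar>t\<bar> < 1" for i j t
    by (rule summable_comparison_test'[of "\<lambda>n. ?m * (?r * \<bar>t\<bar>)^n" 0])
       (use bound that a0 in \<open>auto intro!: summable_mult summable_geometric\<close>)
  have x0: "x 0 = X" by (simp add: x_def vec_eq_iff c_def powser_zero)
  have "(x has_vector_derivative flow_field A (x t)) (at t) \<and> norm (x t - X) \<le> ?m / 2"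
    if t: "\<bar>t\<bar> \<le> 1 / (K * (?m + 1))" for t
  proof -
    have m1: "?m + 1 > 0" using norm_ge_zero[of X] by linarith
    have rt: "?r * \<bar>t\<bar> \<le> 1 / 20"
    proof -
      have "?r * \<bar>t\<bar> \<le> ?r * (1 / (K * (?m + 1)))" using t a0 by (intro mult_left_mono) auto
      also have "\<dots> \<le> 1 / 20"
      proof -
        have "20 * ?r \<le> K * (?m + 1)" unfolding K_def using a0 by (simp add: algebra_simps)
        moreover have P: "K * (?m + 1) > 0" using K m1 by (rule mult_pos_pos)
        ultimately have "?r / (K * (?m + 1)) \<le> 1 / 20" unfolding pos_divide_le_eq[OF P] by simp
        then show ?thesis by simp
      qed
      finally show ?thesis .
    qed
    have "((\<lambda>t. x t $ i $ j) has_real_derivative flow_field A (x t) $ i $ j) (at t)" for i j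
    proof -
      have ex: "\<exists>R. \<bar>t\<bar> < R \<and> ?r * R < 1"
      proof (cases "?r = 0")
        case True
        show ?thesis unfolding True by (intro exI[of _ "\<bar>t\<bar> + 1"]) simp
      next
        case False
        then have "?r > 0" using a0 by (simp add: less_le)
        then show ?thesis using rt by (intro exI[of _ "1 / (2 * ?r)"]) (auto simp: field_simps)
      qed
      then obtain R where R: "\<bar>t\<bar> < R" "?r * R < 1" by blast
      have "((\<lambda>t. \<Sum>n. c n i j * t^n) has_real_derivative (\<Sum>n. diffs (\<lambda>n. c n i j) n * t^n)) (at t)"
      proof (rule termdiffs_strong)
        have "?r * \<bar>R\<bar> < 1" using R by simp
        then show "summable (\<lambda>n. c n i j * R^n)" by (rule summable_rabs_cancel[OF summ])
      qed (use R in auto)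
      moreover have "(\<Sum>n. diffs (\<lambda>n. c n i j) n * t^n) = flow_field A (x t) $ i $ j"
      proof -
        have rt1: "?r * \<bar>t\<bar> < 1" using rt by simp
        have pr: "(\<lambda>n. \<Sum>l\<le>n. (c l i k * t^l) * (c (n - l) k j * t^(n - l))) sums (x t $ i $ k * x t $ k $ j)" for k
          using Cauchy_product_sums[of "\<lambda>n. c n i k * t^n" "\<lambda>n. c n k j * t^n"] summ[OF rt1]
          by (simp add: x_def)
        have "(\<lambda>n. (A$j$j - A$i$i) * (\<Sum>k\<in>UNIV. \<Sum>l\<le>n. (c l i k * t^l) * (c (n - l) k j * t^(n - l)))) sums
          ((A$j$j - A$i$i) * (\<Sum>k\<in>UNIV. x t $ i $ k * x t $ k $ j))"
          by (intro sums_mult sums_sum pr)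
        moreover have "(A$j$j - A$i$i) * (\<Sum>k\<in>UNIV. \<Sum>l\<le>n. (c l i k * t^l) * (c (n - l) k j * t^(n - l)))
          = diffs (\<lambda>n. c n i j) n * t^n" for n
        proof -
          have "(\<Sum>l\<le>n. (c l i k * t^l) * (c (n - l) k j * t^(n - l))) = (\<Sum>l\<le>n. c l i k * c (n - l) k j) * t^n" for k
            unfolding sum_distrib_right
            by (intro sum.cong refl) (simp add: ac_simps power_add[symmetric])
          then show ?thesis
            by (simp add: diffs_def c_def sum_distrib_right[symmetric] del: of_nat_Suc)
        qed
        ultimately show ?thesis using flow_field_nth[OF diag, of "x t" i j] sums_unique by force
      qed
      ultimately show ?thesis unfolding x_def by simp
    qed
    then have "(x has_vector_derivative flow_field A (x t)) (at t)"
      unfolding has_vector_derivative_entries by simp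
    moreover have "norm (x t - X) \<le> ?m / 2"
    proof -
      have "\<bar>(x t - X) $ i $ j\<bar> \<le> ?m * (1 / 19)" for i j
      proof -
        have rt1: "?r * \<bar>t\<bar> < 1" "?r * \<bar>t\<bar> \<ge> 0" using rt a0 by auto
        have "summable (\<lambda>n. c n i j * t^n)" by (rule summable_rabs_cancel[OF summ[OF rt1(1)]])
        note summ0 = this
        have summ1: "summable (\<lambda>n. \<bar>c (Suc n) i j * t^(Suc n)\<bar>)"
          using summ[OF rt1(1), of i j] summable_Suc_iff[of "\<lambda>n. \<bar>c n i j * t^n\<bar>"] by blast
        have "summable (\<lambda>n. ?m * (?r * \<bar>t\<bar>)^n)" using rt1 by (intro summable_mult summable_geometric) simp
        then have geo: "summable (\<lambda>n. ?m * (?r * \<bar>t\<bar>)^(Suc n))"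
          using summable_Suc_iff[of "\<lambda>n. ?m * (?r * \<bar>t\<bar>)^n"] by blast
        from suminf_split_head[OF summ0]
        have "(x t - X) $ i $ j = (\<Sum>n. c (Suc n) i j * t^(Suc n))"
          by (simp add: x_def c_def del: power_Suc flow_coeff.simps(2))
        also have "\<bar>\<dots>\<bar> \<le> (\<Sum>n. \<bar>c (Suc n) i j * t^(Suc n)\<bar>)"
          by (rule summable_rabs) (rule summ1)
        also have "\<dots> \<le> (\<Sum>n. ?m * (?r * \<bar>t\<bar>)^(Suc n))"
          by (rule suminf_le[OF bound summ1 geo])
        also have "\<dots> = ?m * (?r * \<bar>t\<bar>) * (1 / (1 - ?r * \<bar>t\<bar>))"
          using suminf_geometric[of "?r * \<bar>t\<bar>"] rt1 suminf_mult[OF summable_geometric[of "?r * \<bar>t\<bar>"], of "?m * (?r * \<bar>t\<bar>)"]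
          by (simp add: ac_simps)
        also have "\<dots> \<le> ?m * (1 / 19)"
        proof -
          have "(?r * \<bar>t\<bar>) * (1 / (1 - ?r * \<bar>t\<bar>)) \<le> 1 / 19" using rt rt1 by (simp add: field_simps)
          then show ?thesis unfolding mult.assoc by (intro mult_left_mono) auto
        qed
        finally show ?thesis .
      qed
      then have "norm (x t - X) \<le> 9 * (?m * (1 / 19))" by (rule norm_le_9_entry_bound)
      also have "\<dots> \<le> ?m / 2" by simp
      finally show ?thesis .
    qed
    ultimately show ?thesis by blast
  qed
  then show ?thesis using x0 by blast
qed

lemma has_vector_derivative_Un:
  assumes "(f has_vector_derivative D) (at x within S)" "(f has_vector_derivative D) (at x within T)"
  shows "(f has_vector_derivative D) (at x within (S \<union> T))"
  using assms unfolding has_vector_derivative_def has_derivative_within by (auto intro: Lim_Un)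

text \<open>Steps of length \<open>1 / (K (\<bar>Y\<bar> + 1))\<close> are glued; if their total length is finite, the
  steps shrink to zero, which means that the solution tends to infinity.\<close>

lemma forward_solution:
  fixes f :: "'a::real_normed_vector \<Rightarrow> 'a"
  assumes K: "K > 0" and loc: "\<And>Y. \<exists>x. x 0 = Y \<and> (\<forall>t. \<bar>t\<bar> \<le> 1 / (K * (norm Y + 1)) \<longrightarrow>
      (x has_vector_derivative f (x t)) (at t) \<and> norm (x t - Y) \<le> norm Y / 2)"
  obtains (global) x where "x 0 = X" "\<And>t. t \<ge> 0 \<Longrightarrow> (x has_vector_derivative f (x t)) (at t within {0..})"
  | (finite) x T where "x 0 = X" "T > 0"
      "\<And>t. t \<in> {0..<T} \<Longrightarrow> (x has_vector_derivative f (x t)) (at t within {0..})"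
      "filterlim x at_infinity (at_left T)"
proof -
  define \<tau> where "\<tau> Y = 1 / (K * (norm Y + 1))" for Y :: 'a
  have \<tau>: "\<tau> Y > 0" for Y unfolding \<tau>_def using K by (simp add: add_nonneg_pos)
  obtain \<phi> where \<phi>: "\<And>Y. \<phi> Y 0 = Y"
    "\<And>Y t. \<bar>t\<bar> \<le> \<tau> Y \<Longrightarrow> (\<phi> Y has_vector_derivative f (\<phi> Y t)) (at t)"
    "\<And>Y t. \<bar>t\<bar> \<le> \<tau> Y \<Longrightarrow> norm (\<phi> Y t - Y) \<le> norm Y / 2"
  proof -
    have "\<forall>Y. \<exists>x. x 0 = Y \<and> (\<forall>t. \<bar>t\<bar> \<le> \<tau> Y \<longrightarrow>
      (x has_vector_derivative f (x t)) (at t) \<and> norm (x t - Y) \<le> norm Y / 2)"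
      using loc unfolding \<tau>_def by blast
    then obtain \<phi> where p: "\<forall>Y. \<phi> Y 0 = Y \<and> (\<forall>t. \<bar>t\<bar> \<le> \<tau> Y \<longrightarrow>
      (\<phi> Y has_vector_derivative f (\<phi> Y t)) (at t) \<and> norm (\<phi> Y t - Y) \<le> norm Y / 2)"
      by (rule choice[THEN exE])
    show thesis by (rule that[of \<phi>]; use p in blast)
  qed
  define Y where "Y = rec_nat X (\<lambda>_ Z. \<phi> Z (\<tau> Z))"
  have Y: "Y 0 = X" "Y (Suc n) = \<phi> (Y n) (\<tau> (Y n))" for n by (simp_all add: Y_def)
  define s where "s n = (\<Sum>k<n. \<tau> (Y k))" for n
  have s: "s 0 = 0" "s (Suc n) = s n + \<tau> (Y n)" for n by (simp_all add: s_def)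
  have s_less: "s n < s (Suc n)" for n using \<tau> s by simp
  have s_mono: "strict_mono s" using s_less by (rule strict_mono_Suc_iff[THEN iffD2, rule_format])
  have s_le: "s m \<le> s n" if "m \<le> n" for m n using s_mono that by (simp add: strict_mono_less_eq)
  define x where "x t = (let n = (LEAST n. t < s (Suc n)) in \<phi> (Y n) (t - s n))" for t
  have x_on: "x t = \<phi> (Y n) (t - s n)" if t: "s n \<le> t" "t \<le> s (Suc n)" for t n
  proof (cases "t < s (Suc n)")
    case True
    have "(LEAST n. t < s (Suc n)) = n"
    proof (rule Least_equality)
      fix m assume "t < s (Suc m)"
      then have "s n < s (Suc m)" using t by simp
      then show "n \<le> m" using s_mono by (simp add: strict_mono_less)
    qed (rule True)
    then show ?thesis by (simp add: x_def)
  next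
    case False
    then have t': "t = s (Suc n)" using t by simp
    have "(LEAST n. t < s (Suc n)) = Suc n"
    proof (rule Least_equality)
      fix m assume "t < s (Suc m)"
      then have "s (Suc n) < s (Suc m)" using t' by simp
      then show "Suc n \<le> m" using s_mono by (simp add: strict_mono_less)
    qed (use t' s_less in simp)
    then have "x t = Y (Suc n)" by (simp add: x_def t' \<phi>(1))
    then show ?thesis using t' by (simp add: Y(2) s(2))
  qed
  have x0: "x 0 = X" using x_on[of 0 0] s s_less[of 0] \<phi>(1) Y(1) by simp
  have piece: "(x has_vector_derivative f (x t)) (at t within {s n..s (Suc n)})"
    if t: "t \<in> {s n..s (Suc n)}" for t n
  proof (rule has_vector_derivative_transform[OF t])
    show "x u = \<phi> (Y n) (u - s n)" if "u \<in> {s n..s (Suc n)}" for u using x_on that by simp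
    have "(\<phi> (Y n) has_vector_derivative f (\<phi> (Y n) (t - s n))) (at (t - s n))"
      using t s(2)[of n] by (intro \<phi>(2)) auto
    then have "((\<phi> (Y n) \<circ> (\<lambda>u. u - s n)) has_vector_derivative (1 *\<^sub>R f (\<phi> (Y n) (t - s n)))) (at t)"
      by (intro vector_diff_chain_at) (auto intro!: derivative_eq_intros simp: has_real_derivative_iff_has_vector_derivative[symmetric])
    then show "((\<lambda>u. \<phi> (Y n) (u - s n)) has_vector_derivative f (x t)) (at t within {s n..s (Suc n)})"
      using x_on[of n t] t by (simp add: o_def has_vector_derivative_at_within)
  qed
  have upto: "\<forall>t\<in>{0..s n}. (x has_vector_derivative f (x t)) (at t within {0..s n})" if "n \<ge> 1" for n
    using that
  proof (induction n rule: dec_induct)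
    case base
    then show ?case using piece[of _ 0] s(1) by simp
  next
    case (step n)
    have s0: "0 \<le> s n" using s_le[of 0 n] s(1) by simp
    have un: "{0..s (Suc n)} = {0..s n} \<union> {s n..s (Suc n)}" using s0 s_less[of n] by auto
    show ?case
    proof
      fix t assume t: "t \<in> {0..s (Suc n)}"
      \<comment> \<open>If \<open>t\<close> lies outside a closed piece, the filter within that
        piece is trivial and the derivative holds vacuously. So the statements for both pieces are
        available at every \<open>t\<close> and can be united.\<close>
      have nl: "(x has_vector_derivative f (x t)) (at t within {0..s n})"
      proof (cases "t \<le> s n")
        case False
        then have "\<not> t islimpt {0..s n}"
          using closed_limpt[THEN iffD1, rule_format, OF closed_atLeastAtMost, of t] by force
        then have "at t within {0..s n} = bot" by (simp add: trivial_limit_within)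
        then show ?thesis by (simp add: has_vector_derivative_def has_derivative_def bounded_linear_scaleR_left)
      qed (use step.IH t in auto)
      have nr: "(x has_vector_derivative f (x t)) (at t within {s n..s (Suc n)})"
      proof (cases "s n \<le> t")
        case False
        then have "\<not> t islimpt {s n..s (Suc n)}"
          using closed_limpt[THEN iffD1, rule_format, OF closed_atLeastAtMost, of t] by force
        then have "at t within {s n..s (Suc n)} = bot" by (simp add: trivial_limit_within)
        then show ?thesis by (simp add: has_vector_derivative_def has_derivative_def bounded_linear_scaleR_left)
      qed (use piece t in auto)
      show "(x has_vector_derivative f (x t)) (at t within {0..s (Suc n)})"
        unfolding un by (rule has_vector_derivative_Un[OF nl nr])
    qed
  qed
  have deriv: "(x has_vector_derivative f (x t)) (at t within {0..})" if t: "0 \<le> t" "t < s n" for t n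
  proof -
    have "n \<ge> 1" using t s(1) by (cases n) auto
    then have "(x has_vector_derivative f (x t)) (at t within {0..s n})" using upto t by auto
    moreover have "at t within {0..s n} = at t within {0..}"
      by (rule at_within_nhd[of t "{..<s n}"]) (use t in auto)
    ultimately show ?thesis by simp
  qed
  show thesis
  proof (cases "\<forall>t. \<exists>n. t < s n")
    case True
    then show ?thesis using deriv by (intro global[of x, OF x0]) blast
  next
    case False
    then obtain B where B: "s n \<le> B" for n by (meson not_le)
    define T where "T = (SUP n. s n)"
    have bdd: "bdd_above (range s)" using B by (auto intro!: bdd_aboveI)
    have sT: "s n < T" for n
      using s_less[of n] cSUP_upper[OF _ bdd, of "Suc n"] unfolding T_def by simp
    have lim: "s \<longlonglongrightarrow> T" unfolding T_def
      by (rule LIMSEQ_incseq_SUP[OF bdd]) (use s_mono in \<open>simp add: strict_mono_mono\<close>)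
    have exn: "\<exists>n. t < s n" if "t < T" for t
      using less_cSUP_iff[OF _ bdd, of t] that unfolding T_def by auto
    have T0: "T > 0" using sT[of 0] s(1) by simp
    have "(\<lambda>n. s (Suc n) - s n) \<longlonglongrightarrow> T - T" using lim LIMSEQ_Suc[OF lim] by (intro tendsto_diff)
    then have \<tau>0: "(\<lambda>n. \<tau> (Y n)) \<longlonglongrightarrow> 0" using s(2) by simp
    have "filterlim x at_infinity (at_left T)"
      unfolding filterlim_at_infinity[OF order_refl]
    proof (intro allI impI)
      fix R :: real assume R: "R > 0"
      have "1 / (K * (2 * R + 1)) > 0" using K R by simp
      then have "eventually (\<lambda>n. \<tau> (Y n) < 1 / (K * (2 * R + 1))) sequentially"
        using \<tau>0 by (rule order_tendstoD(2)[rotated])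
      then obtain N where N: "\<And>n. n \<ge> N \<Longrightarrow> \<tau> (Y n) < 1 / (K * (2 * R + 1))"
        unfolding eventually_sequentially by blast
      \<comment> \<open>Short steps start at large values only. A step loses at most half the norm
        of its starting value, so \<open>2 * R\<close> at the start gives \<open>R\<close>
        throughout the step.\<close>
      have YR: "norm (Y n) \<ge> 2 * R" if "n \<ge> N" for n
      proof (rule ccontr)
        assume c: "\<not> norm (Y n) \<ge> 2 * R"
        have pos: "2 * R + 1 > 0" "norm (Y n) + 1 > 0" using R by (simp_all add: add_nonneg_pos)
        have "1 / (K * (2 * R + 1)) \<le> \<tau> (Y n)"
          unfolding \<tau>_def
          by (intro divide_left_mono mult_left_mono mult_pos_pos[OF K] pos mult_pos_pos)
             (use c K pos in auto)
        then show False using N[OF that] by simp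
      qed
      have "norm (x t) \<ge> R" if t: "s N < t" "t < T" for t
      proof -
        define n where "n = (LEAST n. t < s (Suc n))"
        obtain k where "t < s k" using exn t by blast
        then have "t < s (Suc k)" using s_less[of k] by simp
        then have n1: "t < s (Suc n)" unfolding n_def by (rule LeastI)
        then have "s N < s (Suc n)" using t by simp
        then have nN: "n \<ge> N" using s_mono by (simp add: strict_mono_less)
        have n2: "s n \<le> t"
        proof (rule ccontr)
          assume c: "\<not> s n \<le> t"
          then have "n \<noteq> N" using t by auto
          then obtain p where p: "n = Suc p" using nN by (cases n) auto
          then have "t < s (Suc p)" using c by simp
          then have "n \<le> p" unfolding n_def by (rule Least_le)
          then show False using p by simp
        qed
        have "x t = \<phi> (Y n) (t - s n)" using x_on n1 n2 by simp
        moreover have "norm (\<phi> (Y n) (t - s n) - Y n) \<le> norm (Y n) / 2"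
          using n1 n2 s(2)[of n] by (intro \<phi>(3)) auto
        ultimately have "norm (Y n) - norm (x t) \<le> norm (Y n) / 2"
          using norm_triangle_ineq2[of "Y n" "x t"] by (simp add: norm_minus_commute)
        then show ?thesis using YR[OF nN] by simp
      qed
      then show "eventually (\<lambda>t. R \<le> norm (x t)) (at_left T)"
        using sT[of N] by (intro eventually_at_leftI[of "s N"]) auto
    qed
    moreover have "(x has_vector_derivative f (x t)) (at t within {0..})" if "t \<in> {0..<T}" for t
      using that exn[of t] deriv by auto
    ultimately show ?thesis using finite[of x T] x0 T0 by blast
  qed
qed

subsection \<open>Reduction of the flow to one variable\<close>

text \<open>The off-diagonal products in the Leibniz expansion of the determinant. The two 3-cycles
  have product \<open>edge1 X * edge2 X * edge3 X\<close>, so the square of their difference is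
  \<open>F\<close> at s = 0.\<close>

definition edge1 :: "real^3^3 \<Rightarrow> real" where "edge1 X = X$2$3 * X$3$2"
definition edge2 :: "real^3^3 \<Rightarrow> real" where "edge2 X = X$3$1 * X$1$3"
definition edge3 :: "real^3^3 \<Rightarrow> real" where "edge3 X = X$1$2 * X$2$1"
definition cycle_fwd :: "real^3^3 \<Rightarrow> real" where "cycle_fwd X = X$1$2 * X$2$3 * X$3$1"
definition cycle_bwd :: "real^3^3 \<Rightarrow> real" where "cycle_bwd X = X$1$3 * X$3$2 * X$2$1"

lemmas entry_defs = edge1_def edge2_def edge3_def cycle_fwd_def cycle_bwd_def

text \<open>Along the flow the products \<open>x\<^sub>i\<^sub>j x\<^sub>j\<^sub>i\<close> move on a line, and the squared speed is a cubic
  polynomial in the position.\<close>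

lemma flow_reduction:
  fixes A :: "real^3^3" and x :: "real \<Rightarrow> real^3^3" and \<eta> :: real
  assumes diag: "\<And>i j. i \<noteq> j \<Longrightarrow> A$i$j = 0" and J: "convex J" "0 \<in> J"
    and x: "\<And>t. t \<in> J \<Longrightarrow> (x has_vector_derivative flow_field A (x t)) (at t within J)"
    and \<eta>: "\<eta> * \<eta> = 1"
    and b: "b1 = \<eta> * (A$3$3 - A$2$2)" "b2 = \<eta> * (A$1$1 - A$3$3)" "b3 = \<eta> * (A$2$2 - A$1$1)"
    and b1: "b1 \<noteq> 0" and \<beta>: "\<beta> = b1 * x 0$1$1 + b2 * x 0$2$2 + b3 * x 0$3$3"
    and u: "u1 = edge1 (x 0)" "u2 = edge2 (x 0)" "u3 = edge3 (x 0)"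
    and r: "r = cycle_fwd (x 0) + cycle_bwd (x 0)"
  obtains s y where "s 0 = 0"
    "\<And>t. t \<in> J \<Longrightarrow> (s has_real_derivative y t) (at t within J)"
    "\<And>t. t \<in> J \<Longrightarrow> (y has_real_derivative \<beta> * (r + \<beta> * s t) - 2 * (b1 * (u2 + b2 * s t) * (u3 + b3 * s t)
        + b2 * (u1 + b1 * s t) * (u3 + b3 * s t) + b3 * (u1 + b1 * s t) * (u2 + b2 * s t))) (at t within J)"
    "\<And>t. t \<in> J \<Longrightarrow> (y t)\<^sup>2 = (r + \<beta> * s t)\<^sup>2 - 4 * (u1 + b1 * s t) * (u2 + b2 * s t) * (u3 + b3 * s t)"
    "\<And>t. t \<in> J \<Longrightarrow> edge1 (x t) = u1 + b1 * s t" "\<And>t. t \<in> J \<Longrightarrow> edge2 (x t) = u2 + b2 * s t"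
    "\<And>t. t \<in> J \<Longrightarrow> edge3 (x t) = u3 + b3 * s t" "\<And>t i. t \<in> J \<Longrightarrow> x t $ i $ i = x 0 $ i $ i"
proof -
  have d: "((\<lambda>t. x t $ i $ j) has_real_derivative (A$j$j - A$i$i) *
      (x t$i$1 * x t$1$j + x t$i$2 * x t$2$j + x t$i$3 * x t$3$j)) (at t within J)" if "t \<in> J" for t i j
  proof -
    have "((\<lambda>t. x t $ i $ j) has_real_derivative flow_field A (x t) $ i $ j) (at t within J)"
      using x[OF that] unfolding has_vector_derivative_entries by blast
    moreover have "flow_field A (x t) $ i $ j = (A$j$j - A$i$i) *
      (x t$i$1 * x t$1$j + x t$i$2 * x t$2$j + x t$i$3 * x t$3$j)"
      using flow_field_nth[OF diag, of "x t" i j] unfolding sum_3 .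
    ultimately show ?thesis by (simp only:)
  qed
  have const: "\<exists>c. \<forall>t\<in>J. f t = c" if "\<And>t. t \<in> J \<Longrightarrow> (f has_real_derivative 0) (at t within J)" for f :: "real \<Rightarrow> real"
    using has_field_derivative_zero_constant[OF J(1) that] by blast
  have dconst: "x t $ i $ i = x 0 $ i $ i" if "t \<in> J" for t i
  proof -
    have "\<exists>c. \<forall>t\<in>J. x t $ i $ i = c" by (rule const) (use d[of _ i i] in simp)
    then show ?thesis using that J(2) by metis
  qed
  \<comment> \<open>The difference of the 3-cycles is the common velocity factor of the edge
    products. Its square, sum squared minus four times the product, is \<open>F\<close>.\<close>
  define y where "y t = \<eta> * (cycle_bwd (x t) - cycle_fwd (x t))" for t
  define s where "s t = (edge1 (x t) - u1) / b1" for t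
  have ey: "b1 * y t = (A$3$3 - A$2$2) * (cycle_bwd (x t) - cycle_fwd (x t))"
    "b2 * y t = (A$1$1 - A$3$3) * (cycle_bwd (x t) - cycle_fwd (x t))"
    "b3 * y t = (A$2$2 - A$1$1) * (cycle_bwd (x t) - cycle_fwd (x t))" for t
  proof -
    have "\<eta> * c * (\<eta> * e) = c * e" for c e
    proof -
      have "\<eta> * c * (\<eta> * e) = (\<eta> * \<eta>) * (c * e)" by (simp only: ac_simps)
      then show ?thesis by (simp add: \<eta>)
    qed
    then show "b1 * y t = (A$3$3 - A$2$2) * (cycle_bwd (x t) - cycle_fwd (x t))"
      "b2 * y t = (A$1$1 - A$3$3) * (cycle_bwd (x t) - cycle_fwd (x t))"
      "b3 * y t = (A$2$2 - A$1$1) * (cycle_bwd (x t) - cycle_fwd (x t))"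
      unfolding y_def b by blast+
  qed
  have e1: "((\<lambda>t. edge1 (x t)) has_real_derivative b1 * y t) (at t within J)" if "t \<in> J" for t
    unfolding entry_defs ey
    by (rule DERIV_cong[OF DERIV_mult[OF d[OF that] d[OF that]]]) (simp add: algebra_simps)
  have e2: "((\<lambda>t. edge2 (x t)) has_real_derivative b2 * y t) (at t within J)" if "t \<in> J" for t
    unfolding entry_defs ey
    by (rule DERIV_cong[OF DERIV_mult[OF d[OF that] d[OF that]]]) (simp add: algebra_simps)
  have e3: "((\<lambda>t. edge3 (x t)) has_real_derivative b3 * y t) (at t within J)" if "t \<in> J" for t
    unfolding entry_defs ey
    by (rule DERIV_cong[OF DERIV_mult[OF d[OF that] d[OF that]]]) (simp add: algebra_simps)
  let ?B = "\<lambda>t. (A$3$3 - A$2$2) * x t$1$1 + (A$1$1 - A$3$3) * x t$2$2 + (A$2$2 - A$1$1) * x t$3$3"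
  let ?E = "\<lambda>t. (A$3$3 - A$2$2) * edge2 (x t) * edge3 (x t) + (A$1$1 - A$3$3) * edge1 (x t) * edge3 (x t)
    + (A$2$2 - A$1$1) * edge1 (x t) * edge2 (x t)"
  have cf: "((\<lambda>t. cycle_fwd (x t)) has_real_derivative - ?B t * cycle_fwd (x t) + ?E t) (at t within J)" if "t \<in> J" for t
    unfolding entry_defs
    by (rule DERIV_cong[OF DERIV_mult[OF DERIV_mult[OF d[OF that] d[OF that]] d[OF that]]]) (simp add: algebra_simps)
  have cb: "((\<lambda>t. cycle_bwd (x t)) has_real_derivative ?B t * cycle_bwd (x t) - ?E t) (at t within J)" if "t \<in> J" for t
    unfolding entry_defs
    by (rule DERIV_cong[OF DERIV_mult[OF DERIV_mult[OF d[OF that] d[OF that]] d[OF that]]]) (simp add: algebra_simps)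
  have \<beta>B: "\<beta> = \<eta> * ?B t" if "t \<in> J" for t
    unfolding \<beta> b dconst[OF that] by (simp add: algebra_simps)
  have sd: "(s has_real_derivative y t) (at t within J)" if "t \<in> J" for t
  proof -
    have "((\<lambda>t. (edge1 (x t) - u1) / b1) has_real_derivative (b1 * y t - 0) / b1) (at t within J)"
      by (intro DERIV_cdivide DERIV_diff e1 that) simp
    then show ?thesis unfolding s_def using b1 by simp
  qed
  have s0: "s 0 = 0" by (simp add: s_def u)
  have E1: "edge1 (x t) = u1 + b1 * s t" for t using b1 by (simp add: s_def)
  \<comment> \<open>Whatever has velocity proportional to \<open>y\<close> is affine in
    \<open>s\<close>; this yields the line on which the products and the sum of the cycles
    move.\<close>
  have lin: "g t = g 0 + c * s t" if "\<And>t. t \<in> J \<Longrightarrow> (g has_real_derivative c * y t) (at t within J)" "t \<in> J" for g c t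
  proof -
    have "\<exists>k. \<forall>t\<in>J. g t - c * s t = k"
    proof (rule const)
      fix t assume t: "t \<in> J"
      show "((\<lambda>t. g t - c * s t) has_real_derivative 0) (at t within J)"
        by (rule DERIV_cong[OF DERIV_diff[OF that(1)[OF t] DERIV_cmult[OF sd[OF t]]]]) simp
    qed
    then have "g t - c * s t = g 0 - c * s 0" using that(2) J(2) by metis
    then show ?thesis using s0 by simp
  qed
  have E2: "edge2 (x t) = u2 + b2 * s t" if "t \<in> J" for t
    unfolding u using lin[of "\<lambda>t. edge2 (x t)" b2 t] e2 that by blast
  have E3: "edge3 (x t) = u3 + b3 * s t" if "t \<in> J" for t
    unfolding u using lin[of "\<lambda>t. edge3 (x t)" b3 t] e3 that by blast
  have R: "cycle_fwd (x t) + cycle_bwd (x t) = r + \<beta> * s t" if t: "t \<in> J" for t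
    unfolding r
  proof (rule lin[of "\<lambda>t. cycle_fwd (x t) + cycle_bwd (x t)" \<beta> t, OF _ t])
    fix t assume t: "t \<in> J"
    have "\<beta> * y t = (\<eta> * \<eta>) * (?B t * (cycle_bwd (x t) - cycle_fwd (x t)))"
      unfolding \<beta>B[OF t] y_def by (simp only: ac_simps)
    then show "((\<lambda>t. cycle_fwd (x t) + cycle_bwd (x t)) has_real_derivative \<beta> * y t) (at t within J)"
      unfolding \<eta> by (intro DERIV_cong[OF DERIV_add[OF cf[OF t] cb[OF t]]]) (simp add: algebra_simps)
  qed
  have yd: "(y has_real_derivative \<beta> * (r + \<beta> * s t) - 2 * (b1 * (u2 + b2 * s t) * (u3 + b3 * s t)
        + b2 * (u1 + b1 * s t) * (u3 + b3 * s t) + b3 * (u1 + b1 * s t) * (u2 + b2 * s t))) (at t within J)" if t: "t \<in> J" for t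
  proof -
    have "(y has_real_derivative \<eta> * ((?B t * cycle_bwd (x t) - ?E t) - (- ?B t * cycle_fwd (x t) + ?E t))) (at t within J)"
      unfolding y_def by (intro DERIV_cmult DERIV_diff cf cb t)
    moreover have "\<eta> * ((?B t * cycle_bwd (x t) - ?E t) - (- ?B t * cycle_fwd (x t) + ?E t))
        = (\<eta> * ?B t) * (cycle_fwd (x t) + cycle_bwd (x t)) - 2 * (\<eta> * ?E t)"
      by (simp add: algebra_simps)
    moreover have "\<eta> * ?E t = b1 * edge2 (x t) * edge3 (x t) + b2 * edge1 (x t) * edge3 (x t) + b3 * edge1 (x t) * edge2 (x t)"
      unfolding b by (simp add: algebra_simps)
    ultimately show ?thesis unfolding \<beta>B[OF t, symmetric] R[OF t] E1 E2[OF t] E3[OF t] by simp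
  qed
  have y2: "(y t)\<^sup>2 = (r + \<beta> * s t)\<^sup>2 - 4 * (u1 + b1 * s t) * (u2 + b2 * s t) * (u3 + b3 * s t)" if t: "t \<in> J" for t
  proof -
    have "(y t)\<^sup>2 = (\<eta> * \<eta>) * (cycle_bwd (x t) - cycle_fwd (x t))\<^sup>2" unfolding y_def by (simp add: power2_eq_square)
    also have "\<dots> = (cycle_fwd (x t) + cycle_bwd (x t))\<^sup>2 - 4 * edge1 (x t) * edge2 (x t) * edge3 (x t)"
      unfolding \<eta> entry_defs by (simp add: algebra_simps power2_eq_square)
    finally show ?thesis unfolding R[OF t] E1 E2[OF t] E3[OF t] .
  qed
  show thesis by (rule that[of s y]) (assumption | rule s0 sd yd y2 E1 E2 E3 dconst)+
qed

section \<open>One-dimensional motion on the unbounded component\<close>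

lemma DERIV_lower_bound:
  fixes f :: "real \<Rightarrow> real"
  assumes "a \<le> b" "\<And>t. t \<in> {a..b} \<Longrightarrow> (f has_real_derivative f' t) (at t within S)" "{a..b} \<subseteq> S"
    "\<And>t. a < t \<Longrightarrow> t < b \<Longrightarrow> c \<le> f' t"
  shows "f a + c * (b - a) \<le> f b"
proof (cases "a = b")
  case False
  then have "a < b" using assms(1) by simp
  then obtain t where t: "t \<in> {a<..<b}" "f b - f a = f' t * (b - a)"
    using mvt_simple[of a b f "\<lambda>t. (*) (f' t)"] assms(2)
    unfolding has_field_derivative_def[symmetric]
    by (metis DERIV_subset assms(3) atLeastAtMost_iff)
  then have "c * (b - a) \<le> f' t * (b - a)" using assms(1,4) by (intro mult_right_mono) auto
  then show ?thesis using t(2) by simp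
qed simp

text \<open>For k1 < 0, positivity at the vertex \<open>- k1 / (2 * k2)\<close> means a negative
  discriminant. Completing the square in v gives the constant bound, and in 1/v the quadratic
  one.\<close>

lemma positive_quadratic_lower_bounds:
  fixes k0 k1 k2 :: real
  assumes k2: "k2 > 0" and K: "\<And>v. v \<ge> 0 \<Longrightarrow> k2 * v\<^sup>2 + k1 * v + k0 > 0"
  obtains c \<kappa> where "c > 0" "\<kappa> > 0" "\<And>v. v \<ge> 0 \<Longrightarrow> k2 * v\<^sup>2 + k1 * v + k0 \<ge> c * v\<^sup>2"
    "\<And>v. v \<ge> 0 \<Longrightarrow> k2 * v\<^sup>2 + k1 * v + k0 \<ge> \<kappa>"
proof (cases "k1 \<ge> 0")
  case True
  have k0: "k0 > 0" using K[of 0] by simp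
  show thesis
    by (rule that[of k2 k0]) (use True k0 k2 in auto)
next
  case False
  have k0: "k0 > 0" using K[of 0] by simp
  have "k2 * (- k1 / (2 * k2))\<^sup>2 + k1 * (- k1 / (2 * k2)) + k0 > 0"
    using False k2 by (intro K) (simp add: divide_nonpos_pos)
  moreover have "k2 * (- k1 / (2 * k2))\<^sup>2 + k1 * (- k1 / (2 * k2)) + k0 = k0 - k1\<^sup>2 / (4 * k2)"
    using k2 by (simp add: field_simps power2_eq_square)
  ultimately have D: "k0 - k1\<^sup>2 / (4 * k2) > 0" by simp
  then have "k1\<^sup>2 < 4 * k2 * k0" using k2 by (simp add: field_simps)
  then have c: "k2 - k1\<^sup>2 / (4 * k0) > 0" using k0 by (simp add: field_simps)
  show thesis
  proof (rule that[OF c D])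
    fix v :: real
    have "k2 * v\<^sup>2 + k1 * v + k0 - (k2 - k1\<^sup>2 / (4 * k0)) * v\<^sup>2 = k0 * (1 + k1 * v / (2 * k0))\<^sup>2"
      using k0 by (simp add: field_simps power2_eq_square)
    moreover have "\<dots> \<ge> 0" using k0 by simp
    ultimately show "k2 * v\<^sup>2 + k1 * v + k0 \<ge> (k2 - k1\<^sup>2 / (4 * k0)) * v\<^sup>2" by linarith
    have "k2 * v\<^sup>2 + k1 * v + k0 - (k0 - k1\<^sup>2 / (4 * k2)) = k2 * (v + k1 / (2 * k2))\<^sup>2"
      using k2 by (simp add: field_simps power2_eq_square)
    moreover have "\<dots> \<ge> 0" using k2 by simp
    ultimately show "k2 * v\<^sup>2 + k1 * v + k0 \<ge> k0 - k1\<^sup>2 / (4 * k2)" by linarith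
  qed
qed

text \<open>The equation \<open>v'\<^sup>2 = G(v)\<close> on the unbounded component \<open>v \<ge> 0\<close> of \<open>G \<ge> 0\<close>: the velocity
  becomes positive in finite time, since \<open>v' - \<lambda> v\<close> grows at least linearly before, and from then
  on \<open>1 / sqrt v\<close> decreases at least linearly.\<close>

lemma unbounded_component_no_global_solution:
  fixes v y :: "real \<Rightarrow> real"
  assumes v: "\<And>t. t \<ge> 0 \<Longrightarrow> (v has_real_derivative y t) (at t within {0..})"
    and y: "\<And>t. t \<ge> 0 \<Longrightarrow> (y has_real_derivative (3 * k2 * (v t)\<^sup>2 + 2 * k1 * v t + k0) / 2) (at t within {0..})"
    and G: "\<And>t. t \<ge> 0 \<Longrightarrow> (y t)\<^sup>2 = v t * (k2 * (v t)\<^sup>2 + k1 * v t + k0)"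
    and v0: "\<And>t. t \<ge> 0 \<Longrightarrow> v t \<ge> 0"
    and k2: "k2 > 0" and K: "\<And>v. v \<ge> 0 \<Longrightarrow> k2 * v\<^sup>2 + k1 * v + k0 > 0"
  shows False
proof -
  obtain c \<kappa> where c: "c > 0" "\<And>v. v \<ge> 0 \<Longrightarrow> k2 * v\<^sup>2 + k1 * v + k0 \<ge> c * v\<^sup>2"
    and \<kappa>: "\<kappa> > 0" "\<And>v. v \<ge> 0 \<Longrightarrow> k2 * v\<^sup>2 + k1 * v + k0 \<ge> \<kappa>"
    using positive_quadratic_lower_bounds[OF k2 K] by metis
  have k0: "k0 > 0" using K[of 0] by simp
  have "\<exists>t\<ge>0. y t > 0"
  proof (rule ccontr)
    assume "\<not> (\<exists>t\<ge>0. y t > 0)"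
    then have yneg: "y t \<le> 0" if "t \<ge> 0" for t using that by (meson not_le)
    have vle: "v t \<le> v 0" if "t \<ge> 0" for t
    proof -
      have "- v 0 + 0 * (t - 0) \<le> - v t"
        by (rule DERIV_lower_bound[where f' = "\<lambda>t. - y t" and S = "{0..}"])
           (use that v yneg in \<open>auto intro!: DERIV_minus\<close>)
      then show ?thesis by simp
    qed
    \<comment> \<open>For \<open>v t \<le> \<delta>\<close> the acceleration alone is at least
      \<open>k0 / 4\<close>. Beyond \<delta> the speed is at least
      \<open>sqrt (\<delta> * \<kappa>)\<close>, and \<open>l\<close> is so large that
      \<open>- l * y t\<close> outweighs a negative \<open>k1 * v t\<close>.\<close>
    define \<delta> where "\<delta> = k0 / (4 * (\<bar>k1\<bar> + 1))"
    have \<delta>: "\<delta> > 0" "2 * \<bar>k1\<bar> * \<delta> \<le> k0 / 2" using k0 by (simp_all add: \<delta>_def field_simps)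
    define l where "l = (\<bar>k1\<bar> * v 0 + k0) / sqrt (\<delta> * \<kappa>)"
    have sq: "sqrt (\<delta> * \<kappa>) > 0" using \<delta>(1) \<kappa>(1) by simp
    have l0: "l \<ge> 0" unfolding l_def using sq v0[of 0] k0 by simp
    have k1b: "k1 * v t \<ge> - (\<bar>k1\<bar> * v t)" if "t \<ge> 0" for t
      using mult_right_mono[OF abs_ge_minus_self[of k1] v0[OF that]] by simp
    have lower: "(3 * k2 * (v t)\<^sup>2 + 2 * k1 * v t + k0) / 2 - l * y t \<ge> k0 / 4" if t: "t \<ge> 0" for t
    proof -
      have e: "(3 * k2 * (v t)\<^sup>2 + 2 * k1 * v t + k0) / 2 = (3 * k2 * (v t)\<^sup>2) / 2 + k1 * v t + k0 / 2"
        by (simp add: add_divide_distrib)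
      show ?thesis
    proof (cases "v t \<le> \<delta>")
      case True
      have "\<bar>k1\<bar> * v t \<le> \<bar>k1\<bar> * \<delta>" using True by (intro mult_left_mono) auto
      moreover have "3 * k2 * (v t)\<^sup>2 \<ge> 0" using k2 by simp
      moreover have "- (l * y t) \<ge> 0" using l0 yneg[OF t] by (simp add: mult_nonneg_nonpos)
      ultimately show ?thesis using k1b[OF t] \<delta>(2) unfolding e by linarith
    next
      case False
      have "(sqrt (\<delta> * \<kappa>))\<^sup>2 \<le> (- y t)\<^sup>2"
      proof -
        have "\<delta> * \<kappa> \<le> v t * (k2 * (v t)\<^sup>2 + k1 * v t + k0)"
          using False \<kappa>(2)[OF v0[OF t]] \<delta>(1) \<kappa>(1) v0[OF t] by (intro mult_mono) auto
        then show ?thesis using G[OF t] \<delta>(1) \<kappa>(1) by simp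
      qed
      then have "sqrt (\<delta> * \<kappa>) \<le> - y t" by (rule power2_le_imp_le) (use yneg[OF t] in simp)
      then have "l * sqrt (\<delta> * \<kappa>) \<le> l * (- y t)" using l0 by (rule mult_left_mono)
      moreover have "l * sqrt (\<delta> * \<kappa>) = \<bar>k1\<bar> * v 0 + k0"
      proof -
        have "a / q * q = a" if "q > 0" for a q :: real using that by simp
        then show ?thesis unfolding l_def using sq by blast
      qed
      moreover have "\<bar>k1\<bar> * v t \<le> \<bar>k1\<bar> * v 0" using vle[OF t] by (intro mult_left_mono) auto
      moreover have "3 * k2 * (v t)\<^sup>2 \<ge> 0" using k2 by simp
      ultimately show ?thesis using k1b[OF t] k0 unfolding e by linarith
    qed
    qed
    have grow: "(y 0 - l * v 0) + k0 / 4 * (t - 0) \<le> y t - l * v t" if "t \<ge> 0" for t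
    proof (rule DERIV_lower_bound[where S = "{0..}"])
      show "((\<lambda>t. y t - l * v t) has_real_derivative (3 * k2 * (v u)\<^sup>2 + 2 * k1 * v u + k0) / 2 - l * y u) (at u within {0..})"
        if "u \<in> {0..t}" for u using that by (intro DERIV_diff DERIV_cmult v y) auto
    qed (use that lower in auto)
    \<comment> \<open>The time at which the lower bound for \<open>y - l * v\<close> reaches 1,
      although y \<le> 0 \<le> l * v.\<close>
    define t where "t = (l * v 0 - y 0 + 1) * 4 / k0"
    have "(l * v 0 - y 0 + 1) * 4 \<ge> 0" using mult_nonneg_nonneg[OF l0 v0[of 0]] yneg[of 0] by simp
    then have t0: "t \<ge> 0" unfolding t_def using k0 by (rule divide_nonneg_pos)
    have "k0 / 4 * t = l * v 0 - y 0 + 1" unfolding t_def using k0 by simp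
    then have "y t - l * v t \<ge> 1" using grow[OF t0] by (simp only: diff_zero)
    moreover have "l * v t \<ge> 0" using l0 v0[OF t0] by simp
    ultimately show False using yneg[OF t0] by linarith
  qed
  then obtain t0 where t0: "t0 \<ge> 0" "y t0 > 0" by blast
  have vt0: "v t0 > 0"
  proof -
    have "v t0 \<noteq> 0" using G[OF t0(1)] t0(2) by auto
    then show ?thesis using v0[OF t0(1)] by simp
  qed
  have cont_y: "continuous_on {a..b} y" if "a \<ge> 0" for a b
    by (rule continuous_on_subset[of "{0..}"])
       (use that y in \<open>auto simp: continuous_on_eq_continuous_within intro!: DERIV_continuous\<close>)
  have ypos: "y t > 0" if t: "t \<ge> t0" for t
  proof (rule ccontr)
    assume yt: "\<not> y t > 0"
    have "\<exists>u\<ge>t0. u \<le> t \<and> y u = 0"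
      by (rule IVT2'[OF _ _ t]) (use yt t0 cont_y in auto)
    \<comment> \<open>At the first zero of the velocity after \<open>t0\<close>, \<open>v\<close>
      has not decreased and is still positive, so y^2 = G(v) > 0 there, a contradiction.\<close>
    define Z where "Z = {t0..t} \<inter> y -` {0}"
    have "closed Z" unfolding Z_def by (rule continuous_closed_preimage) (use cont_y t0 in auto)
    moreover have "bounded Z" by (rule bounded_subset[of "{t0..t}"]) (auto simp: Z_def)
    moreover have "Z \<noteq> {}" using \<open>\<exists>u\<ge>t0. u \<le> t \<and> y u = 0\<close> by (auto simp: Z_def)
    ultimately obtain z where z: "z \<in> Z" "\<And>u. u \<in> Z \<Longrightarrow> z \<le> u"
      using compact_attains_inf[of Z] by (auto simp: compact_eq_bounded_closed)
    have before: "y u > 0" if u: "t0 < u" "u < z" for u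
    proof (rule ccontr)
      assume "\<not> y u > 0"
      then have "\<exists>w\<ge>t0. w \<le> u \<and> y w = 0"
        by (intro IVT2') (use u t0 cont_y in auto)
      then obtain w where "t0 \<le> w" "w \<le> u" "y w = 0" by blast
      then show False using z u by (force simp: Z_def)
    qed
    have "v t0 + 0 * (z - t0) \<le> v z"
      by (rule DERIV_lower_bound[where f' = y and S = "{0..}"])
         (use z(1) t0 v before in \<open>auto simp: Z_def less_imp_le\<close>)
    then have vz: "v z > 0" using vt0 by simp
    have "z \<ge> 0" "y z = 0" using z(1) t0 by (auto simp: Z_def)
    then show False using G[of z] K[of "v z"] vz by simp
  qed
  have vpos: "v t > 0" if "t \<ge> t0" for t
  proof -
    have "v t0 + 0 * (t - t0) \<le> v t"
      by (rule DERIV_lower_bound[where f' = y and S = "{0..}"])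
         (use that t0 v ypos in \<open>auto simp: less_imp_le\<close>)
    then show ?thesis using vt0 by simp
  qed
  have speed: "sqrt c * (v t * sqrt (v t)) \<le> y t" if t: "t \<ge> t0" for t
  proof (rule power2_le_imp_le)
    have t': "t \<ge> 0" using t t0 by simp
    have "(sqrt c * (v t * sqrt (v t)))\<^sup>2 = v t * (c * (v t)\<^sup>2)"
      using c(1) vpos[OF t] by (simp add: power_mult_distrib ac_simps)
    also have "\<dots> \<le> (y t)\<^sup>2" unfolding G[OF t'] using c(2)[of "v t"] vpos[OF t] by (intro mult_left_mono) auto
    finally show "(sqrt c * (v t * sqrt (v t)))\<^sup>2 \<le> (y t)\<^sup>2" .
  qed (use ypos[OF t] in simp)
  have "- (1 / sqrt (v t0)) + sqrt c / 2 * (t - t0) \<le> - (1 / sqrt (v t))" if t: "t \<ge> t0" for t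
  proof (rule DERIV_lower_bound[where S = "{0..}"])
    show "((\<lambda>t. - (1 / sqrt (v t))) has_real_derivative y u / (2 * (v u * sqrt (v u)))) (at u within {0..})"
      if u: "u \<in> {t0..t}" for u
    proof -
      have "v u > 0" "u \<ge> 0" using vpos[of u] u t0 by auto
      then show ?thesis
        by (auto intro!: derivative_eq_intros v simp: field_simps power2_eq_square)
    qed
    show "sqrt c / 2 \<le> y u / (2 * (v u * sqrt (v u)))" if u: "t0 < u" "u < t" for u
    proof -
      have "v u * sqrt (v u) > 0" using vpos[of u] u by simp
      then show ?thesis using speed[of u] u by (simp add: field_simps)
    qed
  qed (use t t0 in auto)
  note decay = this
  \<comment> \<open>The time by which \<open>1 / sqrt (v t)\<close> would have decreased to
    0.\<close>
  define t where "t = t0 + 2 / (sqrt c * sqrt (v t0))"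
  have sc: "sqrt c > 0" "sqrt (v t0) > 0" using c(1) vt0 by simp_all
  have tt: "t \<ge> t0" unfolding t_def using sc by simp
  have "sqrt c / 2 * (t - t0) = 1 / sqrt (v t0)" unfolding t_def using sc by simp
  then have "0 \<le> - (1 / sqrt (v t))" using decay[OF tt] by simp
  moreover have "1 / sqrt (v t) > 0" using vpos[OF tt] by simp
  ultimately show False by simp
qed

section \<open>Bounds for solutions on the bounded component\<close>

text \<open>Gronwall's argument for \<open>g\<^sup>2 + w\<^sup>2\<close>: its derivative is at most
  \<open>4 * M\<close> times itself, with \<open>2 * M\<close> from the diagonal terms and
  \<open>2 * M\<close> from the mixed ones.\<close>

lemma linear_system_bound:
  fixes g w :: "real \<Rightarrow> real"
  assumes g: "\<And>t. t \<in> {0..<T} \<Longrightarrow> (g has_real_derivative a11 t * g t + a12 t * w t) (at t within {0..<T})"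
    and w: "\<And>t. t \<in> {0..<T} \<Longrightarrow> (w has_real_derivative a21 t * g t + a22 t * w t) (at t within {0..<T})"
    and M: "\<And>t. t \<in> {0..<T} \<Longrightarrow> \<bar>a11 t\<bar> \<le> M \<and> \<bar>a12 t\<bar> \<le> M \<and> \<bar>a21 t\<bar> \<le> M \<and> \<bar>a22 t\<bar> \<le> M"
    and t: "t \<in> {0..<T}"
  shows "(g t)\<^sup>2 \<le> ((g 0)\<^sup>2 + (w 0)\<^sup>2) * exp (4 * M * T)"
proof -
  have M0: "M \<ge> 0" using M[OF t] by linarith
  define \<phi> where "\<phi> t = (g t)\<^sup>2 + (w t)\<^sup>2" for t
  define d where "d t = 2 * g t * (a11 t * g t + a12 t * w t) + 2 * w t * (a21 t * g t + a22 t * w t)" for t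
  have d: "d u \<le> 4 * M * \<phi> u" if u: "u \<in> {0..<T}" for u
  proof -
    have "a11 u * (g u)\<^sup>2 \<le> M * (g u)\<^sup>2" "a22 u * (w u)\<^sup>2 \<le> M * (w u)\<^sup>2"
      using M[OF u] by (intro mult_right_mono; auto)+
    moreover have "\<bar>(a12 u + a21 u) * (2 * (g u * w u))\<bar> \<le> (2 * M) * ((g u)\<^sup>2 + (w u)\<^sup>2)"
      unfolding abs_mult[of "a12 u + a21 u"]
    proof (rule mult_mono)
      show "\<bar>a12 u + a21 u\<bar> \<le> 2 * M" using M[OF u] by linarith
      show "\<bar>2 * (g u * w u)\<bar> \<le> (g u)\<^sup>2 + (w u)\<^sup>2"
        using zero_le_power2[of "g u - w u"] zero_le_power2[of "g u + w u"]
        by (simp add: abs_le_iff power2_eq_square algebra_simps)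
    qed (use M0 in auto)
    moreover have "d u = 2 * (a11 u * (g u)\<^sup>2) + 2 * (a22 u * (w u)\<^sup>2) + (a12 u + a21 u) * (2 * (g u * w u))"
      unfolding d_def by (simp add: algebra_simps power2_eq_square)
    ultimately show ?thesis unfolding \<phi>_def by (simp add: algebra_simps)
  qed
  have "- (\<phi> 0 * exp (- (4 * M) * 0)) + 0 * (t - 0) \<le> - (\<phi> t * exp (- (4 * M) * t))"
  proof (rule DERIV_lower_bound[where S = "{0..<T}"])
    show "((\<lambda>t. - (\<phi> t * exp (- (4 * M) * t))) has_real_derivative
        - (d u - 4 * M * \<phi> u) * exp (- (4 * M) * u)) (at u within {0..<T})" if "u \<in> {0..t}" for u
    proof -
      have u: "u \<in> {0..<T}" using that t by auto
      show ?thesis unfolding \<phi>_def d_def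
        by (rule derivative_eq_intros g[OF u] w[OF u] refl)+ (simp add: algebra_simps)
    qed
    show "0 \<le> - (d u - 4 * M * \<phi> u) * exp (- (4 * M) * u)" if "0 < u" "u < t" for u
      using d[of u] that t by (intro mult_nonneg_nonneg) auto
  qed (use t in auto)
  then have "\<phi> t * exp (- (4 * M) * t) \<le> \<phi> 0" by simp
  then have "\<phi> t * exp (- (4 * M) * t) * exp (4 * M * t) \<le> \<phi> 0 * exp (4 * M * t)" by (intro mult_right_mono) auto
  moreover have "\<phi> t * exp (- (4 * M) * t) * exp (4 * M * t) = \<phi> t" by (simp add: mult.assoc exp_add[symmetric])
  moreover have "\<phi> 0 * exp (4 * M * t) \<le> \<phi> 0 * exp (4 * M * T)"
    using t M0 by (intro mult_left_mono) (auto simp: \<phi>_def intro!: mult_left_mono)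
  moreover have "(g t)\<^sup>2 \<le> \<phi> t" by (simp add: \<phi>_def)
  ultimately show ?thesis unfolding \<phi>_def[of 0] by linarith
qed

text \<open>To fall below \<open>b\<close>, \<open>s\<close> would have to take all values just
  below it. The forbidden values are only asked to accumulate at \<open>b\<close>, because F < 0 may
  be known only close to that end of the gap.\<close>

lemma level_stays_above:
  fixes s y :: "real \<Rightarrow> real"
  assumes J: "is_interval J" "0 \<in> J" and s: "\<And>t. t \<in> J \<Longrightarrow> (s has_real_derivative y t) (at t within J)"
    and gap: "\<And>c. a < c \<Longrightarrow> c < b \<Longrightarrow> \<exists>m. c \<le> m \<and> m < b \<and> (\<forall>t\<in>J. s t \<noteq> m)" and "a < b"
    and s0: "s 0 \<ge> b" and t: "t \<in> J"
  shows "s t \<ge> b"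
proof (rule ccontr)
  assume "\<not> s t \<ge> b"
  then obtain c where c: "max a (s t) < c" "c < b" using dense[of "max a (s t)" b] \<open>a < b\<close> by auto
  then obtain m where m: "c \<le> m" "m < b" "\<And>t. t \<in> J \<Longrightarrow> s t \<noteq> m" using gap[of c] by auto
  have "continuous_on J s"
    using s by (auto simp: continuous_on_eq_continuous_within intro!: DERIV_continuous)
  moreover have "connected J" using J(1) by (simp add: is_interval_connected)
  ultimately have "connected (s ` J)" by (rule connected_continuous_image)
  then have "m \<in> s ` J"
    by (rule connectedD_interval[of _ "s t" "s 0"]) (use t J c m s0 in auto)
  then show False using m(3) by blast
qed

lemma sum_distinct_3:
  fixes i j k :: 3
  assumes "i \<noteq> j" "j \<noteq> k" "i \<noteq> k"
  shows "sum f UNIV = f i + f j + f k"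
proof -
  have "{i, j, k} = UNIV" by (rule card_subset_eq) (use assms in auto)
  then have "sum f UNIV = sum f {i, j, k}" by simp
  also have "\<dots> = f i + f j + f k" using assms by (simp add: ac_simps)
  finally show ?thesis .
qed

text \<open>The flow is quadratic, but an off-diagonal entry \<open>x\<^sub>i\<^sub>j\<close> and
  the product \<open>x\<^sub>i\<^sub>k x\<^sub>k\<^sub>j\<close> solve a linear system whose
  coefficients contain only diagonal entries and edge products, and these are bounded.\<close>

lemma flow_bounded:
  fixes A :: "real^3^3" and x :: "real \<Rightarrow> real^3^3"
  assumes diag: "\<And>i j. i \<noteq> j \<Longrightarrow> A$i$j = 0"
    and x: "\<And>t. t \<in> {0..<T} \<Longrightarrow> (x has_vector_derivative flow_field A (x t)) (at t within {0..<T})"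
    and dc: "\<And>t i. t \<in> {0..<T} \<Longrightarrow> x t $ i $ i = x 0 $ i $ i"
    and e: "\<And>t. t \<in> {0..<T} \<Longrightarrow> \<bar>edge1 (x t)\<bar> \<le> B \<and> \<bar>edge2 (x t)\<bar> \<le> B \<and> \<bar>edge3 (x t)\<bar> \<le> B"
  shows "\<exists>C. \<forall>t\<in>{0..<T}. norm (x t) \<le> C"
proof -
  define a where "a = 2 * norm A"
  have a: "\<bar>A$j$j - A$i$i\<bar> \<le> a" for i j
    unfolding a_def using entry_le_norm[of A i i] entry_le_norm[of A j j] by linarith
  define D where "D = norm (x 0)"
  have D: "\<bar>x t $ i $ i\<bar> \<le> D" if "t \<in> {0..<T}" for t i
    unfolding dc[OF that] D_def by (rule entry_le_norm)
  have pair: "\<bar>x t $ i $ j * x t $ j $ i\<bar> \<le> B" if "t \<in> {0..<T}" "i \<noteq> j" for t i j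
    using e[OF that(1)] that(2) exhaust_3[of i] exhaust_3[of j]
    unfolding edge1_def edge2_def edge3_def by (elim disjE; simp add: mult.commute)
  define M where "M = a * (4 * D + 2 * \<bar>B\<bar> + 1)"
  have a0: "a \<ge> 0" and D0: "D \<ge> 0" by (simp_all add: a_def D_def)
  have d: "((\<lambda>t. x t $ i $ j) has_real_derivative (A$j$j - A$i$i) * (\<Sum>k\<in>UNIV. x t$i$k * x t$k$j)) (at t within {0..<T})"
    if "t \<in> {0..<T}" for t i j
  proof -
    have "((\<lambda>t. x t $ i $ j) has_real_derivative flow_field A (x t) $ i $ j) (at t within {0..<T})"
      using x[OF that] unfolding has_vector_derivative_entries by blast
    moreover have "flow_field A (x t) $ i $ j = (A$j$j - A$i$i) * (\<Sum>k\<in>UNIV. x t$i$k * x t$k$j)"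
      by (rule flow_field_nth) (rule diag)
    ultimately show ?thesis by (simp only:)
  qed
  have off: "\<exists>C. \<forall>t\<in>{0..<T}. \<bar>x t $ i $ j\<bar> \<le> C" if ijk: "i \<noteq> j" "j \<noteq> k" "i \<noteq> k" for i j k
  proof -
    let ?g = "\<lambda>t. x t $ i $ j" and ?w = "\<lambda>t. x t $ i $ k * x t $ k $ j"
    let ?a11 = "\<lambda>t. (A$j$j - A$i$i) * (x t$i$i + x t$j$j)" and ?a12 = "\<lambda>t::real. A$j$j - A$i$i"
      and ?a21 = "\<lambda>t. (A$k$k - A$i$i) * (x t$j$k * x t$k$j) + (A$j$j - A$k$k) * (x t$i$k * x t$k$i)"
      and ?a22 = "\<lambda>t. (A$k$k - A$i$i) * (x t$i$i + x t$k$k) + (A$j$j - A$k$k) * (x t$k$k + x t$j$j)"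
    have S: "(\<Sum>l\<in>UNIV. f l) = f i + f j + f k" for f :: "3 \<Rightarrow> real" using sum_distinct_3[OF ijk] .
    have "(?g t)\<^sup>2 \<le> ((?g 0)\<^sup>2 + (?w 0)\<^sup>2) * exp (4 * M * T)" if t: "t \<in> {0..<T}" for t
    proof (rule linear_system_bound[where g = ?g and w = ?w and ?a11.0 = ?a11 and ?a12.0 = ?a12
          and ?a21.0 = ?a21 and ?a22.0 = ?a22, OF _ _ _ t])
      fix t assume t: "t \<in> {0..<T}"
      show "(?g has_real_derivative ?a11 t * ?g t + ?a12 t * ?w t) (at t within {0..<T})"
        by (rule DERIV_cong[OF d[OF t]]) (simp add: S algebra_simps)
      show "(?w has_real_derivative ?a21 t * ?g t + ?a22 t * ?w t) (at t within {0..<T})"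
        by (rule DERIV_cong[OF DERIV_mult[OF d[OF t] d[OF t]]]) (simp add: S algebra_simps)
      have m: "\<bar>(A$q$q - A$p$p) * c\<bar> \<le> a * C" if "\<bar>c\<bar> \<le> C" for p q c C
        unfolding abs_mult using a that a0 by (intro mult_mono) auto
      have 1: "\<bar>x t$p$p + x t$q$q\<bar> \<le> 2 * D" for p q using D[OF t, of p] D[OF t, of q] by linarith
      define b where "b = \<bar>B\<bar>"
      have 2: "\<bar>x t$j$k * x t$k$j\<bar> \<le> b" "\<bar>x t$i$k * x t$k$i\<bar> \<le> b"
        unfolding b_def
        by (rule order_trans[OF pair[OF t ijk(2)] abs_ge_self], rule order_trans[OF pair[OF t ijk(3)] abs_ge_self])
      have M: "M = 4 * (a * D) + 2 * (a * b) + a" unfolding M_def b_def by (simp add: algebra_simps)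
      have nn: "a * D \<ge> 0" "a * b \<ge> 0" using a0 D0 by (simp_all add: b_def)
      show "\<bar>?a11 t\<bar> \<le> M \<and> \<bar>?a12 t\<bar> \<le> M \<and> \<bar>?a21 t\<bar> \<le> M \<and> \<bar>?a22 t\<bar> \<le> M"
      proof (intro conjI)
        show "\<bar>?a11 t\<bar> \<le> M"
          by (rule order_trans[OF m[OF 1[of i j], of j i]]) (use M nn a0 in linarith)
        show "\<bar>?a12 t\<bar> \<le> M"
          by (rule order_trans[OF a]) (use M nn in linarith)
        show "\<bar>?a21 t\<bar> \<le> M"
          by (rule order_trans[OF abs_triangle_ineq order_trans[OF add_mono[OF m[OF 2(1), of k i] m[OF 2(2), of j k]]]])
             (use M nn a0 in linarith)
        show "\<bar>?a22 t\<bar> \<le> M"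
          by (rule order_trans[OF abs_triangle_ineq order_trans[OF add_mono[OF m[OF 1[of i k], of k i] m[OF 1[of k j], of j k]]]])
             (use M nn a0 in linarith)
      qed
    qed
    then have "\<bar>?g t\<bar> \<le> sqrt (((?g 0)\<^sup>2 + (?w 0)\<^sup>2) * exp (4 * M * T))" if "t \<in> {0..<T}" for t
      using that by (intro real_le_rsqrt) simp
    then show ?thesis by blast
  qed
  have "\<exists>C. \<forall>t\<in>{0..<T}. \<bar>x t $ i $ j\<bar> \<le> C" for i j
  proof (cases "i = j")
    case True
    then show ?thesis using D by (intro exI[of _ D]) simp
  next
    case False
    have "{i, j} \<noteq> UNIV"
    proof
      assume eq: "{i, j} = UNIV"
      have "card {i, j} \<le> 2" by (simp add: card_insert_if)
      then show False unfolding eq by simp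
    qed
    then obtain k where "k \<notin> {i, j}" using UNIV_eq_I[of "{i, j}"] by blast
    then have "\<exists>k. j \<noteq> k \<and> i \<noteq> k" by auto
    then show ?thesis using off False by blast
  qed
  then obtain C where C: "\<And>i j t. t \<in> {0..<T} \<Longrightarrow> \<bar>x t $ i $ j\<bar> \<le> C i j" by metis
  have "norm (x t) \<le> 9 * (\<Sum>i\<in>UNIV. \<Sum>j\<in>UNIV. \<bar>C i j\<bar>)" if t: "t \<in> {0..<T}" for t
  proof (rule norm_le_9_entry_bound)
    fix i j
    have "\<bar>x t $ i $ j\<bar> \<le> \<bar>C i j\<bar>" using C[OF t, of i j] by linarith
    also have "\<dots> \<le> (\<Sum>j\<in>UNIV. \<bar>C i j\<bar>)" by (rule member_le_sum) auto
    also have "\<dots> \<le> (\<Sum>i\<in>UNIV. \<Sum>j\<in>UNIV. \<bar>C i j\<bar>)"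
      by (rule member_le_sum[of i UNIV "\<lambda>i. \<Sum>j\<in>UNIV. \<bar>C i j\<bar>"]) (auto intro: sum_nonneg)
    finally show "\<bar>x t $ i $ j\<bar> \<le> (\<Sum>i\<in>UNIV. \<Sum>j\<in>UNIV. \<bar>C i j\<bar>)" .
  qed
  then show ?thesis by blast
qed

section \<open>Time reversal and maximal solutions\<close>

lemma flow_field_transpose:
  fixes A X :: "real^3^3"
  assumes "\<And>i j. i \<noteq> j \<Longrightarrow> A$i$j = 0"
  shows "flow_field A (transpose X) = - transpose (flow_field A X)"
proof -
  have "flow_field A (transpose X) $ i $ j = - (flow_field A X $ j $ i)" for i j
  proof -
    have e: "flow_field A Y $ i $ j = (A$j$j - A$i$i) * (\<Sum>k\<in>UNIV. Y$i$k * Y$k$j)" for Y :: "real^3^3" and i j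
      by (rule flow_field_nth) (rule assms)
    show ?thesis unfolding e by (simp add: transpose_def mult.commute left_diff_distrib)
  qed
  moreover have "Z = - transpose Y" if "\<And>i j. Z$i$j = - (Y$j$i)" for Y Z :: "real^3^3"
    using that by (simp add: vec_eq_iff transpose_def)
  ultimately show ?thesis by blast
qed

text \<open>Transposition reverses time.\<close>

lemma glue_solutions:
  fixes A X :: "real^3^3"
  assumes diag: "\<And>i j. i \<noteq> j \<Longrightarrow> A$i$j = 0"
    and x: "x 0 = X" "\<And>t. t \<in> D1 \<Longrightarrow> (x has_vector_derivative flow_field A (x t)) (at t within {0..})"
    and z: "z 0 = transpose X" "\<And>t. t \<in> D2 \<Longrightarrow> (z has_vector_derivative flow_field A (z t)) (at t within {0..})"
    and D: "0 \<in> D1" "0 \<in> D2"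
  defines "g \<equiv> \<lambda>t. if t \<ge> 0 then x t else transpose (z (- t))"
  shows "t \<ge> 0 \<and> t \<in> D1 \<or> t \<le> 0 \<and> - t \<in> D2 \<Longrightarrow> (g has_vector_derivative flow_field A (g t)) (at t)"
proof -
  have right: "(g has_vector_derivative flow_field A (g t)) (at t within {0..})" if t: "t \<ge> 0" "t \<in> D1" for t
  proof (rule has_vector_derivative_transform[of t _ g x])
    show "(x has_vector_derivative flow_field A (g t)) (at t within {0..})" using x(2)[OF t(2)] t(1) by (simp add: g_def)
  qed (use t in \<open>auto simp: g_def\<close>)
  have gl: "g t = transpose (z (- t))" if "t \<le> 0" for t
    using that x(1) z(1) by (cases "t = 0") (auto simp: g_def)
  have left: "(g has_vector_derivative flow_field A (g t)) (at t within {..0})" if t: "t \<le> 0" "- t \<in> D2" for t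
  proof (rule has_vector_derivative_transform[of t _ g "\<lambda>t. transpose (z (- t))"])
    have img: "uminus ` {..0::real} = {0..}" by force
    have "((\<lambda>u. z u $ i $ j) has_real_derivative flow_field A (z (- t)) $ i $ j) (at (- t) within uminus ` {..0})" for i j
      using z(2)[OF t(2)] unfolding has_vector_derivative_entries img by blast
    moreover have "((\<lambda>u. f (- u)) has_real_derivative c * (- 1)) (at t within {..0})"
      if "(f has_real_derivative c) (at (- t) within uminus ` {..0})" for f :: "real \<Rightarrow> real" and c
    proof -
      have "(uminus has_real_derivative - 1) (at t within {..0})" by (auto intro!: derivative_eq_intros)
      from DERIV_image_chain[OF that this] show ?thesis by (simp add: o_def)
    qed
    ultimately have "((\<lambda>u. z (- u) $ i $ j) has_real_derivative flow_field A (z (- t)) $ i $ j * (- 1)) (at t within {..0})" for i j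
      by blast
    moreover have "flow_field A (g t) $ i $ j = flow_field A (z (- t)) $ j $ i * (- 1)" for i j
    proof -
      have ft: "flow_field A (transpose (z (- t))) = - transpose (flow_field A (z (- t)))"
        by (rule flow_field_transpose) (rule diag)
      have "(- transpose Y) $ i $ j = Y $ j $ i * (- 1)" for Y :: "real^3^3" by (simp add: transpose_def)
      then show ?thesis unfolding gl[OF t(1)] ft .
    qed
    ultimately show "((\<lambda>t. transpose (z (- t))) has_vector_derivative flow_field A (g t)) (at t within {..0})"
      unfolding has_vector_derivative_entries by (simp add: transpose_def)
  qed (use t gl in auto)
  assume t: "t \<ge> 0 \<and> t \<in> D1 \<or> t \<le> 0 \<and> - t \<in> D2"
  consider "t > 0" "t \<in> D1" | "t = 0" | "t < 0" "- t \<in> D2" using t by linarith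
  then show "(g has_vector_derivative flow_field A (g t)) (at t)"
  proof cases
    case 1
    moreover have "at t within {0..} = at t" using 1 by (intro at_within_interior) (simp add: interior_real_atLeast)
    ultimately show ?thesis using right[of t] by simp
  next
    case 2
    have "({0..} \<union> {..0}) = (UNIV :: real set)" by auto
    then show ?thesis using has_vector_derivative_Un[OF right[of 0] left[of 0]] D 2 by simp
  next
    case 3
    moreover have "at t within {..0} = at t" using 3 by (intro at_within_interior) (simp add: interior_real_atMost)
    ultimately show ?thesis using left[of t] by simp
  qed
qed

lemma norm_transpose_le: "norm (X :: real^3^3) \<le> 9 * norm (transpose X)"
proof (rule norm_le_9_entry_bound)
  show "\<bar>X$i$j\<bar> \<le> norm (transpose X)" for i j
    using entry_le_norm[of "transpose X" j i] by (simp add: transpose_def)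
qed

lemma flow_forward_solution:
  fixes A X :: "real^3^3"
  assumes diag: "\<And>i j. i \<noteq> j \<Longrightarrow> A$i$j = 0"
  obtains (global) x where "x 0 = X" "\<And>t. t \<ge> 0 \<Longrightarrow> (x has_vector_derivative flow_field A (x t)) (at t within {0..})"
  | (finite) x T where "x 0 = X" "T > 0"
      "\<And>t. t \<in> {0..<T} \<Longrightarrow> (x has_vector_derivative flow_field A (x t)) (at t within {0..})"
      "filterlim x at_infinity (at_left T)"
proof -
  define a where "a = 2 * norm A"
  have a: "\<bar>A$j$j - A$i$i\<bar> \<le> a" for i j
    unfolding a_def using entry_le_norm[of A i i] entry_le_norm[of A j j] by linarith
  have K: "20 * (3 * a + 1) > 0" by (simp add: a_def add_nonneg_pos)
  have loc: "\<exists>x. x 0 = Y \<and> (\<forall>t. \<bar>t\<bar> \<le> 1 / (20 * (3 * a + 1) * (norm Y + 1)) \<longrightarrow>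
      (x has_vector_derivative flow_field A (x t)) (at t) \<and> norm (x t - Y) \<le> norm Y / 2)" for Y
    by (rule flow_local_solution) (use diag a in auto)
  show thesis
  proof (rule forward_solution[OF K loc, of X])
    fix x assume "x 0 = X" and a2: "\<And>t. t \<ge> 0 \<Longrightarrow> (x has_vector_derivative flow_field A (x t)) (at t within {0..})"
    from this(1) show thesis by (rule global) (rule a2)
  next
    fix x T assume "x 0 = X" and a2: "T > 0" and a4: "filterlim x at_infinity (at_left T)"
      and a3: "\<And>t. t \<in> {0..<T} \<Longrightarrow> (x has_vector_derivative flow_field A (x t)) (at t within {0..})"
    from this(1) show thesis by (rule finite) (rule a2 a3 a4, assumption?)+
  qed
qed

text \<open>A forward solution from \<open>transpose X\<close>, transposed and run backwards, is the
  backward half of a solution from \<open>X\<close>. Excluding global forward solutions from both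
  matrices makes both ends finite.\<close>

lemma blows_up_if_no_global:
  fixes A X :: "real^3^3"
  assumes diag: "\<And>i j. i \<noteq> j \<Longrightarrow> A$i$j = 0"
    and ng: "\<And>Y x. Y = X \<or> Y = transpose X \<Longrightarrow> x 0 = Y \<Longrightarrow>
      (\<And>t. t \<ge> 0 \<Longrightarrow> (x has_vector_derivative flow_field A (x t)) (at t within {0..})) \<Longrightarrow> False"
  shows "blows_up A X"
proof -
  have ex: "\<exists>x T. x 0 = Y \<and> T > 0 \<and> (\<forall>t\<in>{0..<T}. (x has_vector_derivative flow_field A (x t)) (at t within {0..}))
      \<and> filterlim x at_infinity (at_left T)" if Y: "Y = X \<or> Y = transpose X" for Y
    by (rule flow_forward_solution[OF diag, of Y]) (use ng[OF Y] in blast)+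
  obtain x T where x: "x 0 = X" "T > 0" "\<And>t. t \<in> {0..<T} \<Longrightarrow> (x has_vector_derivative flow_field A (x t)) (at t within {0..})"
    "filterlim x at_infinity (at_left T)" using ex[of X] by auto
  obtain z S where z: "z 0 = transpose X" "S > 0" "\<And>t. t \<in> {0..<S} \<Longrightarrow> (z has_vector_derivative flow_field A (z t)) (at t within {0..})"
    "filterlim z at_infinity (at_left S)" using ex[of "transpose X"] by auto
  define g where "g t = (if t \<ge> 0 then x t else transpose (z (- t)))" for t
  have "(g has_vector_derivative flow_field A (g t)) (at t)" if "t \<in> {- S<..<T}" for t
    unfolding g_def[abs_def] 
    by (rule glue_solutions[where ?D1.0 = "{0..<T}" and ?D2.0 = "{0..<S}", OF _ x(1,3) z(1,3)])
       (use that x(2) z(2) diag in auto)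
  then have sol: "solution_on A X g {- S<..<T}"
    unfolding solution_on_def using x(1) by (simp add: g_def)
  have "eventually (\<lambda>t. t > 0) (at_left T)" using x(2) by (intro eventually_at_leftI[of 0]) auto
  then have "eventually (\<lambda>t. x t = g t) (at_left T)" by eventually_elim (simp add: g_def)
  then have r: "filterlim g at_infinity (at_left T)"
    using x(4) filterlim_cong[OF refl refl] by blast
  have l: "filterlim g at_infinity (at_right (- S))"
  proof -
    have "filterlim (\<lambda>t. norm (z t)) at_top (at_left S)"
      using z(4) by (simp add: filterlim_at_infinity_conv_norm_at_top)
    then have "filterlim (\<lambda>t. norm (z (- t))) at_top (at_right (- S))"
      by (simp add: at_right_minus filterlim_filtermap)
    then have "filterlim (\<lambda>t. (1/9) * norm (z (- t))) at_top (at_right (- S))"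
      by (intro filterlim_tendsto_pos_mult_at_top[OF tendsto_const]) auto
    moreover have "eventually (\<lambda>t. t < 0) (at_right (- S))" using z(2) by (intro eventually_at_rightI[of _ 0]) auto
    then have "eventually (\<lambda>t. (1/9) * norm (z (- t)) \<le> norm (g t)) (at_right (- S))"
    proof eventually_elim
      case (elim t)
      then show ?case using norm_transpose_le[of "z (- t)"] by (simp add: g_def)
    qed
    ultimately have "filterlim (\<lambda>t. norm (g t)) at_top (at_right (- S))" by (rule filterlim_at_top_mono)
    then show ?thesis by (simp add: filterlim_at_infinity_conv_norm_at_top)
  qed
  show ?thesis unfolding blows_up_def using sol r l x(2) z(2)
    by (intro exI[of _ "- S"] exI[of _ T] exI[of _ g]) simp
qed

text \<open>The bound is demanded of every solution with either initial value. So it refutes any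
  witness of \<open>blows_up\<close> at its right end, and it leaves only the global case of
  \<open>flow_forward_solution\<close> in both time directions.\<close>

lemma bounded_solutions_exist_globally:
  fixes A X :: "real^3^3"
  assumes diag: "\<And>i j. i \<noteq> j \<Longrightarrow> A$i$j = 0"
    and bd: "\<And>Y x T. Y = X \<or> Y = transpose X \<Longrightarrow> x 0 = Y \<Longrightarrow> T > 0 \<Longrightarrow>
      (\<And>t. t \<in> {0..<T} \<Longrightarrow> (x has_vector_derivative flow_field A (x t)) (at t within {0..<T})) \<Longrightarrow>
      \<exists>C. \<forall>t\<in>{0..<T}. norm (x t) \<le> C"
  shows "\<not> blows_up A X" "exists_for_all_times A X"
proof -
  have nolim: "\<not> filterlim x at_infinity (at_left T)" if H: "Y = X \<or> Y = transpose X" "x 0 = Y" "T > 0"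
    "\<And>t. t \<in> {0..<T} \<Longrightarrow> (x has_vector_derivative flow_field A (x t)) (at t within {0..<T})" for Y x T
  proof
    assume lim: "filterlim x at_infinity (at_left T)"
    obtain C where C: "\<And>t. t \<in> {0..<T} \<Longrightarrow> norm (x t) \<le> C" using bd[OF H] by blast
    have "eventually (\<lambda>t. \<bar>C\<bar> + 1 \<le> norm (x t)) (at_left T)"
      using lim unfolding filterlim_at_infinity[OF order_refl] by auto
    moreover have "eventually (\<lambda>t. t \<in> {0..<T}) (at_left T)"
      using H(3) by (intro eventually_at_leftI[of 0]) auto
    ultimately have "eventually (\<lambda>t. False) (at_left T)"
    proof eventually_elim
      case (elim t)
      then show ?case using C[of t] by linarith
    qed
    then show False by (simp add: trivial_limit_at_left_real)
  qed
  show "\<not> blows_up A X"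
  proof
    assume "blows_up A X"
    then obtain s T x where b: "s < 0" "0 < T" "solution_on A X x {s<..<T}" "filterlim x at_infinity (at_left T)"
      unfolding blows_up_def by blast
    have d: "(x has_vector_derivative flow_field A (x t)) (at t within {0..<T})" if "t \<in> {0..<T}" for t
    proof -
      have "t \<in> {s<..<T}" using that b(1) by simp
      then have "(x has_vector_derivative flow_field A (x t)) (at t)"
        using b(3) unfolding solution_on_def by blast
      then show ?thesis by (rule has_vector_derivative_at_within)
    qed
    moreover have "x 0 = X" using b(3) by (simp add: solution_on_def)
    ultimately have "\<not> filterlim x at_infinity (at_left T)" using nolim[of X x T, OF _ _ b(2) d] by blast
    then show False using b(4) by blast
  qed
  have ex: "\<exists>x. x 0 = Y \<and> (\<forall>t\<in>{0..}. (x has_vector_derivative flow_field A (x t)) (at t within {0..}))"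
    if Y: "Y = X \<or> Y = transpose X" for Y
  proof (rule flow_forward_solution[of A Y])
    show "i \<noteq> j \<Longrightarrow> A$i$j = 0" for i j by (rule diag)
  next
    fix x assume "x 0 = Y" "\<And>t. t \<ge> 0 \<Longrightarrow> (x has_vector_derivative flow_field A (x t)) (at t within {0..})"
    then show ?thesis by (intro exI[of _ x]) simp
  next
    fix x T assume x: "x 0 = Y" "T > 0" "filterlim x at_infinity (at_left T)"
      "\<And>t. t \<in> {0..<T} \<Longrightarrow> (x has_vector_derivative flow_field A (x t)) (at t within {0..})"
    have "(x has_vector_derivative flow_field A (x t)) (at t within {0..<T})" if "t \<in> {0..<T}" for t
      by (rule has_vector_derivative_within_subset[OF x(4)[OF that]]) auto
    from nolim[OF Y x(1,2) this] show ?thesis using x(3) by blast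
  qed
  obtain x where x: "x 0 = X" "\<forall>t\<in>{0..}. (x has_vector_derivative flow_field A (x t)) (at t within {0..})"
    using ex[of X] by blast
  obtain z where z: "z 0 = transpose X" "\<forall>t\<in>{0..}. (z has_vector_derivative flow_field A (z t)) (at t within {0..})"
    using ex[of "transpose X"] by blast
  define g where "g t = (if t \<ge> 0 then x t else transpose (z (- t)))" for t
  have "(g has_vector_derivative flow_field A (g t)) (at t)" for t
    unfolding g_def[abs_def] 
    by (rule glue_solutions[where ?D1.0 = "{0..}" and ?D2.0 = "{0..}", OF _ x(1) x(2)[rule_format] z(1) z(2)[rule_format]])
       (use diag in auto)
  then have "solution_on A X g UNIV"
    unfolding solution_on_def using x(1) by (simp add: g_def)
  then show "exists_for_all_times A X" unfolding exists_for_all_times_def by blast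
qed

subsection \<open>The type of the hexagon\<close>

context pencil_cubic
begin

lemma component_types_aux:
  assumes x: "x1 < x2" "x2 < x3" and Fs: "\<And>s. F s = - 4 * (b1 * b2 * b3) * (s - x1) * (s - x2) * (s - x3)"
    and s: "x2 < s" "s < x3" and pos: "b2 * b3 * (u1 + b1 * s) > 0"
    and card: "card (connected_components_of (subtopology rp2 curve)) = 2"
  defines "p2 \<equiv> pencil_cubic.curve_pos m2 m3 m1 w b2 b3 b1 \<beta> u2 u3 u1 r s"
    and "n2 \<equiv> pencil_cubic.curve_neg m2 m3 m1 w b2 b3 b1 \<beta> u2 u3 u1 r s"
    and "p3 \<equiv> pencil_cubic.curve_pos m3 m1 m2 w b3 b1 b2 \<beta> u3 u1 u2 r s"
    and "n3 \<equiv> pencil_cubic.curve_neg m3 m1 m2 w b3 b1 b2 \<beta> u3 u1 u2 r s"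
  shows "\<exists>N C. connected_components_of (subtopology rp2 curve) = {N, C} \<and> N \<inter> C = {} \<and>
    contractible_in_rp2 C \<and> \<not> contractible_in_rp2 N \<and> curve_pos s = N \<and> curve_neg s = C \<and> p2 = p3 \<and>
    (p2 = N \<and> n2 = C \<or> p2 = C \<and> n2 = N) \<and> (p3 = N \<and> n3 = C \<or> p3 = C \<and> n3 = N)"
proof -
  interpret rot: pencil_cubic m2 m3 m1 w b2 b3 b1 \<beta> u2 u3 u1 r by (rule rotate)
  interpret rot2: pencil_cubic m3 m1 m2 w b3 b1 b2 \<beta> u3 u1 u2 r by (rule rot.rotate)
  have F2: "rot.F t = - 4 * (b2 * b3 * b1) * (t - x1) * (t - x2) * (t - x3)" for t
    unfolding rot_F Fs by (simp add: ac_simps)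
  have F3: "rot2.F t = - 4 * (b3 * b1 * b2) * (t - x1) * (t - x2) * (t - x3)" for t
    unfolding rot.rot_F rot_F Fs by (simp add: ac_simps)
  have c1: "connected_components_of (subtopology rp2 curve) = {curve_pos s, curve_neg s}"
    by (rule two_components(4)[OF x Fs s card])
  have c2: "connected_components_of (subtopology rp2 curve) = {p2, n2}"
    using rot.two_components(4)[OF x F2 s] card unfolding rot_curve p2_def n2_def by blast
  have c3: "connected_components_of (subtopology rp2 curve) = {p3, n3}"
    using rot2.two_components(4)[OF x F3 s] card unfolding rot.rot_curve rot_curve p3_def n3_def by blast
  note d = distinguished_index[OF x Fs s pos, folded p2_def p3_def]
  have "{p2, n2} = {curve_pos s, curve_neg s}" "{p3, n3} = {curve_pos s, curve_neg s}" using c1 c2 c3 by simp_all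
  then show ?thesis
    using d c1 two_components(5)[OF x Fs s]
    by (intro exI[of _ "curve_pos s"] exI[of _ "curve_neg s"]) (auto simp: doubleton_eq_iff)
qed

text \<open>\<open>b2 * b3 * (u1 + b1 * s)\<close> and its two rotations multiply to
  \<open>(b1 * b2 * b3)\<^sup>2\<close> times a positive number, as \<open>F s < 0\<close>. So one
  of them is positive and \<open>component_types_aux\<close> applies to its index. The last
  conclusion is the parity statement: \<open>N\<close> carries one or three of the points at
  infinity.\<close>

lemma component_types:
  assumes x: "x1 < x2" "x2 < x3" and Fs: "\<And>s. F s = - 4 * (b1 * b2 * b3) * (s - x1) * (s - x2) * (s - x3)"
    and s: "x2 < s" "s < x3"
    and card: "card (connected_components_of (subtopology rp2 curve)) = 2"
  defines "p1 \<equiv> curve_pos s" and "n1 \<equiv> curve_neg s"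
    and "p2 \<equiv> pencil_cubic.curve_pos m2 m3 m1 w b2 b3 b1 \<beta> u2 u3 u1 r s"
    and "n2 \<equiv> pencil_cubic.curve_neg m2 m3 m1 w b2 b3 b1 \<beta> u2 u3 u1 r s"
    and "p3 \<equiv> pencil_cubic.curve_pos m3 m1 m2 w b3 b1 b2 \<beta> u3 u1 u2 r s"
    and "n3 \<equiv> pencil_cubic.curve_neg m3 m1 m2 w b3 b1 b2 \<beta> u3 u1 u2 r s"
  obtains N C where "connected_components_of (subtopology rp2 curve) = {N, C}" "N \<inter> C = {}"
    "contractible_in_rp2 C" "\<not> contractible_in_rp2 N"
    "p1 = N \<and> n1 = C \<or> p1 = C \<and> n1 = N" "p2 = N \<and> n2 = C \<or> p2 = C \<and> n2 = N"
    "p3 = N \<and> n3 = C \<or> p3 = C \<and> n3 = N"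
    "p1 = N \<and> p2 = p3 \<or> p2 = N \<and> p3 = p1 \<or> p3 = N \<and> p1 = p2"
proof -
  interpret rot: pencil_cubic m2 m3 m1 w b2 b3 b1 \<beta> u2 u3 u1 r by (rule rotate)
  interpret rot2: pencil_cubic m3 m1 m2 w b3 b1 b2 \<beta> u3 u1 u2 r by (rule rot.rotate)
  have F2: "rot.F t = - 4 * (b2 * b3 * b1) * (t - x1) * (t - x2) * (t - x3)" for t
    unfolding rot_F Fs by (simp add: ac_simps)
  have F3: "rot2.F t = - 4 * (b3 * b1 * b2) * (t - x1) * (t - x2) * (t - x3)" for t
    unfolding rot.rot_F rot_F Fs by (simp add: ac_simps)
  have c2: "rot.curve = curve" by (rule rot_curve)
  have c3: "rot2.curve = curve" unfolding rot.rot_curve by (rule rot_curve)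
  let ?c1 = "b2 * b3 * (u1 + b1 * s)" and ?c2 = "b3 * b1 * (u2 + b2 * s)" and ?c3 = "b1 * b2 * (u3 + b3 * s)"
  have "?c1 * ?c2 * ?c3 = (b1 * b2 * b3)\<^sup>2 * ((u1 + b1 * s) * (u2 + b2 * s) * (u3 + b3 * s))"
    by (simp only: power2_eq_square ac_simps)
  moreover have "(b1 * b2 * b3)\<^sup>2 > 0" using b_nz by simp
  ultimately have pr: "?c1 * ?c2 * ?c3 > 0"
    using mult_pos_pos[OF _ F_neg_prod[OF two_components(1)[OF x Fs s]]] by presburger
  have "?c1 > 0 \<or> ?c2 > 0 \<or> ?c3 > 0"
  proof (rule ccontr)
    assume "\<not> ?thesis"
    then have "?c1 \<le> 0" "?c2 \<le> 0" "?c3 \<le> 0" by auto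
    then have "?c1 * ?c2 * ?c3 \<le> 0" using mult_nonneg_nonpos[OF mult_nonpos_nonpos] by blast
    then show False using pr by linarith
  qed
  then show thesis
  proof (elim disjE)
    assume "?c1 > 0"
    from component_types_aux[OF x Fs s _ card, folded p1_def n1_def p2_def n2_def p3_def n3_def, OF this]
    obtain N C where n: "connected_components_of (subtopology rp2 curve) = {N, C}" "N \<inter> C = {}"
      "contractible_in_rp2 C" "\<not> contractible_in_rp2 N" "p1 = N" "n1 = C" "p2 = p3"
      "p2 = N \<and> n2 = C \<or> p2 = C \<and> n2 = N" "p3 = N \<and> n3 = C \<or> p3 = C \<and> n3 = N"
      by (elim exE conjE)
    show thesis by (rule that[OF n(1-4)]) (use n(5-) in auto)
  next
    assume "?c2 > 0"
    from rot.component_types_aux[OF x F2 s, unfolded c2, OF _ card, folded p1_def n1_def p2_def n2_def p3_def n3_def, OF this]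
    obtain N C where n: "connected_components_of (subtopology rp2 curve) = {N, C}" "N \<inter> C = {}"
      "contractible_in_rp2 C" "\<not> contractible_in_rp2 N" "p2 = N" "n2 = C" "p3 = p1"
      "p3 = N \<and> n3 = C \<or> p3 = C \<and> n3 = N" "p1 = N \<and> n1 = C \<or> p1 = C \<and> n1 = N"
      by (elim exE conjE)
    show thesis by (rule that[OF n(1-4)]) (use n(5-) in auto)
  next
    assume "?c3 > 0"
    from rot2.component_types_aux[OF x F3 s, unfolded c3, OF _ card, folded p1_def n1_def p2_def n2_def p3_def n3_def, OF this]
    obtain N C where n: "connected_components_of (subtopology rp2 curve) = {N, C}" "N \<inter> C = {}"
      "contractible_in_rp2 C" "\<not> contractible_in_rp2 N" "p3 = N" "n3 = C" "p1 = p2"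
      "p1 = N \<and> n1 = C \<or> p1 = C \<and> n1 = N" "p2 = N \<and> n2 = C \<or> p2 = C \<and> n2 = N"
      by (elim exE conjE)
    show thesis by (rule that[OF n(1-4)]) (use n(5-) in auto)
  qed
qed

end

text \<open>A double root of \<open>F\<close> produces a complex singular point of the curve; the two lemmas solve
  its equations in the coordinates \<open>m\<^sub>i / z\<^sub>3\<close>.\<close>

lemma singular_point_two_zero:
  fixes b1 b2 \<beta> U3 :: real
  assumes "b1 \<noteq> 0" "b2 \<noteq> 0"
  shows "\<exists>M1 M2 :: complex. M1 * M2 = of_real U3 \<and> of_real b1 * M1 + of_real b2 * M2 = of_real \<beta>"
proof -
  define d :: complex where "d = csqrt (of_real (\<beta>\<^sup>2 - 4 * b1 * b2 * U3))"
  have d2: "d\<^sup>2 = of_real \<beta> ^ 2 - 4 * of_real b1 * of_real b2 * of_real U3" unfolding d_def by simp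
  have b: "complex_of_real b1 \<noteq> 0" "complex_of_real b2 \<noteq> 0" using assms by auto
  let ?M1 = "(of_real \<beta> + d) / (2 * of_real b1)" and ?M2 = "(of_real \<beta> - d) / (2 * of_real b2)"
  have "?M1 * ?M2 = (of_real \<beta> ^ 2 - d\<^sup>2) / (4 * of_real b1 * of_real b2)"
    by (simp add: power2_eq_square algebra_simps)
  also have "\<dots> = of_real U3" unfolding d2 using b by (simp add: field_simps)
  finally have "?M1 * ?M2 = of_real U3" .
  moreover have "of_real b1 * ?M1 + of_real b2 * ?M2 = of_real \<beta>"
  proof -
    have "of_real b1 * ?M1 = (of_real \<beta> + d) / 2" "of_real b2 * ?M2 = (of_real \<beta> - d) / 2" using b by simp_all
    then show ?thesis by (simp add: add_divide_distrib diff_divide_distrib)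
  qed
  ultimately show ?thesis by blast
qed

lemma singular_point_exists:
  fixes b1 b2 b3 \<beta> U1 U2 U3 R :: real
  assumes b: "b1 \<noteq> 0" "b2 \<noteq> 0" "b3 \<noteq> 0" and R: "R\<^sup>2 = 4 * U1 * U2 * U3"
    and dR: "\<beta> * R = 2 * (b1 * U2 * U3 + b2 * U1 * U3 + b3 * U1 * U2)"
  obtains M1 M2 M3 :: complex where "M2 * M3 = of_real U1" "M3 * M1 = of_real U2" "M1 * M2 = of_real U3"
    "of_real b1 * M1 + of_real b2 * M2 + of_real b3 * M3 = of_real \<beta>"
    "2 * (of_real U1 * M1 + of_real U2 * M2 + of_real U3 * M3) = 3 * of_real R"
proof (cases "R = 0")
  case True
  then have "U1 = 0 \<and> U2 = 0 \<or> U1 = 0 \<and> U3 = 0 \<or> U2 = 0 \<and> U3 = 0"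
    using R dR b by auto
  then show thesis
  proof (elim disjE conjE)
    assume U: "U1 = 0" "U2 = 0"
    obtain M1 M2 :: complex where "M1 * M2 = of_real U3" "of_real b1 * M1 + of_real b2 * M2 = of_real \<beta>"
      using singular_point_two_zero[OF b(1,2)] by blast
    then show thesis using U True by (intro that[of M2 0 M1]) auto
  next
    assume U: "U1 = 0" "U3 = 0"
    obtain M1 M3 :: complex where "M1 * M3 = of_real U2" "of_real b1 * M1 + of_real b3 * M3 = of_real \<beta>"
      using singular_point_two_zero[OF b(1,3)] by blast
    then show thesis using U True by (intro that[of 0 M3 M1]) (auto simp: mult.commute)
  next
    assume U: "U2 = 0" "U3 = 0"
    obtain M2 M3 :: complex where "M2 * M3 = of_real U1" "of_real b2 * M2 + of_real b3 * M3 = of_real \<beta>"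
      using singular_point_two_zero[OF b(2,3)] by blast
    then show thesis using U True by (intro that[of M2 M3 0]) auto
  qed
next
  case False
  have U: "U1 \<noteq> 0" "U2 \<noteq> 0" "U3 \<noteq> 0" using R False by auto
  \<comment> \<open>The product equations give
    \<open>U1 * M1 = U2 * M2 = U3 * M3 = M1 * M2 * M3\<close>, and the square of this value is
    \<open>U1 * U2 * U3\<close>; hence the common value R / 2.\<close>
  define n1 n2 n3 where "n1 = R / (2 * U1)" and "n2 = R / (2 * U2)" and "n3 = R / (2 * U3)"
  have p: "n2 * n3 = U1" "n3 * n1 = U2" "n1 * n2 = U3"
    using R U unfolding n1_def n2_def n3_def by (simp_all add: field_simps power2_eq_square)
  have Un: "2 * (U1 * n1) = R" "2 * (U2 * n2) = R" "2 * (U3 * n3) = R" using U by (simp_all add: n1_def n2_def n3_def)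
  have "R * (b1 * n1 + b2 * n2 + b3 * n3) = R * \<beta>"
  proof -
    have "R * n1 = 2 * (U2 * U3)" "R * n2 = 2 * (U1 * U3)" "R * n3 = 2 * (U1 * U2)"
      using R U unfolding n1_def n2_def n3_def by (simp_all add: field_simps power2_eq_square)
    moreover have "R * (b1 * n1 + b2 * n2 + b3 * n3) = b1 * (R * n1) + b2 * (R * n2) + b3 * (R * n3)"
      by (simp add: algebra_simps)
    ultimately show ?thesis using dR by (simp add: algebra_simps)
  qed
  then have l: "b1 * n1 + b2 * n2 + b3 * n3 = \<beta>" using False by simp
  show thesis
  proof (rule that[of "of_real n2" "of_real n3" "of_real n1"])
    show "of_real n2 * of_real n3 = complex_of_real U1" "of_real n3 * of_real n1 = complex_of_real U2"
      "of_real n1 * of_real n2 = complex_of_real U3"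
      using p by (simp_all flip: of_real_mult)
    show "of_real b1 * of_real n1 + of_real b2 * of_real n2 + of_real b3 * of_real n3 = complex_of_real \<beta>"
      using l by (simp flip: of_real_mult of_real_add)
    have "2 * (U1 * n1 + U2 * n2 + U3 * n3) = 3 * R" using Un by simp
    then have "complex_of_real (2 * (U1 * n1 + U2 * n2 + U3 * n3)) = complex_of_real (3 * R)" by simp
    then show "2 * (of_real U1 * of_real n1 + of_real U2 * of_real n2 + of_real U3 * of_real n3) = 3 * complex_of_real R"
      by simp
  qed
qed

section \<open>The spectral curve as a cubic in its diagonal forms\<close>

text \<open>Polymorphic in the field: smoothness speaks of complex points, ovals of real
  ones.\<close>

definition diag_form :: "real^3^3 \<Rightarrow> real^3^3 \<Rightarrow> 3 \<Rightarrow> 'a::real_field^3 \<Rightarrow> 'a" where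
  "diag_form A X k z = of_real (X$k$k) * z$3 + of_real (A$k$k) * z$1 - z$2"

definition cubic_form :: "real^3^3 \<Rightarrow> 'a::real_field \<Rightarrow> 'a \<Rightarrow> 'a \<Rightarrow> 'a \<Rightarrow> 'a" where
  "cubic_form X m1 m2 m3 v = m1 * m2 * m3
    - v\<^sup>2 * (of_real (edge1 X) * m1 + of_real (edge2 X) * m2 + of_real (edge3 X) * m3)
    + of_real (cycle_fwd X + cycle_bwd X) * v^3"

lemma spectral_poly_eq:
  assumes "\<And>i j. i \<noteq> j \<Longrightarrow> A$i$j = 0"
  shows "spectral_poly A X z = cubic_form X (diag_form A X 1 z) (diag_form A X 2 z) (diag_form A X 3 z) (z$3)"
proof -
  have A: "A$1$2 = 0" "A$1$3 = 0" "A$2$1 = 0" "A$2$3 = 0" "A$3$1 = 0" "A$3$2 = 0"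
    using assms by simp_all
  have d: "pencil A X z $ k $ k = diag_form A X k z" for k
    by (simp add: pencil_def diag_form_def mat_def)
  have o: "pencil A X z $ i $ j = z$3 * of_real (X$i$j)" if "i \<noteq> j" for i j
    using that assms[OF that] by (simp add: pencil_def mat_def)
  show ?thesis
    unfolding spectral_poly_def det_3 d cubic_form_def edge1_def edge2_def edge3_def cycle_fwd_def cycle_bwd_def
    by (simp add: o algebra_simps power2_eq_square power3_eq_cube)
qed

lemma cubic_form_scale: "cubic_form X (c * m1) (c * m2) (c * m3) (c * v) = c^3 * cubic_form X m1 m2 m3 v"
  unfolding cubic_form_def by (simp add: algebra_simps power2_eq_square power3_eq_cube)

lemma real_part_eq:
  assumes diag: "\<And>i j. i \<noteq> j \<Longrightarrow> A$i$j = 0"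
  shows "real_part A X = {proj_pt v | v. v \<noteq> 0 \<and>
    cubic_form X (diag_form A X 1 v) (diag_form A X 2 v) (diag_form A X 3 v) (v$3) = 0}"
proof -
  have sp: "spectral_poly A X z = cubic_form X (diag_form A X 1 z) (diag_form A X 2 z) (diag_form A X 3 z) (z$3)" for z
    by (rule spectral_poly_eq) (rule diag)
  have "proj_pt (\<chi> i. complex_of_real (v$i)) \<in> spectral_curve A X \<longleftrightarrow>
    cubic_form X (diag_form A X 1 v) (diag_form A X 2 v) (diag_form A X 3 v) (v$3) = 0"
    if v: "v \<noteq> 0" for v :: "real^3"
  proof -
    let ?v = "\<chi> i. complex_of_real (v$i)"
    have v0: "?v \<noteq> 0" using v by (simp add: vec_eq_iff)
    have scale: "spectral_poly A X (c *s z) = c^3 * spectral_poly A X z" for c z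
    proof -
      have "diag_form A X k (c *s z) = c * diag_form A X k z" for k
        by (simp add: diag_form_def algebra_simps)
      then show ?thesis unfolding sp using cubic_form_scale by simp
    qed
    have "proj_pt ?v \<in> spectral_curve A X \<longleftrightarrow> spectral_poly A X ?v = 0"
    proof
      assume "proj_pt ?v \<in> spectral_curve A X"
      then obtain z where "proj_pt ?v = proj_pt z" "spectral_poly A X z = 0" unfolding spectral_curve_def by auto
      then show "spectral_poly A X ?v = 0" by (auto simp: proj_pt_eq_iff scale)
    next
      assume "spectral_poly A X ?v = 0"
      then show "proj_pt ?v \<in> spectral_curve A X" using v0 unfolding spectral_curve_def by blast
    qed
    also have "spectral_poly A X ?v = of_real (cubic_form X (diag_form A X 1 v) (diag_form A X 2 v) (diag_form A X 3 v) (v$3))"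
      unfolding sp by (simp add: cubic_form_def diag_form_def)
    finally show ?thesis by (simp only: of_real_eq_0_iff)
  qed
  then show ?thesis unfolding real_part_def by blast
qed

text \<open>Grouped so that at the point from \<open>singular_point_exists\<close> the coefficients
  of \<open>d1\<close>, \<open>d2\<close>, \<open>d3\<close> become b1 s, b2 s, b3 s.\<close>

lemma cubic_form_deriv:
  fixes f1 f2 f3 v :: "complex \<Rightarrow> complex"
  assumes f: "(f1 has_field_derivative d1) (at t)" "(f2 has_field_derivative d2) (at t)"
    "(f3 has_field_derivative d3) (at t)" and v: "(v has_field_derivative dv) (at t)"
  shows "((\<lambda>t. cubic_form X (f1 t) (f2 t) (f3 t) (v t)) has_field_derivative
    d1 * (f2 t * f3 t - (v t)\<^sup>2 * of_real (edge1 X)) + d2 * (f3 t * f1 t - (v t)\<^sup>2 * of_real (edge2 X))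
    + d3 * (f1 t * f2 t - (v t)\<^sup>2 * of_real (edge3 X))
    + dv * (3 * of_real (cycle_fwd X + cycle_bwd X) * (v t)\<^sup>2
      - 2 * v t * (of_real (edge1 X) * f1 t + of_real (edge2 X) * f2 t + of_real (edge3 X) * f3 t))) (at t)"
  unfolding cubic_form_def
  by (rule DERIV_cong[OF DERIV_add[OF DERIV_diff[OF DERIV_mult[OF DERIV_mult[OF f(1,2)] f(3)]
          DERIV_mult[OF DERIV_power[OF v, of 2] DERIV_add[OF DERIV_add[OF DERIV_cmult[OF f(1)] DERIV_cmult[OF f(2)]]
            DERIV_cmult[OF f(3)]]]] DERIV_cmult[OF DERIV_power[OF v, of 3]]]])
     (simp add: algebra_simps power2_eq_square)

text \<open>At the point produced by a double root, the partial derivatives in z1 and z2 vanish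
  because (b1, b2, b3) is orthogonal to the diagonal of \<open>A\<close> and to (1, 1, 1). The one
  in z3 vanishes by the definition of \<beta> and the last equation of
  \<open>singular_point_exists\<close>.\<close>

lemma smooth_nondegenerate:
  fixes A X :: "real^3^3"
  assumes diag: "\<And>i j. i \<noteq> j \<Longrightarrow> A$i$j = 0" and smooth: "smooth_spectral_curve A X"
    and b: "b1 = \<eta> * (A$3$3 - A$2$2)" "b2 = \<eta> * (A$1$1 - A$3$3)" "b3 = \<eta> * (A$2$2 - A$1$1)"
    and bnz: "b1 \<noteq> 0" "b2 \<noteq> 0" "b3 \<noteq> 0"
    and \<beta>: "\<beta> = b1 * X$1$1 + b2 * X$2$2 + b3 * X$3$3"
    and u: "u1 = edge1 X" "u2 = edge2 X" "u3 = edge3 X" and r: "r = cycle_fwd X + cycle_bwd X"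
    and F: "(r + \<beta> * s)\<^sup>2 = 4 * (u1 + b1 * s) * (u2 + b2 * s) * (u3 + b3 * s)"
  shows "\<beta> * (r + \<beta> * s) \<noteq> 2 * (b1 * (u2 + b2 * s) * (u3 + b3 * s)
        + b2 * (u1 + b1 * s) * (u3 + b3 * s) + b3 * (u1 + b1 * s) * (u2 + b2 * s))"
proof
  assume dF: "\<beta> * (r + \<beta> * s) = 2 * (b1 * (u2 + b2 * s) * (u3 + b3 * s)
        + b2 * (u1 + b1 * s) * (u3 + b3 * s) + b3 * (u1 + b1 * s) * (u2 + b2 * s))"
  obtain M1 M2 M3 :: complex where M: "M2 * M3 = of_real (u1 + b1 * s)" "M3 * M1 = of_real (u2 + b2 * s)"
    "M1 * M2 = of_real (u3 + b3 * s)"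
    and Mb: "of_real b1 * M1 + of_real b2 * M2 + of_real b3 * M3 = of_real \<beta>"
    and MU: "2 * (of_real (u1 + b1 * s) * M1 + of_real (u2 + b2 * s) * M2 + of_real (u3 + b3 * s) * M3) = 3 * of_real (r + \<beta> * s)"
    using singular_point_exists[OF bnz F dF] by metis
  have sp: "spectral_poly A X z = cubic_form X (diag_form A X 1 z) (diag_form A X 2 z) (diag_form A X 3 z) (z$3)" for z
    by (rule spectral_poly_eq) (rule diag)
  define a1 a2 a3 x1 x2 x3 where "a1 = complex_of_real (A$1$1)" and "a2 = complex_of_real (A$2$2)" and "a3 = complex_of_real (A$3$3)"
    and "x1 = complex_of_real (X$1$1)" and "x2 = complex_of_real (X$2$2)" and "x3 = complex_of_real (X$3$3)"
  define B1 B2 B3 S where "B1 = complex_of_real b1" and "B2 = complex_of_real b2" and "B3 = complex_of_real b3"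
    and "S = complex_of_real s"
  have Bnz: "B3 \<noteq> 0" using bnz by (simp add: B3_def)
  have B: "B1 = of_real \<eta> * (a3 - a2)" "B2 = of_real \<eta> * (a1 - a3)" "B3 = of_real \<eta> * (a2 - a1)"
    unfolding B1_def B2_def B3_def b a1_def a2_def a3_def by simp_all
  have Bs: "B1 + B2 + B3 = 0" "a1 * B1 + a2 * B2 + a3 * B3 = 0" unfolding B by (simp_all add: algebra_simps)
  have Bx: "x1 * B1 + x2 * B2 + x3 * B3 = of_real \<beta>" unfolding \<beta> B1_def B2_def B3_def x1_def x2_def x3_def by (simp add: mult.commute)
  have a12: "a1 - a2 \<noteq> 0" using Bnz B(3) by auto
  \<comment> \<open>z1 and z2 solve the equations for m1 and m2 at z3 = 1; the one for m3 then
    follows from the linear relation, as b3 is nonzero.\<close>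
  define z1 where "z1 = (M1 - M2 - (x1 - x2)) / (a1 - a2)"
  define z2 where "z2 = x1 + a1 * z1 - M1"
  define z :: "complex^3" where "z = vector [z1, z2, 1]"
  have zc: "z$1 = z1" "z$2 = z2" "z$3 = 1" unfolding z_def by (simp_all add: vector_3)
  have z1: "z1 * (a1 - a2) = M1 - M2 - (x1 - x2)" unfolding z1_def using a12 by simp
  have f1: "x1 + a1 * z1 - z2 = M1" by (simp add: z2_def)
  have f2: "x2 + a2 * z1 - z2 = M2" using z1 by (simp add: z2_def algebra_simps)
  have f3: "x3 + a3 * z1 - z2 = M3"
  proof -
    have "B1 * (x1 + a1 * z1 - z2) + B2 * (x2 + a2 * z1 - z2) + B3 * (x3 + a3 * z1 - z2)
      = (x1 * B1 + x2 * B2 + x3 * B3) + z1 * (a1 * B1 + a2 * B2 + a3 * B3) - z2 * (B1 + B2 + B3)"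
      by (simp add: algebra_simps)
    also have "\<dots> = B1 * M1 + B2 * M2 + B3 * M3" unfolding Bs Bx Mb[folded B1_def B2_def B3_def] by simp
    finally have "B3 * (x3 + a3 * z1 - z2) = B3 * M3" unfolding f1 f2 by simp
    then show ?thesis using Bnz by simp
  qed
  have df: "diag_form A X 1 z = M1" "diag_form A X 2 z = M2" "diag_form A X 3 z = M3"
    using f1 f2 f3 unfolding diag_form_def zc a1_def a2_def a3_def x1_def x2_def x3_def by simp_all
  define E where "E = of_real u1 * M1 + of_real u2 * M2 + of_real u3 * M3"
  have MM: "M2 * M3 - of_real u1 = B1 * S" "M3 * M1 - of_real u2 = B2 * S" "M1 * M2 - of_real u3 = B3 * S"
    unfolding M B1_def B2_def B3_def S_def by simp_all
  have E2: "2 * E = 3 * of_real r + of_real \<beta> * S"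
  proof -
    have "2 * E + 2 * S * (B1 * M1 + B2 * M2 + B3 * M3) = 3 * of_real r + 3 * of_real \<beta> * S"
      using MU unfolding E_def B1_def B2_def B3_def S_def by (simp add: algebra_simps)
    then show ?thesis unfolding Mb[folded B1_def B2_def B3_def] by (simp add: algebra_simps)
  qed
  have zero: "spectral_poly A X z = 0"
  proof -
    have "2 * E + 2 * S * (B1 * M1 + B2 * M2 + B3 * M3) = 6 * (M1 * M2 * M3)"
    proof -
      have e: "of_real u1 + B1 * S = M2 * M3" "of_real u2 + B2 * S = M3 * M1" "of_real u3 + B3 * S = M1 * M2"
        using MM by (simp_all add: algebra_simps)
      have "2 * E + 2 * S * (B1 * M1 + B2 * M2 + B3 * M3) =
          2 * (M1 * (of_real u1 + B1 * S)) + 2 * (M2 * (of_real u2 + B2 * S)) + 2 * (M3 * (of_real u3 + B3 * S))"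
        unfolding E_def by (simp add: algebra_simps)
      then show ?thesis unfolding e by (simp add: algebra_simps)
    qed
    then have "6 * (M1 * M2 * M3) = 3 * of_real r + 3 * of_real \<beta> * S"
      unfolding E2 Mb[folded B1_def B2_def B3_def] by (simp add: algebra_simps)
    moreover have "6 * (M1 * M2 * M3 - E + of_real r) = 6 * (M1 * M2 * M3) - 3 * (2 * E) + 6 * of_real r"
      by (simp add: algebra_simps)
    ultimately have "6 * (M1 * M2 * M3 - E + of_real r) = 0" unfolding E2 by (simp add: algebra_simps)
    then have "M1 * M2 * M3 - E + of_real r = 0" by (simp only: mult_eq_0_iff) simp
    then show ?thesis unfolding sp df zc cubic_form_def u[symmetric] r[symmetric] E_def by simp
  qed
  have partial: "deriv (\<lambda>w. spectral_poly A X (\<chi> i. if i = j then w else z$i)) (z$j) = 0" for j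
  proof -
    define f where "f k = (\<lambda>w. diag_form A X k (\<chi> i. if i = j then w else z$i))" for k
    define v where "v = (\<lambda>w. if (3::3) = j then w else (1::complex))"
    define dk where "dk k = (if j = 1 then complex_of_real (A$k$k) else if j = 2 then - 1 else of_real (X$k$k))" for k
    define dv :: complex where "dv = (if j = 3 then 1 else 0)"
    have fz: "f k (z$j) = diag_form A X k z" for k
    proof -
      have "(\<chi> i. if i = j then z$j else z$i) = z" by (simp add: vec_eq_iff)
      then show ?thesis by (simp add: f_def)
    qed
    have vz: "v (z$j) = 1" using zc by (auto simp: v_def)
    have fd: "(f k has_field_derivative dk k) (at w)" for k w
      using exhaust_3[of j] unfolding f_def diag_form_def dk_def
      by (elim disjE; hypsubst) (auto intro!: derivative_eq_intros)
    have vd: "(v has_field_derivative dv) (at w)" for w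
      unfolding v_def dv_def by (cases "j = 3") (auto intro!: derivative_eq_intros)
    have eq: "(\<lambda>w. spectral_poly A X (\<chi> i. if i = j then w else z$i)) = (\<lambda>w. cubic_form X (f 1 w) (f 2 w) (f 3 w) (v w))"
      unfolding sp f_def v_def using zc by (auto simp: fun_eq_iff)
    have D0: "dk 1 * (B1 * S) + dk 2 * (B2 * S) + dk 3 * (B3 * S) + dv * (3 * of_real r - 2 * E) = 0"
    proof -
      consider "j = 1" | "j = 2" | "j = 3" using exhaust_3[of j] by blast
      then show ?thesis
      proof cases
        case 1
        have "dk 1 * (B1 * S) + dk 2 * (B2 * S) + dk 3 * (B3 * S) = S * (a1 * B1 + a2 * B2 + a3 * B3)"
          using 1 by (simp add: dk_def a1_def a2_def a3_def algebra_simps)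
        then show ?thesis using 1 by (simp add: Bs dv_def)
      next
        case 2
        have "dk 1 * (B1 * S) + dk 2 * (B2 * S) + dk 3 * (B3 * S) = - S * (B1 + B2 + B3)"
          using 2 by (simp add: dk_def algebra_simps)
        then show ?thesis using 2 by (simp add: Bs dv_def)
      next
        case 3
        have "dk 1 * (B1 * S) + dk 2 * (B2 * S) + dk 3 * (B3 * S) = S * (x1 * B1 + x2 * B2 + x3 * B3)"
          using 3 by (simp add: dk_def x1_def x2_def x3_def algebra_simps)
        also have "\<dots> = S * of_real \<beta>" unfolding Bx ..
        finally show ?thesis using 3 E2 by (simp add: dv_def algebra_simps)
      qed
    qed
    have "((\<lambda>w. cubic_form X (f 1 w) (f 2 w) (f 3 w) (v w)) has_field_derivative 0) (at (z$j))"
      using cubic_form_deriv[OF fd[of 1 "z$j"] fd[of 2 "z$j"] fd[of 3 "z$j"] vd[of "z$j"], of X]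
      unfolding fz vz df u[symmetric] r[symmetric] E_def[symmetric] power_one mult_1 mult_1_right MM D0 .
    then show ?thesis unfolding eq by (rule DERIV_imp_deriv)
  qed
  have "z \<noteq> 0" using zc(3) by (metis zero_index zero_neq_one)
  then show False using smooth zero partial unfolding smooth_spectral_curve_def by blast
qed

lemma linear_diag_form: "linear (diag_form A X k :: real^3 \<Rightarrow> real)"
  by (rule linearI) (simp_all add: diag_form_def algebra_simps)

text \<open>\<open>b1 + b2 + b3 = 0\<close> and the b-weighted sum of the diagonal of
  \<open>A\<close> is 0, so z1 and z2 cancel in the weighted sum of the diagonal forms and \<beta>
  z3 remains.\<close>

lemma pencil_cubic_spectral:
  fixes A X :: "real^3^3"
  assumes diag: "\<And>i j. i \<noteq> j \<Longrightarrow> A$i$j = 0" and smooth: "smooth_spectral_curve A X"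
    and b: "b1 = \<eta> * (A$3$3 - A$2$2)" "b2 = \<eta> * (A$1$1 - A$3$3)" "b3 = \<eta> * (A$2$2 - A$1$1)"
    and neg: "b1 * b2 * b3 < 0"
    and \<beta>: "\<beta> = b1 * X$1$1 + b2 * X$2$2 + b3 * X$3$3"
    and u: "u1 = edge1 X" "u2 = edge2 X" "u3 = edge3 X" and r: "r = cycle_fwd X + cycle_bwd X"
  shows "pencil_cubic (diag_form A X 1) (diag_form A X 2) (diag_form A X 3) (\<lambda>z. z$3) b1 b2 b3 \<beta> u1 u2 u3 r"
proof (rule pencil_cubic.intro)
  have bnz: "b1 \<noteq> 0" "b2 \<noteq> 0" "b3 \<noteq> 0" using neg by auto
  have Bs: "b1 + b2 + b3 = 0" "A$1$1 * b1 + A$2$2 * b2 + A$3$3 * b3 = 0" unfolding b by (simp_all add: algebra_simps)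
  have a12: "A$1$1 - A$2$2 \<noteq> 0" using bnz(3) b(3) by auto
  show "linear (diag_form A X 1 :: real^3 \<Rightarrow> real)" "linear (diag_form A X 2 :: real^3 \<Rightarrow> real)"
    "linear (diag_form A X 3 :: real^3 \<Rightarrow> real)" by (rule linear_diag_form)+
  show "linear (\<lambda>z::real^3. z$3)" by (rule linearI) simp_all
  have comb: "b1 * (X$1$1 * c + A$1$1 * z1 - z2) + b2 * (X$2$2 * c + A$2$2 * z1 - z2) + b3 * (X$3$3 * c + A$3$3 * z1 - z2) = \<beta> * c" for c z1 z2
  proof -
    have "b1 * (X$1$1 * c + A$1$1 * z1 - z2) + b2 * (X$2$2 * c + A$2$2 * z1 - z2) + b3 * (X$3$3 * c + A$3$3 * z1 - z2)
      = \<beta> * c + z1 * (A$1$1 * b1 + A$2$2 * b2 + A$3$3 * b3) - z2 * (b1 + b2 + b3)"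
      unfolding \<beta> by (simp add: algebra_simps)
    then show ?thesis unfolding Bs by simp
  qed
  show "b1 * diag_form A X 1 z + b2 * diag_form A X 2 z + b3 * diag_form A X 3 z = \<beta> * z$3" for z :: "real^3"
    using comb[of "z$3" "z$1" "z$2"] by (simp add: diag_form_def)
  show "z = 0" if "diag_form A X 1 z = 0" "diag_form A X 2 z = 0" "diag_form A X 3 z = 0" "z$3 = 0" for z :: "real^3"
  proof -
    have e: "A$1$1 * z$1 = z$2" "A$2$2 * z$1 = z$2" using that by (simp_all add: diag_form_def)
    then have "(A$1$1 - A$2$2) * z$1 = 0" by (simp add: algebra_simps)
    then have "z$1 = 0" using a12 by simp
    then show ?thesis using e that(4) by (simp add: vec_eq_iff forall_3)
  qed
  show "\<exists>z::real^3. diag_form A X 1 z = x1 \<and> diag_form A X 2 z = x2 \<and> diag_form A X 3 z = x3 \<and> z$3 = c"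
    if rel: "b1 * x1 + b2 * x2 + b3 * x3 = \<beta> * c" for x1 x2 x3 c
  proof -
    define z1 where "z1 = (x1 - x2 - (X$1$1 - X$2$2) * c) / (A$1$1 - A$2$2)"
    define z2 where "z2 = X$1$1 * c + A$1$1 * z1 - x1"
    have z1: "z1 * (A$1$1 - A$2$2) = x1 - x2 - (X$1$1 - X$2$2) * c" unfolding z1_def using a12 by simp
    have f1: "X$1$1 * c + A$1$1 * z1 - z2 = x1" by (simp add: z2_def)
    have f2: "X$2$2 * c + A$2$2 * z1 - z2 = x2" using z1 by (simp add: z2_def algebra_simps)
    have "b3 * (X$3$3 * c + A$3$3 * z1 - z2) = b3 * x3" using comb[of c z1 z2] rel unfolding f1 f2 by linarith
    then have f3: "X$3$3 * c + A$3$3 * z1 - z2 = x3" using bnz(3) by simp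
    show ?thesis
      by (rule exI[of _ "vector [z1, z2, c]"]) (simp add: diag_form_def vector_3 f1 f2 f3)
  qed
  show "b1 * b2 * b3 < 0" by (rule neg)
  show "\<beta> * (r + \<beta> * s) \<noteq> 2 * (b1 * (u2 + b2 * s) * (u3 + b3 * s)
        + b2 * (u1 + b1 * s) * (u3 + b3 * s) + b3 * (u1 + b1 * s) * (u2 + b2 * s))"
    if F: "(r + \<beta> * s)\<^sup>2 = 4 * (u1 + b1 * s) * (u2 + b2 * s) * (u3 + b3 * s)" for s
    by (rule smooth_nondegenerate[OF _ smooth b bnz \<beta> u r F]) (rule diag)
qed

lemma (in pencil_cubic) at_level_mem:
  assumes "at_level t v" "v \<noteq> 0"
  shows "proj_pt v \<in> curve_pos s \<longleftrightarrow> s < t" "proj_pt v \<in> curve_neg s \<longleftrightarrow> t < s"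
  using mem_curve_pos_neg[OF assms(2) at_level_Phi[OF assms(1)]] sep_form_level_sgn[OF assms] by auto

text \<open>Both vertices of an index lie over level 0, so the sign of \<open>s\<close> decides
  their piece.\<close>

lemma vertices_in_components:
  fixes A X :: "real^3^3" and s :: real
  assumes P: "pencil_cubic (diag_form A X i) (diag_form A X j) (diag_form A X k) (\<lambda>z. z$3) b1 b2 b3 \<beta> u1 u2 u3 r"
    and u: "u1 = X$j$k * X$k$j" "u2 = X$k$i * X$i$k" "u3 = X$i$j * X$j$i"
    and r: "r = X$i$j * X$j$k * X$k$i + X$i$k * X$k$j * X$j$i"
  defines "pos \<equiv> pencil_cubic.curve_pos (diag_form A X i) (diag_form A X j) (diag_form A X k) (\<lambda>z. z$3) b1 b2 b3 \<beta> u1 u2 u3 r s"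
    and "neg \<equiv> pencil_cubic.curve_neg (diag_form A X i) (diag_form A X j) (diag_form A X k) (\<lambda>z. z$3) b1 b2 b3 \<beta> u1 u2 u3 r s"
  shows "s < 0 \<Longrightarrow> vertex_P A X i j k \<in> pos \<and> vertex_Q A X i j k \<in> pos"
    and "0 < s \<Longrightarrow> vertex_P A X i j k \<in> neg \<and> vertex_Q A X i j k \<in> neg"
proof -
  interpret pencil_cubic "diag_form A X i" "diag_form A X j" "diag_form A X k" "\<lambda>z. z$3" b1 b2 b3 \<beta> u1 u2 u3 r
    by (rule P)
  have line: "minor_line A X p q l = {proj_pt z | z. z \<noteq> 0 \<and> X$l$p * X$q$l * z$3 - X$q$p * diag_form A X l z = 0}" for p q l
    unfolding minor_line_def minor_form_def diag_form_def by simp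
  obtain v where v: "v \<noteq> 0" "at_level 0 v"
    "{proj_pt z | z. z \<noteq> 0 \<and> X$k$i * X$j$k * z$3 - X$j$i * diag_form A X k z = 0} \<inter>
     {proj_pt z | z. z \<noteq> 0 \<and> X$j$i * X$k$j * z$3 - X$k$i * diag_form A X j z = 0} = {proj_pt v}"
    using vertex[of "X$j$k" "X$k$j" "X$k$i" "X$i$k" "X$i$j" "X$j$i", OF u r] by blast
  have vP: "vertex_P A X i j k = proj_pt v"
    unfolding vertex_P_def line[of i j k] line[of i k j] using v(3) by (simp add: mult.commute)
  have u': "u1 = X$k$j * X$j$k" "u2 = X$i$k * X$k$i" "u3 = X$j$i * X$i$j"
    and r': "r = X$j$i * X$k$j * X$i$k + X$k$i * X$j$k * X$i$j" using u r by (simp_all add: ac_simps)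
  obtain v' where v': "v' \<noteq> 0" "at_level 0 v'"
    "{proj_pt z | z. z \<noteq> 0 \<and> X$i$k * X$k$j * z$3 - X$i$j * diag_form A X k z = 0} \<inter>
     {proj_pt z | z. z \<noteq> 0 \<and> X$i$j * X$j$k * z$3 - X$i$k * diag_form A X j z = 0} = {proj_pt v'}"
    using vertex[of "X$k$j" "X$j$k" "X$i$k" "X$k$i" "X$j$i" "X$i$j", OF u' r'] by blast
  have vQ: "vertex_Q A X i j k = proj_pt v'"
    unfolding vertex_Q_def line[of j i k] line[of k i j] using v'(3) by (simp add: mult.commute)
  show "s < 0 \<Longrightarrow> vertex_P A X i j k \<in> pos \<and> vertex_Q A X i j k \<in> pos"
    "0 < s \<Longrightarrow> vertex_P A X i j k \<in> neg \<and> vertex_Q A X i j k \<in> neg"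
    unfolding vP vQ pos_def neg_def using at_level_mem[OF v(2,1)] at_level_mem[OF v'(2,1)] by blast+
qed

section \<open>Behaviour of the flow on either side of the gap\<close>

lemma flow_no_global_solution:
  fixes A :: "real^3^3" and x :: "real \<Rightarrow> real^3^3"
  assumes diag: "\<And>i j. i \<noteq> j \<Longrightarrow> A$i$j = 0" and \<eta>: "\<eta> * \<eta> = 1"
    and b: "b1 = \<eta> * (A$3$3 - A$2$2)" "b2 = \<eta> * (A$1$1 - A$3$3)" "b3 = \<eta> * (A$2$2 - A$1$1)" and b1: "b1 \<noteq> 0"
    and \<beta>: "\<beta> = b1 * x 0$1$1 + b2 * x 0$2$2 + b3 * x 0$3$3"
    and u: "u1 = edge1 (x 0)" "u2 = edge2 (x 0)" "u3 = edge3 (x 0)" and r: "r = cycle_fwd (x 0) + cycle_bwd (x 0)"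
    and x: "\<And>t. t \<ge> 0 \<Longrightarrow> (x has_vector_derivative flow_field A (x t)) (at t within {0..})"
    and F: "\<And>s. (r + \<beta> * s)\<^sup>2 - 4 * (u1 + b1 * s) * (u2 + b2 * s) * (u3 + b3 * s)
      = (s - s3) * (k2 * (s - s3)\<^sup>2 + k1 * (s - s3) + k0)"
    and k2: "k2 > 0" and K: "\<And>v. v \<ge> 0 \<Longrightarrow> k2 * v\<^sup>2 + k1 * v + k0 > 0" and s3: "s3 \<le> 0"
  shows False
proof -
  have x': "(x has_vector_derivative flow_field A (x t)) (at t within {0..})" if "t \<in> {0..}" for t using x that by simp
  have k0: "k0 > 0" using K[of 0] by simp
  \<comment> \<open>Both sides are derivatives at \<open>s\<close> of the same function, written in
    its two forms.\<close>
  have dF: "2 * (\<beta> * (r + \<beta> * s) - 2 * (b1 * (u2 + b2 * s) * (u3 + b3 * s)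
      + b2 * (u1 + b1 * s) * (u3 + b3 * s) + b3 * (u1 + b1 * s) * (u2 + b2 * s)))
    = 3 * k2 * (s - s3)\<^sup>2 + 2 * k1 * (s - s3) + k0" for s
  proof -
    have "((\<lambda>s. (r + \<beta> * s)\<^sup>2 - 4 * (u1 + b1 * s) * (u2 + b2 * s) * (u3 + b3 * s)) has_real_derivative
      2 * (\<beta> * (r + \<beta> * s) - 2 * (b1 * (u2 + b2 * s) * (u3 + b3 * s)
      + b2 * (u1 + b1 * s) * (u3 + b3 * s) + b3 * (u1 + b1 * s) * (u2 + b2 * s)))) (at s)"
      by (auto intro!: derivative_eq_intros simp: algebra_simps)
    moreover have "((\<lambda>s. (s - s3) * (k2 * (s - s3)\<^sup>2 + k1 * (s - s3) + k0)) has_real_derivative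
      3 * k2 * (s - s3)\<^sup>2 + 2 * k1 * (s - s3) + k0) (at s)"
      by (auto intro!: derivative_eq_intros simp: algebra_simps power2_eq_square)
    ultimately show ?thesis unfolding F by (rule DERIV_unique)
  qed
  have J: "convex {0::real..}" "(0::real) \<in> {0..}" by simp_all
  show False
  proof (rule flow_reduction[where J = "{0..}", OF _ J x' \<eta> b b1 \<beta> u r])
    show "i \<noteq> j \<Longrightarrow> A$i$j = 0" for i j by (rule diag)
  next
    fix s y assume s0: "s 0 = 0"
      and s: "\<And>t. t \<in> {0..} \<Longrightarrow> (s has_real_derivative y t) (at t within {0..})"
      and y: "\<And>t. t \<in> {0..} \<Longrightarrow> (y has_real_derivative \<beta> * (r + \<beta> * s t) - 2 * (b1 * (u2 + b2 * s t) * (u3 + b3 * s t)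
        + b2 * (u1 + b1 * s t) * (u3 + b3 * s t) + b3 * (u1 + b1 * s t) * (u2 + b2 * s t))) (at t within {0..})"
      and y2: "\<And>t. t \<in> {0..} \<Longrightarrow> (y t)\<^sup>2 = (r + \<beta> * s t)\<^sup>2 - 4 * (u1 + b1 * s t) * (u2 + b2 * s t) * (u3 + b3 * s t)"
    \<comment> \<open>\<open>K\<close> controls the quadratic factor only for v \<ge> 0. Its value
      at 0 is k0 > 0, and \<epsilon> is so small that it stays positive on [- \<epsilon>, 0]; so
      \<open>F\<close> is negative just below \<open>s3\<close>.\<close>
    define \<epsilon> where "\<epsilon> = k0 / (2 * (\<bar>k1\<bar> + 1))"
    have "\<epsilon> > 0" unfolding \<epsilon>_def using k0 by (intro divide_pos_pos) auto
    moreover have "(\<bar>k1\<bar> + 1) * \<epsilon> = k0 / 2"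
    proof -
      have h: "c * (k0 / (2 * c)) = k0 / 2" if "c > 0" for c using that by simp
      have "\<bar>k1\<bar> + 1 > 0" by simp
      then show ?thesis unfolding \<epsilon>_def by (rule h)
    qed
    ultimately have \<epsilon>: "\<epsilon> > 0" "\<bar>k1\<bar> * \<epsilon> < k0" using k0 by (simp_all add: distrib_right)
    have ge: "s t \<ge> s3" if t: "t \<ge> 0" for t
    proof (rule level_stays_above[where J = "{0..}" and a = "s3 - 1" and y = y and s = s and t = t])
      fix c assume c: "s3 - 1 < c" "c < s3"
      define m where "m = max c (s3 - \<epsilon>)"
      have m: "c \<le> m" "m < s3" "s3 - m \<le> \<epsilon>" using c \<epsilon> by (auto simp: m_def)
      have "k1 * (m - s3) \<ge> - (\<bar>k1\<bar> * \<epsilon>)"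
      proof -
        have "\<bar>k1 * (m - s3)\<bar> \<le> \<bar>k1\<bar> * \<epsilon>" unfolding abs_mult using m by (intro mult_left_mono) auto
        then show ?thesis by linarith
      qed
      moreover have "k2 * (m - s3)\<^sup>2 \<ge> 0" using k2 by simp
      ultimately have "k2 * (m - s3)\<^sup>2 + k1 * (m - s3) + k0 > 0" using \<epsilon>(2) by linarith
      then have neg: "(m - s3) * (k2 * (m - s3)\<^sup>2 + k1 * (m - s3) + k0) < 0" using m(2) by (intro mult_neg_pos) auto
      have "s u \<noteq> m" if "u \<in> {0..}" for u
        using y2[OF that] neg unfolding F by (metis not_less zero_le_power2)
      then show "\<exists>m. c \<le> m \<and> m < s3 \<and> (\<forall>t\<in>{0..}. s t \<noteq> m)" using m by blast
    qed (use s s0 s3 t in auto)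
    define v where "v t = s t - s3" for t
    show False
    proof (rule unbounded_component_no_global_solution[where v = v and y = y and ?k2.0 = k2 and ?k1.0 = k1 and ?k0.0 = k0])
      show "(v has_real_derivative y t) (at t within {0..})" if "t \<ge> 0" for t
        unfolding v_def using DERIV_diff[OF s[of t] DERIV_const[of s3]] that by simp
      show "(y has_real_derivative (3 * k2 * (v t)\<^sup>2 + 2 * k1 * v t + k0) / 2) (at t within {0..})" if "t \<ge> 0" for t
      proof -
        have half: "2 * a / 2 = a" for a :: real by simp
        show ?thesis unfolding v_def dF[symmetric] half by (rule y) (use that in simp)
      qed
      show "(y t)\<^sup>2 = v t * (k2 * (v t)\<^sup>2 + k1 * v t + k0)" if "t \<ge> 0" for t
        using y2[of t] that unfolding F v_def by simp
      show "v t \<ge> 0" if "t \<ge> 0" for t using ge[OF that] by (simp add: v_def)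
    qed (use k2 K in auto)
  qed
qed

text \<open>y^2 = F(s) keeps \<open>F\<close> nonnegative along the solution. Starting at 0 \<le>
  x2, \<open>s\<close> cannot cross the gap and stays in [x1, x2], which bounds the edge
  products.\<close>

lemma flow_bounded_component:
  fixes A :: "real^3^3" and x :: "real \<Rightarrow> real^3^3"
  assumes diag: "\<And>i j. i \<noteq> j \<Longrightarrow> A$i$j = 0" and \<eta>: "\<eta> * \<eta> = 1"
    and b: "b1 = \<eta> * (A$3$3 - A$2$2)" "b2 = \<eta> * (A$1$1 - A$3$3)" "b3 = \<eta> * (A$2$2 - A$1$1)" and b1: "b1 \<noteq> 0"
    and \<beta>: "\<beta> = b1 * x 0$1$1 + b2 * x 0$2$2 + b3 * x 0$3$3"
    and u: "u1 = edge1 (x 0)" "u2 = edge2 (x 0)" "u3 = edge3 (x 0)" and r: "r = cycle_fwd (x 0) + cycle_bwd (x 0)"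
    and T: "T > 0" and x: "\<And>t. t \<in> {0..<T} \<Longrightarrow> (x has_vector_derivative flow_field A (x t)) (at t within {0..<T})"
    and F: "\<And>s. (r + \<beta> * s)\<^sup>2 - 4 * (u1 + b1 * s) * (u2 + b2 * s) * (u3 + b3 * s) = k2 * (s - x1) * (s - x2) * (s - x3)"
    and k2: "k2 > 0" and x12: "x1 < x2" and x23: "x2 < x3" and x2: "0 \<le> x2"
  shows "\<exists>C. \<forall>t\<in>{0..<T}. norm (x t) \<le> C"
proof -
  have J: "convex {0..<T}" "0 \<in> {0..<T}" using T by simp_all
  show ?thesis
  proof (rule flow_reduction[where J = "{0..<T}", OF _ J x \<eta> b b1 \<beta> u r])
    show "i \<noteq> j \<Longrightarrow> A$i$j = 0" for i j by (rule diag)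
  next
    fix s y assume s0: "s 0 = 0"
      and s: "\<And>t. t \<in> {0..<T} \<Longrightarrow> (s has_real_derivative y t) (at t within {0..<T})"
      and y2: "\<And>t. t \<in> {0..<T} \<Longrightarrow> (y t)\<^sup>2 = (r + \<beta> * s t)\<^sup>2 - 4 * (u1 + b1 * s t) * (u2 + b2 * s t) * (u3 + b3 * s t)"
      and e: "\<And>t. t \<in> {0..<T} \<Longrightarrow> edge1 (x t) = u1 + b1 * s t" "\<And>t. t \<in> {0..<T} \<Longrightarrow> edge2 (x t) = u2 + b2 * s t"
        "\<And>t. t \<in> {0..<T} \<Longrightarrow> edge3 (x t) = u3 + b3 * s t" and dc: "\<And>t i. t \<in> {0..<T} \<Longrightarrow> x t $ i $ i = x 0 $ i $ i"
    have F0: "k2 * (s t - x1) * (s t - x2) * (s t - x3) \<ge> 0" if "t \<in> {0..<T}" for t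
      using y2[OF that] unfolding F by (metis zero_le_power2)
    have le: "s t \<le> x2" if t: "t \<in> {0..<T}" for t
    proof -
      have "- s t \<ge> - x2"
      proof (rule level_stays_above[where J = "{0..<T}" and a = "- x3" and y = "\<lambda>t. - y t" and s = "\<lambda>t. - s t"])
        fix c assume c: "- x3 < c" "c < - x2"
        have "k2 * (- c - x1) * (- c - x2) * (- c - x3) < 0"
          using c k2 x12 by (intro mult_pos_neg mult_pos_pos) auto
        then have "- s t \<noteq> c" if "t \<in> {0..<T}" for t using F0[OF that] by (metis minus_minus not_less)
        then show "\<exists>m. c \<le> m \<and> m < - x2 \<and> (\<forall>t\<in>{0..<T}. - s t \<noteq> m)" using c by blast
      qed (use s s0 x2 x23 t J in \<open>auto intro!: DERIV_minus simp: is_interval_convex_1\<close>)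
      then show ?thesis by simp
    qed
    have ge: "s t \<ge> x1" if t: "t \<in> {0..<T}" for t
    proof (rule ccontr)
      assume "\<not> s t \<ge> x1"
      then have "k2 * (x1 - s t) * (x2 - s t) * (x3 - s t) > 0" using k2 x12 x23 by (intro mult_pos_pos) auto
      moreover have "k2 * (x1 - s t) * (x2 - s t) * (x3 - s t) = - (k2 * (s t - x1) * (s t - x2) * (s t - x3))"
        by (simp add: algebra_simps)
      ultimately show False using F0[OF t] by linarith
    qed
    define M where "M = \<bar>x1\<bar> + \<bar>x2\<bar>"
    have sM: "\<bar>s t\<bar> \<le> M" if "t \<in> {0..<T}" for t using le[OF that] ge[OF that] unfolding M_def by linarith
    have lb: "\<bar>p + q * s t\<bar> \<le> \<bar>p\<bar> + \<bar>q\<bar> * M" if "t \<in> {0..<T}" for p q t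
    proof -
      have "\<bar>q * s t\<bar> \<le> \<bar>q\<bar> * M" unfolding abs_mult using sM[OF that] by (intro mult_left_mono) auto
      then show ?thesis by linarith
    qed
    define B where "B = (\<bar>u1\<bar> + \<bar>b1\<bar> * M) + (\<bar>u2\<bar> + \<bar>b2\<bar> * M) + (\<bar>u3\<bar> + \<bar>b3\<bar> * M)"
    have nn: "\<bar>p\<bar> + \<bar>q\<bar> * M \<ge> 0" for p q unfolding M_def by simp
    show ?thesis
    proof (rule flow_bounded[where B = B, OF _ x dc])
      show "i \<noteq> j \<Longrightarrow> A$i$j = 0" for i j by (rule diag)
      show "\<bar>edge1 (x t)\<bar> \<le> B \<and> \<bar>edge2 (x t)\<bar> \<le> B \<and> \<bar>edge3 (x t)\<bar> \<le> B" if t: "t \<in> {0..<T}" for t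
      proof -
        have le_sum: "\<lbrakk>d1 \<le> c1; d2 \<le> c2; d3 \<le> c3; 0 \<le> c1; 0 \<le> c2; 0 \<le> c3\<rbrakk> \<Longrightarrow>
            d1 \<le> c1 + c2 + c3 \<and> d2 \<le> c1 + c2 + c3 \<and> d3 \<le> c1 + c2 + c3" for d1 d2 d3 c1 c2 c3 :: real by simp
        show ?thesis
          unfolding e(1)[OF t] e(2)[OF t] e(3)[OF t] B_def by (rule le_sum[OF lb[OF t] lb[OF t] lb[OF t] nn nn nn])
      qed
    qed
  qed
qed

lemma count_in_two_sets:
  assumes NC: "N \<inter> C = {}" "N \<noteq> C" and S: "S1 = N \<or> S1 = C" "S2 = N \<or> S2 = C" "S3 = N \<or> S3 = C"
    and v: "P1 \<in> S1 \<and> Q1 \<in> S1" "P2 \<in> S2 \<and> Q2 \<in> S2" "P3 \<in> S3 \<and> Q3 \<in> S3"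
  shows "length (filter (\<lambda>v. v \<in> C) [P1, Q2, P3, Q1, P2, Q3]) =
      (if S1 = C then 2 else 0) + (if S2 = C then 2 else 0) + (if S3 = C then 2 else 0)"
    and "length (filter (\<lambda>v. v \<in> N) [P1, Q2, P3, Q1, P2, Q3]) =
      (if S1 = N then 2 else 0) + (if S2 = N then 2 else 0) + (if S3 = N then 2 else 0)"
proof -
  have mem: "x \<in> C \<longleftrightarrow> S = C" "x \<in> N \<longleftrightarrow> S = N" if "x \<in> S" "S = N \<or> S = C" for x S
    using that NC by blast+
  have in_C: "P1 \<in> C \<longleftrightarrow> S1 = C" "Q1 \<in> C \<longleftrightarrow> S1 = C" "P2 \<in> C \<longleftrightarrow> S2 = C" "Q2 \<in> C \<longleftrightarrow> S2 = C"
    "P3 \<in> C \<longleftrightarrow> S3 = C" "Q3 \<in> C \<longleftrightarrow> S3 = C"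
    using v S by (blast intro!: mem(1))+
  have in_N: "P1 \<in> N \<longleftrightarrow> S1 = N" "Q1 \<in> N \<longleftrightarrow> S1 = N" "P2 \<in> N \<longleftrightarrow> S2 = N" "Q2 \<in> N \<longleftrightarrow> S2 = N"
    "P3 \<in> N \<longleftrightarrow> S3 = N" "Q3 \<in> N \<longleftrightarrow> S3 = N"
    using v S by (blast intro!: mem(2))+
  show "length (filter (\<lambda>v. v \<in> C) [P1, Q2, P3, Q1, P2, Q3]) =
      (if S1 = C then 2 else 0) + (if S2 = C then 2 else 0) + (if S3 = C then 2 else 0)"
    by (simp add: in_C)
  show "length (filter (\<lambda>v. v \<in> N) [P1, Q2, P3, Q1, P2, Q3]) =
      (if S1 = N then 2 else 0) + (if S2 = N then 2 else 0) + (if S3 = N then 2 else 0)"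
    by (simp add: in_N)
qed

theorem theorem2p13:
  fixes A X :: "real^3^3"
  assumes diagonal: "\<And>i j. i \<noteq> j \<Longrightarrow> A$i$j = 0"
    and distinct_entries: "\<And>i j. i \<noteq> j \<Longrightarrow> A$i$i \<noteq> A$j$j"
    and smooth: "smooth_spectral_curve A X"
  shows "(card (ovals A X) = 1 \<longrightarrow> blows_up A X) \<and>
    (card (ovals A X) = 2 \<longrightarrow>
      (blows_up A X \<longleftrightarrow> hexagon_type A X 0 6 \<or> hexagon_type A X 4 2) \<and>
      (hexagon_type A X 6 0 \<or> hexagon_type A X 2 4 \<longrightarrow> exists_for_all_times A X))"
proof -
  define p where "p = (A$3$3 - A$2$2) * (A$1$1 - A$3$3) * (A$2$2 - A$1$1)"
  \<comment> \<open>Changing the sign of all three factors changes that of their product; this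
    choice makes \<open>b1 * b2 * b3\<close> negative.\<close>
  define \<eta> :: real where "\<eta> = (if p < 0 then 1 else - 1)"
  define b1 b2 b3 where b: "b1 = \<eta> * (A$3$3 - A$2$2)" "b2 = \<eta> * (A$1$1 - A$3$3)" "b3 = \<eta> * (A$2$2 - A$1$1)"
  define \<beta> where "\<beta> = b1 * X$1$1 + b2 * X$2$2 + b3 * X$3$3"
  define u1 u2 u3 r where u: "u1 = edge1 X" "u2 = edge2 X" "u3 = edge3 X" and r: "r = cycle_fwd X + cycle_bwd X"
  have \<eta>: "\<eta> * \<eta> = 1" by (simp add: \<eta>_def)
  have nz: "p \<noteq> 0"
    unfolding p_def using distinct_entries[of 3 2] distinct_entries[of 1 3] distinct_entries[of 2 1] by simp
  have "b1 * b2 * b3 = (\<eta> * \<eta>) * \<eta> * p"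
    unfolding b p_def by (simp only: ac_simps)
  then have neg: "b1 * b2 * b3 < 0" using nz unfolding \<eta> by (auto simp: \<eta>_def)
  then have b1nz: "b1 \<noteq> 0" by auto
  let ?m1 = "diag_form A X 1 :: real^3 \<Rightarrow> real" and ?m2 = "diag_form A X 2 :: real^3 \<Rightarrow> real"
    and ?m3 = "diag_form A X 3 :: real^3 \<Rightarrow> real" and ?w = "\<lambda>z::real^3. z$3"
  interpret P: pencil_cubic ?m1 ?m2 ?m3 ?w b1 b2 b3 \<beta> u1 u2 u3 r
    by (rule pencil_cubic_spectral[OF _ smooth b neg \<beta>_def u r]) (rule diagonal)
  interpret P2: pencil_cubic ?m2 ?m3 ?m1 ?w b2 b3 b1 \<beta> u2 u3 u1 r by (rule P.rotate)
  interpret P3: pencil_cubic ?m3 ?m1 ?m2 ?w b3 b1 b2 \<beta> u3 u1 u2 r by (rule P2.rotate)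
  have "real_part A X = P.curve"
  proof -
    have "real_part A X = {proj_pt v | v. v \<noteq> 0 \<and> cubic_form X (?m1 v) (?m2 v) (?m3 v) (v$3) = 0}"
      by (rule real_part_eq) (rule diagonal)
    moreover have "cubic_form X (?m1 v) (?m2 v) (?m3 v) (v$3) = P.Phi v" for v
      unfolding cubic_form_def P.Phi_def unfolding u r by simp
    ultimately show ?thesis unfolding P.curve_def by simp
  qed
  then have ovals: "ovals A X = connected_components_of (subtopology rp2 P.curve)"
    unfolding ovals_def by simp
  let ?F = "\<lambda>s. (r + \<beta> * s)\<^sup>2 - 4 * (u1 + b1 * s) * (u2 + b2 * s) * (u3 + b3 * s)"
  define k2 where "k2 = - 4 * (b1 * b2 * b3)"
  have k2: "k2 > 0" unfolding k2_def by (rule P.leading_coeff_pos)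
  \<comment> \<open>Transposition exchanges the two 3-cycles and fixes diagonal entries and edge
    products, so forward and backward motion have the same data.\<close>
  have inv: "\<beta> = b1 * Y$1$1 + b2 * Y$2$2 + b3 * Y$3$3" "u1 = edge1 Y" "u2 = edge2 Y" "u3 = edge3 Y"
    "r = cycle_fwd Y + cycle_bwd Y" if "Y = X \<or> Y = transpose X" for Y
    using that unfolding \<beta>_def u r edge1_def edge2_def edge3_def cycle_fwd_def cycle_bwd_def
    by (elim disjE; simp add: transpose_def ac_simps)+
  have blow: "blows_up A X"
    if F: "\<And>s. P.F s = (s - s3) * (k2 * (s - s3)\<^sup>2 + k1 * (s - s3) + k0)"
      and K: "\<And>v. v \<ge> 0 \<Longrightarrow> k2 * v\<^sup>2 + k1 * v + k0 > 0" and s3: "s3 \<le> 0" for s3 k1 k0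
  proof (rule blows_up_if_no_global)
    show "i \<noteq> j \<Longrightarrow> A$i$j = 0" for i j by (rule diagonal)
    fix Y x assume Y: "Y = X \<or> Y = transpose X" and x0: "x 0 = Y"
      and x: "\<And>t. t \<ge> 0 \<Longrightarrow> (x has_vector_derivative flow_field A (x t)) (at t within {0..})"
    show False
      by (rule flow_no_global_solution[OF _ \<eta> b b1nz inv[OF Y, folded x0] x F[unfolded P.F_def] k2 K s3])
         (auto simp: diagonal)
  qed
  have F00: "P.F 0 \<ge> 0"
  proof -
    have "P.F 0 = (cycle_fwd X - cycle_bwd X)\<^sup>2"
      unfolding P.F_def unfolding u r edge1_def edge2_def edge3_def cycle_fwd_def cycle_bwd_def
      by (simp add: algebra_simps power2_eq_square)
    then show ?thesis by simp
  qed
  show ?thesis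
  proof (rule P.F_root_cases)
    fix s3 k1 k0 assume "\<And>s. P.F s = (s - s3) * (- 4 * (b1 * b2 * b3) * (s - s3)\<^sup>2 + k1 * (s - s3) + k0)"
      and "k1\<^sup>2 < 4 * (- 4 * (b1 * b2 * b3)) * k0"
    then have F: "\<And>s. P.F s = (s - s3) * (k2 * (s - s3)\<^sup>2 + k1 * (s - s3) + k0)" and D: "k1\<^sup>2 < 4 * k2 * k0"
      unfolding k2_def by blast+
    have K: "k2 * v\<^sup>2 + k1 * v + k0 > 0" for v by (rule quadratic_pos[OF k2 D])
    have "s3 \<le> 0"
    proof -
      have "(0 - s3) * (k2 * (0 - s3)\<^sup>2 + k1 * (0 - s3) + k0) \<ge> 0" using F00 unfolding F .
      then have "0 - s3 \<ge> 0" using K[of "0 - s3"] by (metis mult_neg_pos not_less)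
      then show ?thesis by simp
    qed
    then have "blows_up A X" using blow[OF F] K by blast
    moreover have "card (ovals A X) \<noteq> 2"
    proof -
      have "connectedin rp2 P.curve" by (rule P.connectedin_curve_one_root[OF F k2_def D])
      then have "connected_space (subtopology rp2 P.curve)" by (simp add: connectedin_def)
      then have "ovals A X \<subseteq> {topspace (subtopology rp2 P.curve)}"
        unfolding ovals using connected_components_of_subset_sing by blast
      then have "card (ovals A X) \<le> card {topspace (subtopology rp2 P.curve)}" by (intro card_mono) auto
      then show ?thesis by simp
    qed
    ultimately show ?thesis by blast
  next
    fix x1 x2 x3 assume x: "x1 < x2" "x2 < x3"
      and Fs: "\<And>s. P.F s = - 4 * (b1 * b2 * b3) * (s - x1) * (s - x2) * (s - x3)"
    have F: "\<And>s. P.F s = k2 * (s - x1) * (s - x2) * (s - x3)" unfolding k2_def by (rule Fs)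
    define s where "s = (x2 + x3) / 2"
    have s: "x2 < s" "s < x3" using x by (simp_all add: s_def)
    have "card (ovals A X) \<noteq> 1" unfolding ovals by (rule P.two_components(3)[OF x Fs s])
    moreover have "(blows_up A X \<longleftrightarrow> hexagon_type A X 0 6 \<or> hexagon_type A X 4 2) \<and>
      (hexagon_type A X 6 0 \<or> hexagon_type A X 2 4 \<longrightarrow> exists_for_all_times A X)"
      if card: "card (ovals A X) = 2"
    proof -
      obtain N C where NC: "ovals A X = {N, C}" "N \<inter> C = {}" "contractible_in_rp2 C" "\<not> contractible_in_rp2 N"
        and t1: "P.curve_pos s = N \<and> P.curve_neg s = C \<or> P.curve_pos s = C \<and> P.curve_neg s = N"
        and t2: "P2.curve_pos s = N \<and> P2.curve_neg s = C \<or> P2.curve_pos s = C \<and> P2.curve_neg s = N"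
        and t3: "P3.curve_pos s = N \<and> P3.curve_neg s = C \<or> P3.curve_pos s = C \<and> P3.curve_neg s = N"
        and tt: "P.curve_pos s = N \<and> P2.curve_pos s = P3.curve_pos s \<or>
          P2.curve_pos s = N \<and> P3.curve_pos s = P.curve_pos s \<or> P3.curve_pos s = N \<and> P.curve_pos s = P2.curve_pos s"
        by (rule P.component_types[OF x Fs s card[unfolded ovals], folded ovals]) (rule that; assumption)
      have CN: "C \<noteq> N" using NC(3,4) by blast
      have type: "hexagon_type A X m n \<longleftrightarrow> length (filter (\<lambda>v. v \<in> C) (hexagon A X)) = m \<and>
          length (filter (\<lambda>v. v \<in> N) (hexagon A X)) = n" for m n
        unfolding hexagon_type_def NC(1) using NC(3,4) by blast
      have uu: "u1 = X$2$3 * X$3$2" "u2 = X$3$1 * X$1$3" "u3 = X$1$2 * X$2$1"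
        and rr: "r = X$1$2 * X$2$3 * X$3$1 + X$1$3 * X$3$2 * X$2$1"
        by (simp_all add: u r edge1_def edge2_def edge3_def cycle_fwd_def cycle_bwd_def)
      have rr2: "r = X$2$3 * X$3$1 * X$1$2 + X$2$1 * X$1$3 * X$3$2"
        and rr3: "r = X$3$1 * X$1$2 * X$2$3 + X$3$2 * X$2$1 * X$1$3"
        unfolding rr by (simp_all add: ac_simps)
      note v1 = vertices_in_components[where s = s, OF P.pencil_cubic_axioms uu rr]
      note v2 = vertices_in_components[where s = s, OF P2.pencil_cubic_axioms uu(2,3,1) rr2]
      note v3 = vertices_in_components[where s = s, OF P3.pencil_cubic_axioms uu(3,1,2) rr3]
      note count_pos = count_in_two_sets[OF NC(2) CN[symmetric] _ _ _ v1(1) v2(1) v3(1), folded hexagon_def]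
      note count_neg = count_in_two_sets[OF NC(2) CN[symmetric] _ _ _ v1(2) v2(2) v3(2), folded hexagon_def]
      \<comment> \<open>\<open>N\<close> contains one or three of the points at infinity. For
        \<open>s < 0\<close> the vertices of each index lie on the oval of its point at infinity,
        which gives type (4,2) or (0,6).\<close>
      have pos_cases: "P.curve_pos s = N \<and> P2.curve_pos s = N \<and> P3.curve_pos s = N \<or>
        P.curve_pos s = N \<and> P2.curve_pos s = C \<and> P3.curve_pos s = C \<or>
        P.curve_pos s = C \<and> P2.curve_pos s = N \<and> P3.curve_pos s = C \<or>
        P.curve_pos s = C \<and> P2.curve_pos s = C \<and> P3.curve_pos s = N"
        using t1 t2 t3 tt CN by (elim disjE conjE) simp_all
      \<comment> \<open>For \<open>0 < s\<close> the vertices of each index lie on the other oval,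
        which gives type (2,4) or (6,0).\<close>
      have neg_cases: "P.curve_neg s = C \<and> P2.curve_neg s = C \<and> P3.curve_neg s = C \<or>
        P.curve_neg s = C \<and> P2.curve_neg s = N \<and> P3.curve_neg s = N \<or>
        P.curve_neg s = N \<and> P2.curve_neg s = C \<and> P3.curve_neg s = N \<or>
        P.curve_neg s = N \<and> P2.curve_neg s = N \<and> P3.curve_neg s = C"
        using t1 t2 t3 pos_cases CN by (elim disjE conjE) simp_all
      have pos_NC: "P.curve_pos s = N \<or> P.curve_pos s = C" "P2.curve_pos s = N \<or> P2.curve_pos s = C"
        "P3.curve_pos s = N \<or> P3.curve_pos s = C" and neg_NC: "P.curve_neg s = N \<or> P.curve_neg s = C"
        "P2.curve_neg s = N \<or> P2.curve_neg s = C" "P3.curve_neg s = N \<or> P3.curve_neg s = C"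
        using t1 t2 t3 by blast+
      have gap: "0 \<le> x2 \<or> x3 \<le> 0"
      proof (rule ccontr)
        assume "\<not> ?thesis"
        then have c: "x2 < 0" "0 < x3" by auto
        have "k2 * (0 - x1) * (0 - x2) * (0 - x3) < 0"
          using c x k2 by (intro mult_pos_neg mult_pos_pos) auto
        then show False using F00 unfolding F by linarith
      qed
      show ?thesis
      proof (cases "x3 \<le> 0")
        case True
        then have s0: "s < 0" using s by simp
        have "blows_up A X"
        proof (rule blow[where ?s3.0 = x3 and ?k1.0 = "k2 * ((x3 - x1) + (x3 - x2))" and ?k0.0 = "k2 * ((x3 - x1) * (x3 - x2))"])
          show "P.F t = (t - x3) * (k2 * (t - x3)\<^sup>2 + k2 * ((x3 - x1) + (x3 - x2)) * (t - x3) + k2 * ((x3 - x1) * (x3 - x2)))" for t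
            unfolding F by (simp add: algebra_simps power2_eq_square)
          show "k2 * v\<^sup>2 + k2 * ((x3 - x1) + (x3 - x2)) * v + k2 * ((x3 - x1) * (x3 - x2)) > 0" if "v \<ge> 0" for v
          proof -
            have "k2 * ((v + (x3 - x1)) * (v + (x3 - x2))) > 0"
              using that x k2 by (intro mult_pos_pos) auto
            then show ?thesis by (simp add: algebra_simps power2_eq_square)
          qed
        qed (rule True)
        moreover have "(hexagon_type A X 0 6 \<or> hexagon_type A X 4 2) \<and> \<not> hexagon_type A X 6 0 \<and> \<not> hexagon_type A X 2 4"
          unfolding type count_pos(1)[OF pos_NC s0 s0 s0] count_pos(2)[OF pos_NC s0 s0 s0]
          using pos_cases CN by (elim disjE conjE) simp_all
        ultimately show ?thesis by blast
      next
        case False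
        then have x2: "0 \<le> x2" and s0: "0 < s" using gap s by auto
        have bd: "\<exists>C. \<forall>t\<in>{0..<T}. norm (x t) \<le> C"
          if Y: "Y = X \<or> Y = transpose X" and x0: "x 0 = Y" and T: "T > 0"
            and sol: "\<And>t. t \<in> {0..<T} \<Longrightarrow> (x has_vector_derivative flow_field A (x t)) (at t within {0..<T})" for Y x T
          by (rule flow_bounded_component[OF _ \<eta> b b1nz inv[OF Y, folded x0] T sol F[unfolded P.F_def] k2 x x2])
             (auto simp: diagonal)
        have "\<not> blows_up A X" "exists_for_all_times A X"
          by (rule bounded_solutions_exist_globally; (rule diagonal | rule bd); assumption)+
        moreover have "\<not> hexagon_type A X 0 6 \<and> \<not> hexagon_type A X 4 2"
          unfolding type count_neg(1)[OF neg_NC s0 s0 s0] count_neg(2)[OF neg_NC s0 s0 s0]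
          using neg_cases CN by (elim disjE conjE) simp_all
        ultimately show ?thesis by blast
      qed
    qed
    ultimately show ?thesis by blast
  qed
qed

end
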